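(* Let $(\mathcal{R},\partial,\int)$ be an integro-differential ring with constants $\mathcal{K}=\mathcal{C}$ and let $\Phi$ be a set of $\mathcal{K}$-linear functionals $\mathcal{R}\to\mathcal{K}$ including the induced evaluation $\mathrm{E}$. Let the $\mathcal{K}$-bimodule $M=M_{\mathsf R}\oplus M_{\mathsf D}\oplus M_{\mathsf I}\oplus M_{\mathsf\Phi}$, the ring of integro-differential operators with functionals $\mathcal{R}\langle\partial,\int,\Phi\rangle$, and the tensor reduction system $\Sigma_{\mathrm{IDO}\Phi}$ on $\mathcal{K}\langle M\rangle$ be defined as in the context. Then every $t\in\mathcal{K}\langle M\rangle$ has a unique normal form $t\!\downarrow_{\Sigma_{\mathrm{IDO}\Phi}}\in\mathcal{K}\langle M\rangle$, which can be written as a $\mathcal{K}$-linear combination of pure tensors of the form $$\textstyle f\otimes\partial^{\otimes j},\quad f\otimes\int\otimes g,\quad f\otimes\varphi\otimes h\otimes\partial^{\otimes j},\quad\text{or}\quad f\otimes\varphi\otimes h\otimes\int\otimes g$$ where $j\in\mathbb{N}_0$, $f,g,h\in\int\mathcal{R}$, $\varphi\in\Phi$, and each of $f,g,h$ may be absent such that $\varphi\otimes h\otimes\int$ does not specialize to $\mathrm{E}\otimes\int$ (i.e. in the last form $h$ may not be absent when $\varphi=\mathrm{E}$). Moreover, $$\textstyle\mathcal{R}\langle\partial,\int,\Phi\rangle\cong\mathcal{K}\langle M\rangle_{\mathrm{irr}}$$ as $\mathcal{K}$-rings, where multiplication on $\mathcal{K}\langle M\rangle_{\mathrm{irr}}$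 is defined by $s\cdot t:=(s\otimes t)\!\downarrow_{\Sigma_{\mathrm{IDO}\Phi}}$.
   Context: Rings are unital, nonzero, not necessarily commutative. A derivation on $\mathcal{R}$ is an additive map $\partial$ with $\partial(fg)=(\partial f)g+f\,\partial g$; $\mathcal{C}=\{f:\partial f=0\}$ is the ring of constants. "$\mathcal{C}$-linear" means homomorphism of $\mathcal{C}$-bimodules. An integro-differential ring $(\mathcal{R},\partial,\int)$ is a differential ring with a $\mathcal{C}$-linear map $\int\colon\mathcal{R}\to\mathcal{R}$ satisfying $\partial\int f=f$. Its induced evaluation is $\mathrm{E}f:=f-\int\partial f\in\mathcal{C}$, and $\mathcal{R}=\mathcal{C}\oplus\int\mathcal{R}$ as $\mathcal{C}$-bimodules. Module: $M_{\mathsf R}:=\mathcal{R}=M_{\mathsf K}\oplus M_{\tilde{\mathsf R}}$ with $M_{\mathsf K}:=\mathcal{K}$ and $M_{\tilde{\mathsf R}}:=\int\mathcal{R}$; $M_{\mathsf D}:=\mathcal{K}\partial$ and $M_{\mathsf I}:=\mathcal{K}\int$ are free left $\mathcal{K}$-modules on the symbols $\partial,\int$, and $M_{\mathsf\Phi}:=\mathcal{K}\Phi$ is the free left $\mathcal{K}$-module on the elements of $\Phi$; they are made into bimodules by $(c\,s)\cdot d=cd\,s$ for $c,d\in\mathcal{K}$ and $s$ a basis symbol. $M_{\mathsf\Phi}=M_{\mathsf E}\oplus M_{\tilde{\mathsf\Phi}}$ where $M_{\mathsf E}=\mathcal{K}\mathrm{E}$ and $M_{\tilde{\mathsf\Phi}}$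 is generated by $\Phi\setminus\{\mathrm{E}\}$. The tensor ring is $\mathcal{K}\langle M\rangle=\bigoplus_{n\ge0}M^{\otimes n}$ (bimodule tensor products over $\mathcal{K}$, $M^{\otimes0}=\mathcal{K}\varepsilon$, with $\varepsilon$ the empty tensor, multiplication $\otimes$). A $\mathcal{K}$-ring is a ring that is a $\mathcal{K}$-bimodule with $(xy)z=x(yz)$ for all $x,y,z$ in the ring or $\mathcal{K}$. Operator ring: $\mathcal{R}\langle\partial,\int,\Phi\rangle:=\mathcal{K}\langle M\rangle/I_{\mathrm{IDO}\Phi}$, where $I_{\mathrm{IDO}\Phi}$ is the two-sided ideal generated by the following elements, for $f,g\in\mathcal{R}$, $\varphi,\psi\in\Phi$: $1-\varepsilon$ (with $1\in M_{\mathsf K}$), $f\otimes g-fg$, $\partial\otimes f-f\otimes\partial-\partial f$, $\partial\otimes\int-\varepsilon$, $\int\otimes\partial-\varepsilon+\mathrm{E}$, $\partial\otimes f\otimes\varphi-\partial f\otimes\varphi$, $\int\otimes f\otimes\varphi-\int f\otimes\varphi$, $\varphi\otimes f\otimes\psi-(\varphi f)\psi$. Words: $X=\{\mathsf K,\tilde{\mathsf R},\mathsf D,\mathsf I,\mathsf E,\tilde{\mathsf\Phi}\}$, $Z=X\cup\{\mathsf R,\mathsf\Phi\}$; for a word $W=w_1\cdots w_n$ over $Z$, $M_W:=M_{w_1}\otimes\dots\otimes M_{w_n}$. The specializations of $W$ are the words over $X$ obtained by replacing each letter $\mathsf R$ by $\mathsf K$ or $\tilde{\mathsf R}$ and each letter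 $\mathsf\Phi$ by $\mathsf E$ or $\tilde{\mathsf\Phi}$. Reductions: a reduction rule is a pair $(W,h)$ with a $\mathcal{K}$-bimodule homomorphism $h\colon M_W\to\mathcal{K}\langle M\rangle$; it reduces $a\otimes w\otimes b$ to $a\otimes h(w)\otimes b$ for $w\in M_W$, $a\in M_A$, $b\in M_B$ with words $A,B$ (and a sum of tensors by reducing a summand). For a set $\Sigma$ of rules, $t$ can be reduced to $s$ if $s$ arises from $t$ by finitely many (possibly zero) such steps. A word over $X$ is irreducible if it contains no subword that is a specialization of a word $W$ with $(W,h)\in\Sigma$; $\mathcal{K}\langle M\rangle_{\mathrm{irr}}:=\bigoplus M_W$ over all irreducible words $W$ over $X$. A normal form of $t$ is an element of $\mathcal{K}\langle M\rangle_{\mathrm{irr}}$ to which $t$ can be reduced; if unique it is denoted $t\!\downarrow_\Sigma$. $\Sigma_{\mathrm{IDO}\Phi}$ consists of the rules (for $f,g\in\mathcal{R}$ and $\varphi,\psi\in\Phi$, extended to bimodule homomorphisms): $\mathsf K$: $1\mapsto\varepsilon$; $\mathsf{RR}$: $f\otimes g\mapsto fg$; $\mathsf{DR}$: $\partial\otimes f\mapsto f\otimes\partial+\partial f$; $\mathsf{D\Phi}$: $\partial\otimes\varphi\mapsto0$; $\mathsf{DI}$: $\partial\otimes\int\mapsto\varepsilon$; $\mathsf{\Phi R\Phi}$: $\varphi\otimes f\otimes\psi\mapsto(\varphi f)\psi$; $\mathsf{\Phi\Phi}$: $\varphi\otimes\psi\mapsto(\varphi1)\psi$; $\mathsf{EI}$: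 $\mathrm{E}\otimes\int\mapsto0$; $\mathsf{IRD}$: $\int\otimes f\otimes\partial\mapsto f-\mathrm{E}\otimes f-\int\otimes\partial f$; $\mathsf{IR\Phi}$: $\int\otimes f\otimes\varphi\mapsto\int f\otimes\varphi$; $\mathsf{IRI}$: $\int\otimes f\otimes\int\mapsto\int f\otimes\int-\mathrm{E}\otimes\int f\otimes\int-\int\otimes\int f$; $\mathsf{ID}$: $\int\otimes\partial\mapsto\varepsilon-\mathrm{E}$; $\mathsf{I\Phi}$: $\int\otimes\varphi\mapsto\int1\otimes\varphi$; $\mathsf{II}$: $\int\otimes\int\mapsto\int1\otimes\int-\mathrm{E}\otimes\int1\otimes\int-\int\otimes\int1$. Here $\partial f,\int f,\int1$ denote elements of $\mathcal{R}=M_{\mathsf R}$ and $\varphi f,\varphi1$ elements of $\mathcal{K}$, while isolated $\partial,\int,\mathrm{E},\varphi,\psi$ denote the symbols. *)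

theory Defs
  imports "HOL-Algebra.Algebra" "HOL-Library.Poly_Mapping" "HOL-Library.Product_Plus"
    "HOL-Library.Sublist"
begin

section \<open>Rings that are bimodules over a subring\<close>

record ('k, 'a) bimod_ring = "'a ring" +
  lsmult :: "'k \<Rightarrow> 'a \<Rightarrow> 'a"
  rsmult :: "'a \<Rightarrow> 'k \<Rightarrow> 'a"

definition K_bimodule :: "'k::ring_1 set \<Rightarrow> ('k, 'a) bimod_ring \<Rightarrow> bool" where
  "K_bimodule K A \<longleftrightarrow> abelian_group A \<and>
    (\<forall>k\<in>K. \<forall>x\<in>carrier A. lsmult A k x \<in> carrier A \<and> rsmult A x k \<in> carrier A) \<and>
    (\<forall>k\<in>K. \<forall>x\<in>carrier A. \<forall>y\<in>carrier A.
       lsmult A k (x \<oplus>\<^bsub>A\<^esub> y) = lsmult A k x \<oplus>\<^bsub>A\<^esub> lsmult A k y \<and>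
       rsmult A (x \<oplus>\<^bsub>A\<^esub> y) k = rsmult A x k \<oplus>\<^bsub>A\<^esub> rsmult A y k) \<and>
    (\<forall>k\<in>K. \<forall>l\<in>K. \<forall>x\<in>carrier A.
       lsmult A (k + l) x = lsmult A k x \<oplus>\<^bsub>A\<^esub> lsmult A l x \<and>
       rsmult A x (k + l) = rsmult A x k \<oplus>\<^bsub>A\<^esub> rsmult A x l \<and>
       lsmult A (k * l) x = lsmult A k (lsmult A l x) \<and>
       rsmult A x (k * l) = rsmult A (rsmult A x k) l \<and>
       rsmult A (lsmult A k x) l = lsmult A k (rsmult A x l)) \<and>
    (\<forall>x\<in>carrier A. lsmult A 1 x = x \<and> rsmult A x 1 = x)"

definition K_ring :: "'k::ring_1 set \<Rightarrow> ('k, 'a) bimod_ring \<Rightarrow> bool" where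
  "K_ring K A \<longleftrightarrow> ring A \<and> K_bimodule K A \<and>
    (\<forall>k\<in>K. \<forall>x\<in>carrier A. \<forall>y\<in>carrier A.
       lsmult A k x \<otimes>\<^bsub>A\<^esub> y = lsmult A k (x \<otimes>\<^bsub>A\<^esub> y) \<and>
       rsmult A x k \<otimes>\<^bsub>A\<^esub> y = x \<otimes>\<^bsub>A\<^esub> lsmult A k y \<and>
       rsmult A (x \<otimes>\<^bsub>A\<^esub> y) k = x \<otimes>\<^bsub>A\<^esub> rsmult A y k)"

definition K_ring_iso ::
    "'k set \<Rightarrow> ('k, 'a) bimod_ring \<Rightarrow> ('k, 'b) bimod_ring \<Rightarrow> ('a \<Rightarrow> 'b) set" where
  "K_ring_iso K A B = {h \<in> ring_iso A B. \<forall>k\<in>K. \<forall>x\<in>carrier A.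
     h (lsmult A k x) = lsmult B k (h x) \<and> h (rsmult A x k) = rsmult B (h x) k}"

definition with_scalars :: "'a ring \<Rightarrow> ('k \<Rightarrow> 'a) \<Rightarrow> ('k, 'a) bimod_ring" where
  "with_scalars A \<iota> =
    \<lparr>carrier = carrier A, monoid.mult = (\<otimes>\<^bsub>A\<^esub>), one = \<one>\<^bsub>A\<^esub>, ring.zero = \<zero>\<^bsub>A\<^esub>, ring.add = (\<oplus>\<^bsub>A\<^esub>),
     lsmult = (\<lambda>k x. \<iota> k \<otimes>\<^bsub>A\<^esub> x), rsmult = (\<lambda>x k. x \<otimes>\<^bsub>A\<^esub> \<iota> k)\<rparr>"


section \<open>Integro-differential rings with functionals\<close>

locale int_diff_ring =
  fixes d J :: "'r::ring_1 \<Rightarrow> 'r"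
  assumes d_add: "d (f + g) = d f + d g"
    and d_mult: "d (f * g) = d f * g + f * d g"
    and J_add: "J (f + g) = J f + J g"
    and J_left: "d c = 0 \<Longrightarrow> J (c * f) = c * J f"
    and J_right: "d c = 0 \<Longrightarrow> J (f * c) = J f * c"
    and d_J: "d (J f) = f"
begin

definition constants :: "'r set" where
  "constants = {c. d c = 0}"

definition evaluation :: "'r \<Rightarrow> 'r" where
  "evaluation f = f - J (d f)"

definition linear_functional :: "('r \<Rightarrow> 'r) \<Rightarrow> bool" where
  "linear_functional \<phi> \<longleftrightarrow>
    (\<forall>f. \<phi> f \<in> constants) \<and> (\<forall>f g. \<phi> (f + g) = \<phi> f + \<phi> g) \<and>
    (\<forall>c\<in>constants. \<forall>f. \<phi> (c * f) = c * \<phi> f \<and> \<phi> (f * c) = \<phi> f * c)"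

end

locale ido_functionals = int_diff_ring d J
  for d J :: "'r::ring_1 \<Rightarrow> 'r" +
  fixes \<Phi> :: "('r \<Rightarrow> 'r) set"
  assumes functionals: "\<phi> \<in> \<Phi> \<Longrightarrow> linear_functional \<phi>"
    and evaluation_in: "evaluation \<in> \<Phi>"


section \<open>The bimodule of generators\<close>

text \<open>The symbols \<open>\<partial>\<close>, \<open>\<integral>\<close> and \<open>\<phi> \<in> \<Phi>\<close>. The evaluation symbol is \<open>Fsym evaluation\<close>.\<close>

datatype 'r symb = Dsym | Isym | Fsym "'r \<Rightarrow> 'r"

text \<open>An element of \<open>M = M\<^sub>R \<oplus> M\<^sub>D \<oplus> M\<^sub>I \<oplus> M\<^sub>\<Phi>\<close> is an element of the ring together
  with a finitely supported family of constants indexed by the symbols.\<close>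

type_synonym 'r gens = "'r \<times> ('r symb \<Rightarrow>\<^sub>0 'r)"

definition rg :: "'r::ring_1 \<Rightarrow> 'r gens" where
  "rg f = (f, 0)"

definition sy :: "'r::ring_1 \<Rightarrow> 'r symb \<Rightarrow> 'r gens" where
  "sy c s = (0, Poly_Mapping.single s c)"

definition lact :: "'r::ring_1 \<Rightarrow> 'r gens \<Rightarrow> 'r gens" where
  "lact k m = (k * fst m, Poly_Mapping.map (\<lambda>c. k * c) (snd m))"

text \<open>Basis symbols commute with scalars, \<open>(c s) \<cdot> k = (c k) s\<close>.\<close>

definition ract :: "'r::ring_1 gens \<Rightarrow> 'r \<Rightarrow> 'r gens" where
  "ract m k = (fst m * k, Poly_Mapping.map (\<lambda>c. c * k) (snd m))"


section \<open>The tensor ring\<close>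

text \<open>A pair \<open>(c, [m\<^sub>1, \<dots>, m\<^sub>n])\<close> stands for \<open>c \<cdot> m\<^sub>1 \<otimes> \<dots> \<otimes> m\<^sub>n\<close>, which is \<open>c \<epsilon>\<close> if \<open>n = 0\<close>.
  The leading scalar makes \<open>M\<^sup>\<otimes>\<^sup>0 = K \<epsilon>\<close> an instance of the general case; for \<open>n \<ge> 1\<close> it can be
  moved into the first factor.\<close>

type_synonym 'r word = "'r \<times> 'r gens list"

type_synonym 'r tensor = "('r word \<Rightarrow>\<^sub>0 int) set"

fun word_mult :: "'r::ring_1 word \<Rightarrow> 'r word \<Rightarrow> 'r word" where
  "word_mult (c, ms) (c', ns) =
    (if ms = [] then (c * c', ns) else (c, butlast ms @ [ract (last ms) c'] @ ns))"

datatype letter = L\<^sub>K | L\<^sub>R\<^sub>t | L\<^sub>D | L\<^sub>I | L\<^sub>E | L\<^sub>\<Phi>\<^sub>t | L\<^sub>R | L\<^sub>\<Phi>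

definition letters_X :: "letter set" where
  "letters_X = {L\<^sub>K, L\<^sub>R\<^sub>t, L\<^sub>D, L\<^sub>I, L\<^sub>E, L\<^sub>\<Phi>\<^sub>t}"

fun letter_spec :: "letter \<Rightarrow> letter set" where
  "letter_spec L\<^sub>R = {L\<^sub>K, L\<^sub>R\<^sub>t}"
| "letter_spec L\<^sub>\<Phi> = {L\<^sub>E, L\<^sub>\<Phi>\<^sub>t}"
| "letter_spec x = {x}"

definition specializations :: "letter list \<Rightarrow> letter list set" where
  "specializations W = {V. list_all2 (\<lambda>w v. v \<in> letter_spec w) W V}"

context ido_functionals
begin

abbreviation K :: "'r set" where
  "K \<equiv> constants"

abbreviation E :: "'r \<Rightarrow> 'r" where
  "E \<equiv> evaluation"

definition gen_module :: "'r gens set" where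
  "gen_module = {(f, p). range (Poly_Mapping.lookup p) \<subseteq> K \<and>
     Poly_Mapping.keys p \<subseteq> {Dsym, Isym} \<union> Fsym ` \<Phi>}"

definition free_word_ring :: "('r word \<Rightarrow>\<^sub>0 int) ring" where
  "free_word_ring =
    \<lparr>carrier = {x. Poly_Mapping.keys x \<subseteq> K \<times> lists gen_module},
     monoid.mult = (\<lambda>x y. frag_extend (\<lambda>u. frag_extend (\<lambda>v. frag_of (word_mult u v)) y) x),
     one = frag_of (1, []), ring.zero = 0, ring.add = (+)\<rparr>"

text \<open>The relations defining the tensor powers over \<open>K\<close>: additivity in every slot, and
  balancedness between adjacent slots.\<close>

definition tensor_relations :: "('r word \<Rightarrow>\<^sub>0 int) set" where
  "tensor_relations =
    {frag_of (c + c', ms) - frag_of (c, ms) - frag_of (c', ms) | c c' ms.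
       c \<in> K \<and> c' \<in> K \<and> ms \<in> lists gen_module} \<union>
    {frag_of (c, ms @ [m + m'] @ ns) - frag_of (c, ms @ [m] @ ns) - frag_of (c, ms @ [m'] @ ns)
       | c ms m m' ns. c \<in> K \<and> {m, m'} \<subseteq> gen_module \<and>
           ms \<in> lists gen_module \<and> ns \<in> lists gen_module} \<union>
    {frag_of (c * k, [m] @ ns) - frag_of (c, [lact k m] @ ns) | c k m ns.
       c \<in> K \<and> k \<in> K \<and> m \<in> gen_module \<and> ns \<in> lists gen_module} \<union>
    {frag_of (c, ms @ [ract m k, m'] @ ns) - frag_of (c, ms @ [m, lact k m'] @ ns)
       | c k ms m m' ns. c \<in> K \<and> k \<in> K \<and> {m, m'} \<subseteq> gen_module \<and>
           ms \<in> lists gen_module \<and> ns \<in> lists gen_module}"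

text \<open>Every relation is homogeneous in the length of words, so that the quotient is the direct sum
  of the tensor powers. The generated additive subgroup is already a two-sided ideal.\<close>

definition tensor_null :: "('r word \<Rightarrow>\<^sub>0 int) set" where
  "tensor_null = generate (add_monoid free_word_ring) tensor_relations"

definition pure :: "'r \<Rightarrow> 'r gens list \<Rightarrow> 'r tensor" where
  "pure c ms = tensor_null +>\<^bsub>free_word_ring\<^esub> frag_of (c, ms)"

text \<open>The action of \<open>k \<in> K\<close> is multiplication by \<open>k \<epsilon>\<close>; by the definition of \<^const>\<open>word_mult\<close>
  this is the given action on the first, respectively last, tensor factor.\<close>

definition T :: "('r, 'r tensor) bimod_ring" where
  "T = with_scalars (free_word_ring Quot tensor_null) (\<lambda>k. pure k [])"

definition additive_span :: "'r tensor set \<Rightarrow> 'r tensor set" where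
  "additive_span S = generate (add_monoid T) S"

definition K_span :: "'r tensor set \<Rightarrow> 'r tensor set" where
  "K_span S = additive_span {lsmult T k x | k x. k \<in> K \<and> x \<in> S}"

abbreviation tens :: "'r gens list \<Rightarrow> 'r tensor" where
  "tens ms \<equiv> pure 1 ms"

abbreviation \<epsilon> :: "'r tensor" where
  "\<epsilon> \<equiv> tens []"

abbreviation D :: "'r gens" where
  "D \<equiv> sy 1 Dsym"

abbreviation I :: "'r gens" where
  "I \<equiv> sy 1 Isym"

abbreviation F :: "('r \<Rightarrow> 'r) \<Rightarrow> 'r gens" where
  "F \<phi> \<equiv> sy 1 (Fsym \<phi>)"


section \<open>Words\<close>

fun letter_module :: "letter \<Rightarrow> 'r gens set" where
  "letter_module L\<^sub>R = range rg"
| "letter_module L\<^sub>K = rg ` K"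
| "letter_module L\<^sub>R\<^sub>t = rg ` range J"
| "letter_module L\<^sub>D = {sy c Dsym | c. c \<in> K}"
| "letter_module L\<^sub>I = {sy c Isym | c. c \<in> K}"
| "letter_module L\<^sub>E = {sy c (Fsym E) | c. c \<in> K}"
| "letter_module L\<^sub>\<Phi>\<^sub>t = {m \<in> gen_module. fst m = 0 \<and> Poly_Mapping.keys (snd m) \<subseteq> Fsym ` (\<Phi> - {E})}"
| "letter_module L\<^sub>\<Phi> = {m \<in> gen_module. fst m = 0 \<and> Poly_Mapping.keys (snd m) \<subseteq> Fsym ` \<Phi>}"

text \<open>Since the letters denote direct summands of \<open>M\<close>, the tensor product of the corresponding
  modules is a direct summand of the tensor power of \<open>M\<close>.\<close>

definition word_module :: "letter list \<Rightarrow> 'r tensor set" where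
  "word_module W = additive_span
    {pure c ms | c ms. c \<in> K \<and> list_all2 (\<lambda>w m. m \<in> letter_module w) W ms}"


section \<open>Tensor reduction systems\<close>

definition bimodule_homs :: "letter list \<Rightarrow> ('r tensor \<Rightarrow> 'r tensor) set" where
  "bimodule_homs W = {h \<in> word_module W \<rightarrow>\<^sub>E carrier T.
     (\<forall>x\<in>word_module W. \<forall>y\<in>word_module W. h (x \<oplus>\<^bsub>T\<^esub> y) = h x \<oplus>\<^bsub>T\<^esub> h y) \<and>
     (\<forall>k\<in>K. \<forall>x\<in>word_module W.
        h (lsmult T k x) = lsmult T k (h x) \<and> h (rsmult T x k) = rsmult T (h x) k)}"

type_synonym 'a rules = "(letter list \<times> ('a tensor \<Rightarrow> 'a tensor)) set"

definition reduces_step :: "'r rules \<Rightarrow> 'r tensor \<Rightarrow> 'r tensor \<Rightarrow> bool" where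
  "reduces_step \<Sigma> t s \<longleftrightarrow>
    (\<exists>(W, h)\<in>\<Sigma>. \<exists>A B. \<exists>a\<in>word_module A. \<exists>w\<in>word_module W. \<exists>b\<in>word_module B. \<exists>r\<in>carrier T.
       t = r \<oplus>\<^bsub>T\<^esub> a \<otimes>\<^bsub>T\<^esub> w \<otimes>\<^bsub>T\<^esub> b \<and> s = r \<oplus>\<^bsub>T\<^esub> a \<otimes>\<^bsub>T\<^esub> h w \<otimes>\<^bsub>T\<^esub> b)"

definition irreducible_word :: "'r rules \<Rightarrow> letter list \<Rightarrow> bool" where
  "irreducible_word \<Sigma> V \<longleftrightarrow> V \<in> lists letters_X \<and>
    \<not> (\<exists>(W, h)\<in>\<Sigma>. \<exists>S\<in>specializations W. sublist S V)"

definition irreducibles :: "'r rules \<Rightarrow> 'r tensor set" where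
  "irreducibles \<Sigma> = additive_span (\<Union>W\<in>{W. irreducible_word \<Sigma> W}. word_module W)"

definition is_normal_form :: "'r rules \<Rightarrow> 'r tensor \<Rightarrow> 'r tensor \<Rightarrow> bool" where
  "is_normal_form \<Sigma> t s \<longleftrightarrow> s \<in> irreducibles \<Sigma> \<and> (reduces_step \<Sigma>)\<^sup>*\<^sup>* t s"

definition normal_form :: "'r rules \<Rightarrow> 'r tensor \<Rightarrow> 'r tensor" where
  "normal_form \<Sigma> t = (THE s. is_normal_form \<Sigma> t s)"

definition irreducible_ring :: "'r rules \<Rightarrow> ('r, 'r tensor) bimod_ring" where
  "irreducible_ring \<Sigma> =
    \<lparr>carrier = irreducibles \<Sigma>, monoid.mult = (\<lambda>s t. normal_form \<Sigma> (s \<otimes>\<^bsub>T\<^esub> t)),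
     one = \<one>\<^bsub>T\<^esub>, ring.zero = \<zero>\<^bsub>T\<^esub>, ring.add = (\<oplus>\<^bsub>T\<^esub>), lsmult = lsmult T, rsmult = rsmult T\<rparr>"


section \<open>Integro-differential operators with functionals\<close>

text \<open>A homomorphism on \<^term>\<open>word_module W\<close> that takes the values prescribed below is unique, as
  these tensors generate the bimodule and \<^const>\<open>bimodule_homs\<close> is extensional.\<close>

definition rule :: "letter list \<Rightarrow> (('r tensor \<Rightarrow> 'r tensor) \<Rightarrow> bool) \<Rightarrow> 'r rules" where
  "rule W P = {(W, h) | h. h \<in> bimodule_homs W \<and> P h}"

definition \<Sigma>_IDO :: "'r rules" where
  "\<Sigma>_IDO =
    rule [L\<^sub>K] (\<lambda>h. h (tens [rg 1]) = \<epsilon>) \<union>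
    rule [L\<^sub>R, L\<^sub>R] (\<lambda>h. \<forall>f g. h (tens [rg f, rg g]) = tens [rg (f * g)]) \<union>
    rule [L\<^sub>D, L\<^sub>R] (\<lambda>h. \<forall>f. h (tens [D, rg f]) = tens [rg f, D] \<oplus>\<^bsub>T\<^esub> tens [rg (d f)]) \<union>
    rule [L\<^sub>D, L\<^sub>\<Phi>] (\<lambda>h. \<forall>\<phi>\<in>\<Phi>. h (tens [D, F \<phi>]) = \<zero>\<^bsub>T\<^esub>) \<union>
    rule [L\<^sub>D, L\<^sub>I] (\<lambda>h. h (tens [D, I]) = \<epsilon>) \<union>
    rule [L\<^sub>\<Phi>, L\<^sub>R, L\<^sub>\<Phi>] (\<lambda>h. \<forall>f. \<forall>\<phi>\<in>\<Phi>. \<forall>\<psi>\<in>\<Phi>.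
      h (tens [F \<phi>, rg f, F \<psi>]) = tens [sy (\<phi> f) (Fsym \<psi>)]) \<union>
    rule [L\<^sub>\<Phi>, L\<^sub>\<Phi>] (\<lambda>h. \<forall>\<phi>\<in>\<Phi>. \<forall>\<psi>\<in>\<Phi>. h (tens [F \<phi>, F \<psi>]) = tens [sy (\<phi> 1) (Fsym \<psi>)]) \<union>
    rule [L\<^sub>E, L\<^sub>I] (\<lambda>h. h (tens [F E, I]) = \<zero>\<^bsub>T\<^esub>) \<union>
    rule [L\<^sub>I, L\<^sub>R, L\<^sub>D] (\<lambda>h. \<forall>f. h (tens [I, rg f, D]) =
      tens [rg f] \<ominus>\<^bsub>T\<^esub> tens [F E, rg f] \<ominus>\<^bsub>T\<^esub> tens [I, rg (d f)]) \<union>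
    rule [L\<^sub>I, L\<^sub>R, L\<^sub>\<Phi>] (\<lambda>h. \<forall>f. \<forall>\<phi>\<in>\<Phi>. h (tens [I, rg f, F \<phi>]) = tens [rg (J f), F \<phi>]) \<union>
    rule [L\<^sub>I, L\<^sub>R, L\<^sub>I] (\<lambda>h. \<forall>f. h (tens [I, rg f, I]) =
      tens [rg (J f), I] \<ominus>\<^bsub>T\<^esub> tens [F E, rg (J f), I] \<ominus>\<^bsub>T\<^esub> tens [I, rg (J f)]) \<union>
    rule [L\<^sub>I, L\<^sub>D] (\<lambda>h. h (tens [I, D]) = \<epsilon> \<ominus>\<^bsub>T\<^esub> tens [F E]) \<union>
    rule [L\<^sub>I, L\<^sub>\<Phi>] (\<lambda>h. \<forall>\<phi>\<in>\<Phi>. h (tens [I, F \<phi>]) = tens [rg (J 1), F \<phi>]) \<union>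
    rule [L\<^sub>I, L\<^sub>I] (\<lambda>h. h (tens [I, I]) =
      tens [rg (J 1), I] \<ominus>\<^bsub>T\<^esub> tens [F E, rg (J 1), I] \<ominus>\<^bsub>T\<^esub> tens [I, rg (J 1)])"

definition IDO_generators :: "'r tensor set" where
  "IDO_generators =
    {tens [rg 1] \<ominus>\<^bsub>T\<^esub> \<epsilon>} \<union>
    {tens [rg f, rg g] \<ominus>\<^bsub>T\<^esub> tens [rg (f * g)] | f g. True} \<union>
    {tens [D, rg f] \<ominus>\<^bsub>T\<^esub> tens [rg f, D] \<ominus>\<^bsub>T\<^esub> tens [rg (d f)] | f. True} \<union>
    {tens [D, I] \<ominus>\<^bsub>T\<^esub> \<epsilon>} \<union>
    {tens [I, D] \<ominus>\<^bsub>T\<^esub> \<epsilon> \<oplus>\<^bsub>T\<^esub> tens [F E]} \<union>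
    {tens [D, rg f, F \<phi>] \<ominus>\<^bsub>T\<^esub> tens [rg (d f), F \<phi>] | f \<phi>. \<phi> \<in> \<Phi>} \<union>
    {tens [I, rg f, F \<phi>] \<ominus>\<^bsub>T\<^esub> tens [rg (J f), F \<phi>] | f \<phi>. \<phi> \<in> \<Phi>} \<union>
    {tens [F \<phi>, rg f, F \<psi>] \<ominus>\<^bsub>T\<^esub> tens [sy (\<phi> f) (Fsym \<psi>)] | f \<phi> \<psi>. \<phi> \<in> \<Phi> \<and> \<psi> \<in> \<Phi>}"

definition IDO_ideal :: "'r tensor set" where
  "IDO_ideal = genideal T IDO_generators"

definition IDO :: "('r, 'r tensor set) bimod_ring" where
  "IDO = with_scalars (T Quot IDO_ideal) (\<lambda>k. IDO_ideal +>\<^bsub>T\<^esub> pure k [])"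

text \<open>A possibly absent tensor factor from \<open>\<integral>R\<close>.\<close>

definition optional_JR :: "'r gens list set" where
  "optional_JR = insert [] {[rg (J f)] | f. True}"

definition normal_tensors :: "'r tensor set" where
  "normal_tensors =
    {tens (f @ replicate j D) | f j. f \<in> optional_JR} \<union>
    {tens (f @ [I] @ g) | f g. f \<in> optional_JR \<and> g \<in> optional_JR} \<union>
    {tens (f @ [F \<phi>] @ h @ replicate j D) | f \<phi> h j.
       f \<in> optional_JR \<and> \<phi> \<in> \<Phi> \<and> h \<in> optional_JR} \<union>
    {tens (f @ [F \<phi>] @ h @ [I] @ g) | f \<phi> h g.
       f \<in> optional_JR \<and> \<phi> \<in> \<Phi> \<and> h \<in> optional_JR \<and> g \<in> optional_JR \<and> \<not> (\<phi> = E \<and> h = [])}"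

end

end

theory Submission
  imports Defs
begin

text \<open>Existence of normal forms is shown by reducing the product of a generator with an irreducible
  tensor; every such product can be reduced by a short explicit computation (for \<open>\<integral> \<otimes> f \<otimes> \<partial>\<^sup>j\<close> by
  induction on \<open>j\<close>).

  For uniqueness, no confluence analysis is made. Instead, the irreducible tensors are modelled by an
  abelian group with generators \<open>f \<partial>\<^sup>j\<close>, \<open>f \<integral> g\<close>, \<open>f \<phi> h \<partial>\<^sup>j\<close> and \<open>f \<phi> h \<integral> g\<close> for arbitrary ring
  elements \<open>f\<close>, \<open>g\<close>, \<open>h\<close>, modulo additivity, balancedness over \<open>K\<close> and \<open>f E k \<integral> g = 0\<close> for
  constants \<open>k\<close>. The symbols act on it from the left by the expected formulas, and this turns it into
  a module over the tensor ring that is annihilated by the ideal of the operator relations. Letting a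
  tensor act on \<open>1\<close> and mapping the result back to the tensor ring, by the splitting
  \<open>f = E f + \<integral> \<partial> f\<close>, recovers every irreducible tensor. Hence the irreducible tensors meet the ideal
  trivially. Since each reduction rule holds modulo the ideal, normal forms are unique, and they
  represent the quotient by the ideal.\<close>

text \<open>The rings are noncommutative and no \<open>K\<close>-basis of the ring is at hand, so
  independence of the normal tensors cannot be read off from coefficients; a map from operators back
  to tensors is built instead. The model admits arbitrary ring elements because the range of
  \<integral> need not be closed under products or derivatives, so the formulas for the operators
  would leave it; the splitting into constants and integrals is postponed to the map back. The extra
  relation for \<open>E\<close> in front of \<integral> is forced: \<partial>\<integral> = 1 and
  \<integral>\<partial> = 1 - E give \<integral> = \<integral> - E\<integral>. In the model,
  \<integral>\<partial> = 1 - E would otherwise fail on f\<integral>g by the word with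
  \<open>E\<close> in front of (E f)\<integral>g. A separate obstacle is that a rule is an actual
  bimodule homomorphism. Irreducible words are those avoiding the words that carry such a
  homomorphism, so every rule needs an explicit multilinear witness before irreducibility can be
  described at all.\<close>

lemma lookup_map_zero: "g 0 = 0 \<Longrightarrow> Poly_Mapping.lookup (Poly_Mapping.map g p) s = g (Poly_Mapping.lookup p s)"
  by (transfer; simp add: when_def)

lemma fst_lact [simp]: "fst (lact k m) = k * fst m"
  and fst_ract [simp]: "fst (ract m k) = fst m * k"
  and lookup_lact [simp]: "Poly_Mapping.lookup (snd (lact k m)) s = k * Poly_Mapping.lookup (snd m) s"
  and lookup_ract [simp]: "Poly_Mapping.lookup (snd (ract m k)) s = Poly_Mapping.lookup (snd m) s * k"
  by (simp_all add: lact_def ract_def lookup_map_zero)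

lemma gens_eqI: "fst m = fst m' \<Longrightarrow> (\<And>s. Poly_Mapping.lookup (snd m) s = Poly_Mapping.lookup (snd m') s) \<Longrightarrow> m = m'"
  by (simp add: prod_eq_iff poly_mapping_eqI)

lemma ract_add: "ract (m + m') k = ract m k + ract m' k"
  and ract_add_scalar: "ract m (k + l) = ract m k + ract m l"
  and ract_ract: "ract (ract m k) l = ract m (k * l)"
  and ract_lact: "ract (lact k m) l = lact k (ract m l)"
  by (auto intro!: gens_eqI simp: lookup_add algebra_simps)

lemma ract_one [simp]: "ract m 1 = m" and lact_one [simp]: "lact 1 m = m"
  and ract_zero [simp]: "ract 0 k = 0" and lact_zero [simp]: "lact k 0 = 0"
  by (auto intro!: gens_eqI)

lemma rg_add: "rg (f + g) = rg f + rg g"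
  and lact_rg [simp]: "lact k (rg f) = rg (k * f)"
  and ract_rg [simp]: "ract (rg f) k = rg (f * k)"
  and rg_zero [simp]: "rg 0 = 0"
  by (auto intro!: gens_eqI simp: rg_def zero_prod_def)

lemma sy_add: "sy (c + c') s = sy c s + sy c' s"
  and lact_sy [simp]: "lact k (sy c s) = sy (k * c) s"
  and ract_sy [simp]: "ract (sy c s) k = sy (c * k) s"
  and sy_zero [simp]: "sy 0 s = 0"
  by (auto intro!: gens_eqI simp: sy_def zero_prod_def single_add lookup_single when_def)

section \<open>Constants and the induced evaluation\<close>

context int_diff_ring
begin

lemma d_zero [simp]: "d 0 = 0" using d_add[of 0 0] by simp
lemma J_zero [simp]: "J 0 = 0" using J_add[of 0 0] by simp
lemma d_minus: "d (- f) = - d f" using d_add[of f "-f"] by (simp add: minus_unique)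
lemma d_diff: "d (f - g) = d f - d g" using d_add[of f "-g"] by (simp add: d_minus)
lemma d_one [simp]: "d 1 = 0" using d_mult[of 1 1] by simp

lemma constants_zero [simp]: "0 \<in> constants"
  and constants_one [simp]: "1 \<in> constants"
  and constants_add [simp]: "c \<in> constants \<Longrightarrow> c' \<in> constants \<Longrightarrow> c + c' \<in> constants"
  and constants_diff [simp]: "c \<in> constants \<Longrightarrow> c' \<in> constants \<Longrightarrow> c - c' \<in> constants"
  and constants_minus [simp]: "c \<in> constants \<Longrightarrow> - c \<in> constants"
  and constants_mult [simp]: "c \<in> constants \<Longrightarrow> c' \<in> constants \<Longrightarrow> c * c' \<in> constants"
  by (auto simp: constants_def d_add d_diff d_minus d_mult)

lemma d_constant [simp]: "c \<in> constants \<Longrightarrow> d c = 0"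
  by (simp add: constants_def)

lemma d_scale [simp]: "c \<in> constants \<Longrightarrow> d (c * f) = c * d f" "c \<in> constants \<Longrightarrow> d (f * c) = d f * c"
  by (simp_all add: d_mult)

lemma J_scale [simp]: "c \<in> constants \<Longrightarrow> J (c * f) = c * J f" "c \<in> constants \<Longrightarrow> J (f * c) = J f * c"
  by (simp_all add: J_left J_right)

lemma evaluation_in_constants [simp]: "evaluation f \<in> constants"
  unfolding evaluation_def constants_def by (simp add: d_diff d_J del: d_constant)

lemma evaluation_constant [simp]: "c \<in> constants \<Longrightarrow> evaluation c = c"
  by (simp add: evaluation_def)

lemma evaluation_J [simp]: "evaluation (J f) = 0"
  by (simp add: evaluation_def d_J)

lemma evaluation_add: "evaluation (f + g) = evaluation f + evaluation g"
  by (simp add: evaluation_def d_add J_add)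

lemma evaluation_scale [simp]:
  "c \<in> constants \<Longrightarrow> evaluation (c * f) = c * evaluation f"
  "c \<in> constants \<Longrightarrow> evaluation (f * c) = evaluation f * c"
  by (simp_all add: evaluation_def algebra_simps)

lemma evaluation_decomp: "f = evaluation f + J (d f)"
  by (simp add: evaluation_def)

end

section \<open>Functionals and the module of generators\<close>

context ido_functionals
begin

lemma functional_in_constants [simp]: "\<phi> \<in> \<Phi> \<Longrightarrow> \<phi> f \<in> K"
  and functional_add: "\<phi> \<in> \<Phi> \<Longrightarrow> \<phi> (f + g) = \<phi> f + \<phi> g"
  and functional_scale [simp]: "\<phi> \<in> \<Phi> \<Longrightarrow> c \<in> K \<Longrightarrow> \<phi> (c * f) = c * \<phi> f"
    "\<phi> \<in> \<Phi> \<Longrightarrow> c \<in> K \<Longrightarrow> \<phi> (f * c) = \<phi> f * c"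
  using functionals by (auto simp: linear_functional_def)

lemma evaluation_in_Phi [simp]: "E \<in> \<Phi>" by (rule evaluation_in)

lemma gen_module_iff:
  "m \<in> gen_module \<longleftrightarrow> (\<forall>s. Poly_Mapping.lookup (snd m) s \<in> K) \<and>
     (\<forall>s. Poly_Mapping.lookup (snd m) s \<noteq> 0 \<longrightarrow> s \<in> {Dsym, Isym} \<union> Fsym ` \<Phi>)"
  by (cases m) (auto simp: gen_module_def in_keys_iff subset_iff image_subset_iff)

lemma gen_module_add [simp]: "m \<in> gen_module \<Longrightarrow> m' \<in> gen_module \<Longrightarrow> m + m' \<in> gen_module"
  unfolding gen_module_iff by (simp add: lookup_add) (metis add_0)

lemma gen_module_zero [simp]: "0 \<in> gen_module"
  by (simp add: gen_module_iff)

lemma gen_module_lact [simp]: "k \<in> K \<Longrightarrow> m \<in> gen_module \<Longrightarrow> lact k m \<in> gen_module"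
  and gen_module_ract [simp]: "k \<in> K \<Longrightarrow> m \<in> gen_module \<Longrightarrow> ract m k \<in> gen_module"
  unfolding gen_module_iff by (simp_all del: Un_iff) (metis mult_zero_left mult_zero_right)+

lemma rg_in [simp]: "rg f \<in> gen_module"
  by (simp add: gen_module_iff rg_def)

lemma sy_in [simp]: "c \<in> K \<Longrightarrow> s \<in> {Dsym, Isym} \<union> Fsym ` \<Phi> \<Longrightarrow> sy c s \<in> gen_module"
  unfolding gen_module_iff by (auto simp: sy_def lookup_single when_def)

end
subsection \<open>The tensor ring\<close>

abbreviation frag_mult :: "('r::ring_1 word \<Rightarrow>\<^sub>0 int) \<Rightarrow> ('r word \<Rightarrow>\<^sub>0 int) \<Rightarrow> ('r word \<Rightarrow>\<^sub>0 int)" where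
  "frag_mult x y \<equiv> frag_extend (\<lambda>u. frag_extend (\<lambda>v. frag_of (word_mult u v)) y) x"

lemma frag_extend_add_fun: "frag_extend (\<lambda>u. f u + g u) x = frag_extend f x + frag_extend g x"
  by (simp add: frag_extend_def frag_cmul_distrib2 sum.distrib)

lemma frag_extend_diff_fun: "frag_extend (\<lambda>u. f u - g u) x = frag_extend f x - frag_extend g x"
  using frag_extend_add_fun[of "\<lambda>u. f u - g u" g x] by simp

lemma frag_mult_add_left: "frag_mult (x + x') y = frag_mult x y + frag_mult x' y"
  and frag_mult_diff_left: "frag_mult (x - x') y = frag_mult x y - frag_mult x' y"
  and frag_mult_add_right: "frag_mult x (y + y') = frag_mult x y + frag_mult x y'"
  and frag_mult_diff_right: "frag_mult x (y - y') = frag_mult x y - frag_mult x y'"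
  by (simp_all add: frag_extend_add frag_extend_diff frag_extend_add_fun frag_extend_diff_fun)

text \<open>The scalar of a right factor is absorbed by the last slot of the left factor, or by its
  scalar if there is no slot. Only the emptiness of the first two words matters, hence the splits at
  their ends.\<close>

lemma word_mult_assoc:
  fixes u v w :: "'r::ring_1 word"
  shows "word_mult (word_mult u v) w = word_mult u (word_mult v w)"
proof (cases u, cases v, cases w)
  fix a b c and us vs ws :: "'r gens list"
  assume "u = (a, us)" "v = (b, vs)" "w = (c, ws)"
  then show ?thesis
    by (cases us rule: rev_cases; cases vs rule: rev_cases)
       (auto simp: mult.assoc ract_ract butlast_append)
qed

lemma frag_mult_assoc: "frag_mult (frag_mult x y) z = frag_mult x (frag_mult y z)"
proof -
  have "x = x \<Longrightarrow> frag_mult (frag_mult x y) z = frag_mult x (frag_mult y z)" if "Poly_Mapping.keys x \<subseteq> UNIV"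
    for x using that
  proof (induction x rule: frag_induction)
    case (one u)
    have "Poly_Mapping.keys y \<subseteq> UNIV" by simp
    then show ?case
    proof (induction y rule: frag_induction)
      case (one v)
      have "Poly_Mapping.keys z \<subseteq> UNIV" by simp
      then show ?case
        by (induction z rule: frag_induction) (auto simp: word_mult_assoc frag_extend_diff)
    qed (auto simp: frag_extend_diff frag_extend_diff_fun)
  qed (auto simp: frag_extend_diff)
  then show ?thesis by simp
qed

lemma word_mult_one_left [simp]: "word_mult (1, []) v = v"
  by (cases v) simp

lemma word_mult_one_right [simp]: "word_mult v (1, []) = v"
  by (cases v) simp

lemma frag_extend_frag_of [simp]: "frag_extend frag_of x = x"
  by (rule frag_expansion[symmetric])

context ido_functionals
begin

abbreviation words :: "'r word set" where "words \<equiv> K \<times> lists gen_module"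

definition carr :: "('r word \<Rightarrow>\<^sub>0 int) set" where
  "carr = {x. Poly_Mapping.keys x \<subseteq> words}"

lemma carr_add [simp]: "x \<in> carr \<Longrightarrow> y \<in> carr \<Longrightarrow> x + y \<in> carr"
  and carr_diff [simp]: "x \<in> carr \<Longrightarrow> y \<in> carr \<Longrightarrow> x - y \<in> carr"
  and carr_minus [simp]: "x \<in> carr \<Longrightarrow> - x \<in> carr"
  and carr_zero [simp]: "0 \<in> carr"
  and carr_of [simp]: "frag_of w \<in> carr \<longleftrightarrow> w \<in> words"
  unfolding carr_def using keys_add[of x y] keys_diff[of x y] by auto

lemma word_mult_in: "u \<in> words \<Longrightarrow> v \<in> words \<Longrightarrow> word_mult u v \<in> words"
proof (cases u, cases v)
  fix a b and us vs :: "'r gens list"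
  assume "u \<in> words" "v \<in> words" "u = (a, us)" "v = (b, vs)"
  then show ?thesis
    by (cases us rule: rev_cases) auto
qed

lemma frag_mult_in [simp]:
  assumes "x \<in> carr" "y \<in> carr" shows "frag_mult x y \<in> carr"
proof -
  have "Poly_Mapping.keys (frag_mult x y) \<subseteq>
      (\<Union>u\<in>Poly_Mapping.keys x. Poly_Mapping.keys (frag_extend (\<lambda>v. frag_of (word_mult u v)) y))"
    by (rule keys_frag_extend)
  also have "\<dots> \<subseteq> (\<Union>u\<in>Poly_Mapping.keys x. \<Union>v\<in>Poly_Mapping.keys y. {word_mult u v})"
  proof (rule UN_mono[OF subset_refl])
    fix u
    show "Poly_Mapping.keys (frag_extend (\<lambda>v. frag_of (word_mult u v)) y) \<subseteq> (\<Union>v\<in>Poly_Mapping.keys y. {word_mult u v})"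
      using keys_frag_extend[of "\<lambda>v. frag_of (word_mult u v)" y] by (simp add: keys_frag_of)
  qed
  also have "\<dots> \<subseteq> words"
    using assms word_mult_in unfolding carr_def by blast
  finally show ?thesis by (simp add: carr_def)
qed

lemma carr_induct [consumes 1, case_names zero one diff]:
  assumes "x \<in> carr" "P 0" "\<And>c ms. c \<in> K \<Longrightarrow> ms \<in> lists gen_module \<Longrightarrow> P (frag_of (c, ms))"
    "\<And>a b. P a \<Longrightarrow> P b \<Longrightarrow> P (a - b)"
  shows "P x"
  using assms unfolding carr_def by (auto intro!: frag_induction[of x words P])

lemma free_word_ring_simps [simp]:
  "carrier free_word_ring = carr"
  "x \<otimes>\<^bsub>free_word_ring\<^esub> y = frag_mult x y"
  "\<one>\<^bsub>free_word_ring\<^esub> = frag_of (1, [])"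
  "\<zero>\<^bsub>free_word_ring\<^esub> = 0"
  "x \<oplus>\<^bsub>free_word_ring\<^esub> y = x + y"
  by (simp_all add: free_word_ring_def carr_def)

lemma ring_free_word_ring: "ring free_word_ring"
proof (rule ringI)
  show "abelian_group free_word_ring"
  proof (rule abelian_groupI)
    fix x assume "x \<in> carrier free_word_ring"
    then show "\<exists>y\<in>carrier free_word_ring. y \<oplus>\<^bsub>free_word_ring\<^esub> x = \<zero>\<^bsub>free_word_ring\<^esub>"
      by (intro bexI[of _ "- x"]) auto
  qed (auto simp: add_ac)
  show "Group.monoid free_word_ring"
    by (rule monoidI) (auto simp: frag_mult_assoc)
qed (simp_all add: frag_mult_add_left frag_mult_add_right)

interpretation FR: ring free_word_ring by (rule ring_free_word_ring)

lemma free_word_ring_minus [simp]: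
  assumes "x \<in> carr" shows "\<ominus>\<^bsub>free_word_ring\<^esub> x = - x"
  using FR.minus_equality[of "-x" x] assms by simp

lemma inv_add_free: "x \<in> carr \<Longrightarrow> inv\<^bsub>add_monoid free_word_ring\<^esub> x = - x"
  using free_word_ring_minus[of x] by (simp only: a_inv_def)

lemma tensor_relations_cases [consumes 1, case_names scalar slot first balance]:
  assumes "x \<in> tensor_relations"
    "\<And>c c' ms. x = frag_of (c + c', ms) - frag_of (c, ms) - frag_of (c', ms) \<Longrightarrow> c \<in> K \<Longrightarrow> c' \<in> K \<Longrightarrow> ms \<in> lists gen_module \<Longrightarrow> P"
    "\<And>c ms m m' ns. x = frag_of (c, ms @ (m + m') # ns) - frag_of (c, ms @ m # ns) - frag_of (c, ms @ m' # ns)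
       \<Longrightarrow> c \<in> K \<Longrightarrow> m \<in> gen_module \<Longrightarrow> m' \<in> gen_module \<Longrightarrow> ms \<in> lists gen_module \<Longrightarrow> ns \<in> lists gen_module \<Longrightarrow> P"
    "\<And>c k m ns. x = frag_of (c * k, m # ns) - frag_of (c, lact k m # ns) \<Longrightarrow> c \<in> K \<Longrightarrow> k \<in> K \<Longrightarrow> m \<in> gen_module \<Longrightarrow> ns \<in> lists gen_module \<Longrightarrow> P"
    "\<And>c k ms m m' ns. x = frag_of (c, ms @ ract m k # m' # ns) - frag_of (c, ms @ m # lact k m' # ns)
       \<Longrightarrow> c \<in> K \<Longrightarrow> k \<in> K \<Longrightarrow> m \<in> gen_module \<Longrightarrow> m' \<in> gen_module \<Longrightarrow> ms \<in> lists gen_module \<Longrightarrow> ns \<in> lists gen_module \<Longrightarrow> P"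
  shows P
  using assms(1) unfolding tensor_relations_def
  apply (elim UnE)
  subgoal using assms(2) by blast
  subgoal apply (elim CollectE exE conjE) subgoal for c ms m m' ns by (rule assms(3)[of c ms m m' ns]) auto done
  subgoal apply (elim CollectE exE conjE) subgoal for c k m ns by (rule assms(4)[of c k m ns]) auto done
  subgoal apply (elim CollectE exE conjE) subgoal for c k ms m m' ns by (rule assms(5)[of c ms m k m' ns]) auto done
  done

lemma tensor_relations_intros:
  "c \<in> K \<Longrightarrow> c' \<in> K \<Longrightarrow> ms \<in> lists gen_module \<Longrightarrow>
     frag_of (c + c', ms) - frag_of (c, ms) - frag_of (c', ms) \<in> tensor_relations"
  "c \<in> K \<Longrightarrow> m \<in> gen_module \<Longrightarrow> m' \<in> gen_module \<Longrightarrow> ms \<in> lists gen_module \<Longrightarrow> ns \<in> lists gen_module \<Longrightarrow>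
     frag_of (c, ms @ (m + m') # ns) - frag_of (c, ms @ m # ns) - frag_of (c, ms @ m' # ns) \<in> tensor_relations"
  "c \<in> K \<Longrightarrow> k \<in> K \<Longrightarrow> m \<in> gen_module \<Longrightarrow> ns \<in> lists gen_module \<Longrightarrow>
     frag_of (c * k, m # ns) - frag_of (c, lact k m # ns) \<in> tensor_relations"
  "c \<in> K \<Longrightarrow> k \<in> K \<Longrightarrow> m \<in> gen_module \<Longrightarrow> m' \<in> gen_module \<Longrightarrow> ms \<in> lists gen_module \<Longrightarrow> ns \<in> lists gen_module \<Longrightarrow>
     frag_of (c, ms @ ract m k # m' # ns) - frag_of (c, ms @ m # lact k m' # ns) \<in> tensor_relations"
  unfolding tensor_relations_def
  subgoal by blast
  subgoal by (rule UnI1, rule UnI1, rule UnI2, rule CollectI, rule exI[of _ c], rule exI[of _ ms], rule exI[of _ m], rule exI[of _ m'], rule exI[of _ ns], simp)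
  subgoal by (rule UnI1, rule UnI2, rule CollectI, rule exI[of _ c], rule exI[of _ k], rule exI[of _ m], rule exI[of _ ns], simp)
  subgoal by (rule UnI2, rule CollectI, rule exI[of _ c], rule exI[of _ k], rule exI[of _ ms], rule exI[of _ m], rule exI[of _ m'], rule exI[of _ ns], simp)
  done

lemma tensor_relations_carr: "x \<in> tensor_relations \<Longrightarrow> x \<in> carr"
  by (erule tensor_relations_cases) auto

lemma tensor_null_zero [simp]: "0 \<in> tensor_null"
  using generate.one[of "add_monoid free_word_ring" tensor_relations] by (simp add: tensor_null_def)

lemma subgroup_tensor_null: "subgroup tensor_null (add_monoid free_word_ring)"
  unfolding tensor_null_def using tensor_relations_carr
  by (intro group.generate_is_subgroup FR.add.is_group) auto

lemma tensor_null_carr: "x \<in> tensor_null \<Longrightarrow> x \<in> carr"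
  using subgroup.mem_carrier[OF subgroup_tensor_null] by simp

lemma tensor_null_add: "x \<in> tensor_null \<Longrightarrow> y \<in> tensor_null \<Longrightarrow> x + y \<in> tensor_null"
  using subgroup.m_closed[OF subgroup_tensor_null] by simp

lemma tensor_null_minus: "x \<in> tensor_null \<Longrightarrow> - x \<in> tensor_null"
  using subgroup.m_inv_closed[OF subgroup_tensor_null, of x] tensor_null_carr[of x] inv_add_free[of x]
  by metis

lemma tensor_null_diff: "x \<in> tensor_null \<Longrightarrow> y \<in> tensor_null \<Longrightarrow> x - y \<in> tensor_null"
  using tensor_null_add[of x "-y"] tensor_null_minus[of y] by simp

lemma tensor_null_rel: "x \<in> tensor_relations \<Longrightarrow> x \<in> tensor_null"
  unfolding tensor_null_def by (rule generate.incl)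

text \<open>Closure under differences together with 0 gives negation and sums, so a single closure
  case replaces the two of the generated subgroup.\<close>

lemma tensor_null_induct [consumes 1, case_names zero rel diff]:
  assumes "x \<in> tensor_null" "P 0" "\<And>x. x \<in> tensor_relations \<Longrightarrow> P x" "\<And>x y. P x \<Longrightarrow> P y \<Longrightarrow> P (x - y)"
  shows "P x"
proof -
  have neg: "P (- x)" if "P x" for x using assms(4)[OF assms(2) that] by simp
  have pl: "P (x + y)" if "P x" "P y" for x y using assms(4)[OF that(1) neg[OF that(2)]] by simp
  from assms(1) show ?thesis unfolding tensor_null_def
  proof (induction rule: generate.induct)
    case (inv h)
    show ?case using neg[OF assms(3)[OF inv]] inv_add_free[OF tensor_relations_carr[OF inv]] by metis
  qed (use assms(2,3) pl in simp_all)
qed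

text \<open>A word on the left may change the kind of a relation: the scalars of the right factor
  move into the last slot \<open>u\<close> of the left word, so additivity in the scalar becomes
  additivity in a slot, and the relation for the first slot becomes a balancing relation between
  \<open>u\<close> and that slot.\<close>

lemma tensor_relation_mult_left:
  assumes "x \<in> tensor_relations" "c0 \<in> K" "ls \<in> lists gen_module"
  shows "frag_mult (frag_of (c0, ls)) x \<in> tensor_relations"
  using assms(1)
proof (cases rule: tensor_relations_cases)
  case (scalar c c' ms)
  show ?thesis
  proof (cases ls rule: rev_cases)
    case Nil
    then show ?thesis using scalar assms tensor_relations_intros(1)[of "c0 * c" "c0 * c'" ms]
      by (simp add: frag_extend_diff distrib_left)
  next
    case (snoc us u)
    then show ?thesis using scalar assms tensor_relations_intros(2)[of c0 "ract u c" "ract u c'" us ms]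
      by (simp add: frag_extend_diff ract_add_scalar)
  qed
next
  case (slot c ms m m' ns)
  show ?thesis
  proof (cases ls rule: rev_cases)
    case Nil
    then show ?thesis using slot assms tensor_relations_intros(2)[of "c0 * c" m m' ms ns]
      by (simp add: frag_extend_diff)
  next
    case (snoc us u)
    then show ?thesis using slot assms tensor_relations_intros(2)[of c0 m m' "us @ ract u c # ms" ns]
      by (simp add: frag_extend_diff)
  qed
next
  case (first c k m ns)
  show ?thesis
  proof (cases ls rule: rev_cases)
    case Nil
    then show ?thesis using first assms tensor_relations_intros(3)[of "c0 * c" k m ns]
      by (simp add: frag_extend_diff mult.assoc)
  next
    case (snoc us u)
    then show ?thesis using first assms tensor_relations_intros(4)[of c0 k "ract u c" m us ns]
      by (simp add: frag_extend_diff ract_ract)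
  qed
next
  case (balance c k ms m m' ns)
  show ?thesis
  proof (cases ls rule: rev_cases)
    case Nil
    then show ?thesis using balance assms tensor_relations_intros(4)[of "c0 * c" k m m' ms ns]
      by (simp add: frag_extend_diff)
  next
    case (snoc us u)
    then show ?thesis using balance assms tensor_relations_intros(4)[of c0 k m m' "us @ ract u c # ms" ns]
      by (simp add: frag_extend_diff)
  qed
qed

text \<open>Here the kind of the relation is kept. The scalar \<open>c0\<close> enters the last
  slot, which is affected by the relation itself only if nothing follows it; then
  \<open>ract\<close> has to be compatible with sums and with \<open>lact\<close>.\<close>

lemma tensor_relation_mult_right:
  assumes "x \<in> tensor_relations" "c0 \<in> K" "ls \<in> lists gen_module"
  shows "frag_mult x (frag_of (c0, ls)) \<in> tensor_relations"
  using assms(1)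
proof (cases rule: tensor_relations_cases)
  case (scalar c c' ms)
  show ?thesis
  proof (cases ms rule: rev_cases)
    case Nil
    then show ?thesis using scalar assms tensor_relations_intros(1)[of "c * c0" "c' * c0" ls]
      by (simp add: frag_extend_diff distrib_right)
  next
    case (snoc us u)
    then show ?thesis using scalar assms tensor_relations_intros(1)[of c c' "us @ ract u c0 # ls"]
      by (simp add: frag_extend_diff)
  qed
next
  case (slot c ms m m' ns)
  show ?thesis
  proof (cases ns rule: rev_cases)
    case Nil
    then show ?thesis using slot assms tensor_relations_intros(2)[of c "ract m c0" "ract m' c0" ms ls]
      by (simp add: frag_extend_diff ract_add)
  next
    case (snoc us u)
    then show ?thesis using slot assms tensor_relations_intros(2)[of c m m' ms "us @ ract u c0 # ls"]
      by (simp add: frag_extend_diff butlast_append)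
  qed
next
  case (first c k m ns)
  show ?thesis
  proof (cases ns rule: rev_cases)
    case Nil
    then show ?thesis using first assms tensor_relations_intros(3)[of c k "ract m c0" ls]
      by (simp add: frag_extend_diff ract_lact)
  next
    case (snoc us u)
    then show ?thesis using first assms tensor_relations_intros(3)[of c k m "us @ ract u c0 # ls"]
      by (simp add: frag_extend_diff)
  qed
next
  case (balance c k ms m m' ns)
  show ?thesis
  proof (cases ns rule: rev_cases)
    case Nil
    then show ?thesis using balance assms tensor_relations_intros(4)[of c k m "ract m' c0" ms ls]
      by (simp add: frag_extend_diff butlast_append ract_lact)
  next
    case (snoc us u)
    then show ?thesis using balance assms tensor_relations_intros(4)[of c k m m' ms "us @ ract u c0 # ls"]
      by (simp add: frag_extend_diff butlast_append)
  qed
qed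

lemma tensor_null_mult_left: "x \<in> tensor_null \<Longrightarrow> a \<in> carr \<Longrightarrow> frag_mult a x \<in> tensor_null"
proof (induction x rule: tensor_null_induct)
  case (rel x)
  from \<open>a \<in> carr\<close> show ?case
    by (induction a rule: carr_induct)
       (use rel tensor_null_rel tensor_relation_mult_left tensor_null_diff in \<open>auto simp: frag_extend_diff\<close>)
qed (auto simp: frag_mult_diff_right tensor_null_diff frag_extend_eq_0)

lemma tensor_null_mult_right: "x \<in> tensor_null \<Longrightarrow> a \<in> carr \<Longrightarrow> frag_mult x a \<in> tensor_null"
proof (induction x rule: tensor_null_induct)
  case (rel x)
  from \<open>a \<in> carr\<close> show ?case
    by (induction a rule: carr_induct)
       (use rel tensor_null_rel tensor_relation_mult_right tensor_null_diff in
         \<open>auto simp: frag_mult_diff_right frag_extend_eq_0\<close>)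
qed (auto simp: frag_extend_diff tensor_null_diff)

lemma ideal_tensor_null: "ideal tensor_null free_word_ring"
  by (rule idealI[OF ring_free_word_ring subgroup_tensor_null])
     (auto simp: tensor_null_mult_left tensor_null_mult_right)

end

section \<open>Transport of ring and bimodule structure\<close>

text \<open>The target is only a structure with operations; all ring axioms, including closure, are
  pulled through the surjection.\<close>

lemma ring_hom_image:
  fixes A :: "('a, 'm) ring_scheme" and B :: "('b, 'n) ring_scheme"
  assumes "ring A" and img: "h ` carrier A = carrier B"
    and mult: "\<And>x y. x \<in> carrier A \<Longrightarrow> y \<in> carrier A \<Longrightarrow> h (x \<otimes>\<^bsub>A\<^esub> y) = h x \<otimes>\<^bsub>B\<^esub> h y"
    and add: "\<And>x y. x \<in> carrier A \<Longrightarrow> y \<in> carrier A \<Longrightarrow> h (x \<oplus>\<^bsub>A\<^esub> y) = h x \<oplus>\<^bsub>B\<^esub> h y"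
    and one: "h \<one>\<^bsub>A\<^esub> = \<one>\<^bsub>B\<^esub>" and zero: "h \<zero>\<^bsub>A\<^esub> = \<zero>\<^bsub>B\<^esub>"
  shows "ring B"
proof -
  interpret A: ring A by fact
  note hom = mult[symmetric] add[symmetric] one[symmetric] zero[symmetric]
  show ?thesis
  proof (rule ringI)
    show "abelian_group B"
    proof (rule abelian_groupI)
      fix x assume "x \<in> carrier B"
      then obtain a where "a \<in> carrier A" "x = h a" using img by blast
      then show "\<exists>y\<in>carrier B. y \<oplus>\<^bsub>B\<^esub> x = \<zero>\<^bsub>B\<^esub>"
        using img by (intro bexI[of _ "h (\<ominus>\<^bsub>A\<^esub> a)"]) (auto simp: hom A.l_neg)
    qed (auto simp: img[symmetric] hom A.a_ac)
    show "Group.monoid B"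
      by (rule monoidI) (auto simp: img[symmetric] hom A.m_assoc)
  qed (auto simp: img[symmetric] hom A.l_distr A.r_distr)
qed

lemma with_scalars_simps [simp]:
  "carrier (with_scalars A \<iota>) = carrier A"
  "x \<otimes>\<^bsub>with_scalars A \<iota>\<^esub> y = x \<otimes>\<^bsub>A\<^esub> y"
  "\<one>\<^bsub>with_scalars A \<iota>\<^esub> = \<one>\<^bsub>A\<^esub>"
  "\<zero>\<^bsub>with_scalars A \<iota>\<^esub> = \<zero>\<^bsub>A\<^esub>"
  "x \<oplus>\<^bsub>with_scalars A \<iota>\<^esub> y = x \<oplus>\<^bsub>A\<^esub> y"
  "lsmult (with_scalars A \<iota>) k x = \<iota> k \<otimes>\<^bsub>A\<^esub> x"
  "rsmult (with_scalars A \<iota>) x k = x \<otimes>\<^bsub>A\<^esub> \<iota> k"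
  by (simp_all add: with_scalars_def)

lemma ring_with_scalars: "ring A \<Longrightarrow> ring (with_scalars A \<iota>)"
  by (rule ring_hom_image[of A "\<lambda>x. x"]) auto

lemma K_ring_with_scalars:
  assumes "ring A" and cl: "\<And>k. k \<in> K \<Longrightarrow> \<iota> k \<in> carrier A" and "\<iota> 1 = \<one>\<^bsub>A\<^esub>"
    and add: "\<And>k l. k \<in> K \<Longrightarrow> l \<in> K \<Longrightarrow> \<iota> (k + l) = \<iota> k \<oplus>\<^bsub>A\<^esub> \<iota> l"
    and mult: "\<And>k l. k \<in> K \<Longrightarrow> l \<in> K \<Longrightarrow> \<iota> (k * l) = \<iota> k \<otimes>\<^bsub>A\<^esub> \<iota> l"
  shows "K_ring K (with_scalars A \<iota>)"
proof -
  interpret A: ring A by fact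
  interpret B: ring "with_scalars A \<iota>" by (rule ring_with_scalars) fact
  show ?thesis
    unfolding K_ring_def K_bimodule_def
    using B.ring_axioms B.abelian_group_axioms
    by (auto simp: assms A.l_distr A.r_distr A.m_assoc)
qed

text \<open>This serves the ring of irreducible tensors, whose product is taken up to normal form:
  associativity and distributivity come from the quotient ring and need no computation with normal
  forms.\<close>

lemma K_ring_image:
  assumes A: "K_ring K A" and K: "1 \<in> K" "\<And>k l. k \<in> K \<Longrightarrow> l \<in> K \<Longrightarrow> k + l \<in> K \<and> k * l \<in> K"
    and img: "h ` carrier A = carrier B"
    and mult: "\<And>x y. x \<in> carrier A \<Longrightarrow> y \<in> carrier A \<Longrightarrow> h (x \<otimes>\<^bsub>A\<^esub> y) = h x \<otimes>\<^bsub>B\<^esub> h y"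
    and add: "\<And>x y. x \<in> carrier A \<Longrightarrow> y \<in> carrier A \<Longrightarrow> h (x \<oplus>\<^bsub>A\<^esub> y) = h x \<oplus>\<^bsub>B\<^esub> h y"
    and one: "h \<one>\<^bsub>A\<^esub> = \<one>\<^bsub>B\<^esub>" and zero: "h \<zero>\<^bsub>A\<^esub> = \<zero>\<^bsub>B\<^esub>"
    and left: "\<And>k x. k \<in> K \<Longrightarrow> x \<in> carrier A \<Longrightarrow> h (lsmult A k x) = lsmult B k (h x)"
    and right: "\<And>k x. k \<in> K \<Longrightarrow> x \<in> carrier A \<Longrightarrow> h (rsmult A x k) = rsmult B (h x) k"
  shows "K_ring K B"
proof -
  have rA: "ring A" and bA: "K_bimodule K A" using A by (auto simp: K_ring_def)
  interpret A: ring A by fact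
  have rB: "ring B" by (rule ring_hom_image[OF rA img mult add one zero])
  interpret B: ring B by fact
  have cl: "lsmult A k x \<in> carrier A" "rsmult A x k \<in> carrier A" if "k \<in> K" "x \<in> carrier A" for k x
    using bA that by (auto simp: K_bimodule_def)
  note hom = mult[symmetric] add[symmetric] one[symmetric] zero[symmetric] left[symmetric] right[symmetric]
  have "K_bimodule K B"
    using bA B.abelian_group_axioms unfolding K_bimodule_def img[symmetric]
    by (auto simp: hom cl K)
  moreover have "\<forall>k\<in>K. \<forall>x\<in>carrier B. \<forall>y\<in>carrier B.
       lsmult B k x \<otimes>\<^bsub>B\<^esub> y = lsmult B k (x \<otimes>\<^bsub>B\<^esub> y) \<and>
       rsmult B x k \<otimes>\<^bsub>B\<^esub> y = x \<otimes>\<^bsub>B\<^esub> lsmult B k y \<and>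
       rsmult B (x \<otimes>\<^bsub>B\<^esub> y) k = x \<otimes>\<^bsub>B\<^esub> rsmult B y k"
    using A unfolding K_ring_def img[symmetric] by (auto simp: hom cl)
  ultimately show ?thesis using rB by (auto simp: K_ring_def)
qed

lemma gens_decomp:
  "m = rg (fst m) + (\<Sum>s\<in>Poly_Mapping.keys (snd m). sy (Poly_Mapping.lookup (snd m) s) s)"
  by (rule gens_eqI)
     (auto simp: rg_def sy_def fst_sum snd_sum lookup_sum lookup_single when_def in_keys_iff)

section \<open>Calculation with pure tensors\<close>

context ido_functionals
begin

sublocale FR: ring free_word_ring by (rule ring_free_word_ring)
sublocale TN: ideal tensor_null free_word_ring by (rule ideal_tensor_null)
sublocale T: ring T unfolding T_def by (intro ring_with_scalars TN.quotient_is_ring)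

declare in_lists_conv_set [simp] ball_Un [simp]

text \<open>Additivity at 0 + 0 yields an element equal to its own double; this is how zero slots,
  zero scalars and values of homomorphisms at zero are shown to vanish.\<close>

lemma T_idem: "x \<in> carrier T \<Longrightarrow> x \<oplus>\<^bsub>T\<^esub> x = x \<Longrightarrow> x = \<zero>\<^bsub>T\<^esub>"
  using T.add.l_cancel_one[of x x] by simp

abbreviation tmul (infixl "*\<^sub>T" 70) where "x *\<^sub>T y \<equiv> x \<otimes>\<^bsub>T\<^esub> y"
abbreviation tadd (infixl "+\<^sub>T" 65) where "x +\<^sub>T y \<equiv> x \<oplus>\<^bsub>T\<^esub> y"
abbreviation tsub (infixl "-\<^sub>T" 65) where "x -\<^sub>T y \<equiv> x \<ominus>\<^bsub>T\<^esub> y"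

abbreviation sc :: "'r \<Rightarrow> 'r tensor" where "sc k \<equiv> pure k []"

definition cls :: "('r word \<Rightarrow>\<^sub>0 int) \<Rightarrow> 'r tensor" where
  "cls x = tensor_null +>\<^bsub>free_word_ring\<^esub> x"

lemma T_smult [simp]: "lsmult T k x = sc k *\<^sub>T x" "rsmult T x k = x *\<^sub>T sc k"
  by (simp_all add: T_def)

lemma carrier_T: "carrier T = cls ` carr"
  by (auto simp: T_def FactRing_def A_RCOSETS_def' cls_def)

lemma cls_in [simp]: "x \<in> carr \<Longrightarrow> cls x \<in> carrier T"
  by (simp add: carrier_T)

lemma cls_add: "x \<in> carr \<Longrightarrow> y \<in> carr \<Longrightarrow> cls (x + y) = cls x +\<^sub>T cls y"
  and cls_mult: "x \<in> carr \<Longrightarrow> y \<in> carr \<Longrightarrow> cls (frag_mult x y) = cls x *\<^sub>T cls y"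
  and cls_one: "cls (frag_of (1, [])) = \<one>\<^bsub>T\<^esub>"
  using TN.rcos_ring_hom by (simp_all add: ring_hom_def T_def cls_def)

lemma cls_zero [simp]: "cls 0 = \<zero>\<^bsub>T\<^esub>"
  by (metis T_idem add_0 carr_zero cls_add cls_in)

lemma cls_diff: assumes "x \<in> carr" "y \<in> carr" shows "cls (x - y) = cls x -\<^sub>T cls y"
proof -
  have "cls x = cls (x - y) +\<^sub>T cls y" using cls_add[of "x - y" y] assms by simp
  then show ?thesis using assms by (simp add: T.minus_eq T.a_assoc T.r_neg)
qed

lemma cls_eq_zero: "x \<in> carr \<Longrightarrow> cls x = \<zero>\<^bsub>T\<^esub> \<longleftrightarrow> x \<in> tensor_null"
proof -
  assume x: "x \<in> carr"
  have "\<zero>\<^bsub>T\<^esub> = tensor_null" by (simp add: T_def FactRing_def)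
  then show ?thesis using x TN.a_rcos_const[of x] TN.rcos_const_imp_mem[of x]
    unfolding cls_def by (auto simp: free_word_ring_simps)
qed

lemma T_eq_iff: "x \<in> carrier T \<Longrightarrow> y \<in> carrier T \<Longrightarrow> x -\<^sub>T y = \<zero>\<^bsub>T\<^esub> \<longleftrightarrow> x = y"
  by (auto simp: T.r_right_minus_eq)

lemma pure_cls: "pure c ms = cls (frag_of (c, ms))"
  by (simp add: pure_def cls_def)

lemma pure_in [simp]: "c \<in> K \<Longrightarrow> ms \<in> lists gen_module \<Longrightarrow> pure c ms \<in> carrier T"
  by (simp add: pure_cls)

lemma T_one: "\<one>\<^bsub>T\<^esub> = \<epsilon>"
  by (simp add: pure_cls cls_one)

lemma tensor_rel_eq:
  assumes "frag_of u - frag_of v \<in> tensor_relations" "u \<in> words" "v \<in> words"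
  shows "cls (frag_of u) = cls (frag_of v)"
  using cls_eq_zero[OF tensor_relations_carr[OF assms(1)]] tensor_null_rel[OF assms(1)] assms(2,3)
  by (simp add: cls_diff T_eq_iff del: lists_empty)

lemma tensor_rel_add:
  assumes "frag_of u - frag_of v - frag_of w \<in> tensor_relations" "u \<in> words" "v \<in> words" "w \<in> words"
  shows "cls (frag_of u) = cls (frag_of v) +\<^sub>T cls (frag_of w)"
proof -
  have "frag_of u - (frag_of v + frag_of w) \<in> tensor_relations" using assms(1) by (simp add: diff_diff_eq)
  then have "cls (frag_of u - (frag_of v + frag_of w)) = \<zero>\<^bsub>T\<^esub>"
    using tensor_relations_carr tensor_null_rel cls_eq_zero by blast
  then show ?thesis using assms(2-4) by (simp add: cls_diff cls_add T_eq_iff)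
qed

lemma pure_add_scalar: "c \<in> K \<Longrightarrow> c' \<in> K \<Longrightarrow> ms \<in> lists gen_module \<Longrightarrow>
    pure (c + c') ms = pure c ms +\<^sub>T pure c' ms"
  unfolding pure_cls by (rule tensor_rel_add) (auto simp: tensor_relations_intros)

lemma pure_add_slot: "c \<in> K \<Longrightarrow> m \<in> gen_module \<Longrightarrow> m' \<in> gen_module \<Longrightarrow> ms \<in> lists gen_module \<Longrightarrow> ns \<in> lists gen_module \<Longrightarrow>
    pure c (ms @ (m + m') # ns) = pure c (ms @ m # ns) +\<^sub>T pure c (ms @ m' # ns)"
  unfolding pure_cls by (rule tensor_rel_add, rule tensor_relations_intros) auto

lemma pure_first: "c \<in> K \<Longrightarrow> k \<in> K \<Longrightarrow> m \<in> gen_module \<Longrightarrow> ns \<in> lists gen_module \<Longrightarrow>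
    pure (c * k) (m # ns) = pure c (lact k m # ns)"
  unfolding pure_cls by (rule tensor_rel_eq, rule tensor_relations_intros) auto

lemma pure_balance: "c \<in> K \<Longrightarrow> k \<in> K \<Longrightarrow> m \<in> gen_module \<Longrightarrow> m' \<in> gen_module \<Longrightarrow> ms \<in> lists gen_module \<Longrightarrow> ns \<in> lists gen_module \<Longrightarrow>
    pure c (ms @ ract m k # m' # ns) = pure c (ms @ m # lact k m' # ns)"
  unfolding pure_cls by (rule tensor_rel_eq, rule tensor_relations_intros) auto

lemma pure_mult: "c \<in> K \<Longrightarrow> c' \<in> K \<Longrightarrow> ms \<in> lists gen_module \<Longrightarrow> ns \<in> lists gen_module \<Longrightarrow>
    pure c ms *\<^sub>T pure c' ns = cls (frag_of (word_mult (c, ms) (c', ns)))"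
  using cls_mult[of "frag_of (c, ms)" "frag_of (c', ns)"] by (simp add: pure_cls)

lemma sc_mult_pure: "k \<in> K \<Longrightarrow> c \<in> K \<Longrightarrow> ms \<in> lists gen_module \<Longrightarrow> sc k *\<^sub>T pure c ms = pure (k * c) ms"
  by (subst pure_mult) (auto simp: pure_cls)

lemma pure_mult_tens: "c \<in> K \<Longrightarrow> ms \<in> lists gen_module \<Longrightarrow> ns \<in> lists gen_module \<Longrightarrow>
    pure c ms *\<^sub>T tens ns = pure c (ms @ ns)"
  by (cases ms rule: rev_cases) (auto simp: pure_mult pure_cls[symmetric])

lemma pure_snoc_sc: "c \<in> K \<Longrightarrow> k \<in> K \<Longrightarrow> m \<in> gen_module \<Longrightarrow> ms \<in> lists gen_module \<Longrightarrow>
    pure c (ms @ [m]) *\<^sub>T sc k = pure c (ms @ [ract m k])"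
  by (auto simp: pure_mult pure_cls[symmetric])

lemma pure_eq: "c \<in> K \<Longrightarrow> ms \<in> lists gen_module \<Longrightarrow> pure c ms = sc c *\<^sub>T tens ms"
  by (simp add: sc_mult_pure)

lemma tens_append: "ms \<in> lists gen_module \<Longrightarrow> ns \<in> lists gen_module \<Longrightarrow> tens (ms @ ns) = tens ms *\<^sub>T tens ns"
  by (simp add: pure_mult_tens)

lemma tens_Cons: "m \<in> gen_module \<Longrightarrow> ns \<in> lists gen_module \<Longrightarrow> tens (m # ns) = tens [m] *\<^sub>T tens ns"
  by (simp add: pure_mult_tens)

lemma sc_add: "k \<in> K \<Longrightarrow> l \<in> K \<Longrightarrow> sc (k + l) = sc k +\<^sub>T sc l"
  by (simp add: pure_add_scalar)

lemma sc_mult: "k \<in> K \<Longrightarrow> l \<in> K \<Longrightarrow> sc (k * l) = sc k *\<^sub>T sc l"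
  by (simp add: sc_mult_pure)

lemma sc_zero [simp]: "sc 0 = \<zero>\<^bsub>T\<^esub>"
  by (metis T_idem add_0 constants_zero lists.Nil pure_in sc_add)

lemma gen_add: "m \<in> gen_module \<Longrightarrow> m' \<in> gen_module \<Longrightarrow> tens [m + m'] = tens [m] +\<^sub>T tens [m']"
  using pure_add_slot[of 1 m m' "[]" "[]"] by simp

lemma gen_zero [simp]: "tens [0] = \<zero>\<^bsub>T\<^esub>"
  by (metis T_idem add_0 constants_one gen_module_zero lists.Nil lists.Cons pure_in gen_add)

lemma gen_lact: "k \<in> K \<Longrightarrow> m \<in> gen_module \<Longrightarrow> tens [lact k m] = sc k *\<^sub>T tens [m]"
  using pure_first[of 1 k m "[]"] by (simp add: sc_mult_pure)

lemma gen_ract: "k \<in> K \<Longrightarrow> m \<in> gen_module \<Longrightarrow> tens [ract m k] = tens [m] *\<^sub>T sc k"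
  using pure_snoc_sc[of 1 k m "[]"] by simp

subsection \<open>Additive spans\<close>

lemma inv_add_T: "x \<in> carrier T \<Longrightarrow> inv\<^bsub>add_monoid T\<^esub> x = \<ominus>\<^bsub>T\<^esub> x"
  by (simp add: a_inv_def)

lemma span_zero [simp]: "\<zero>\<^bsub>T\<^esub> \<in> additive_span S"
  using generate.one[of "add_monoid T"] by (simp add: additive_span_def)

lemma span_incl: "x \<in> S \<Longrightarrow> x \<in> additive_span S"
  by (simp add: additive_span_def generate.incl)

lemma span_add: "x \<in> additive_span S \<Longrightarrow> y \<in> additive_span S \<Longrightarrow> x +\<^sub>T y \<in> additive_span S"
  using generate.eng[of x "add_monoid T" S y] by (simp add: additive_span_def)

lemma span_carrier: "S \<subseteq> carrier T \<Longrightarrow> additive_span S \<subseteq> carrier T"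
  unfolding additive_span_def using group.generate_incl[OF T.add.is_group, of S] by simp

lemma span_minus: "x \<in> additive_span S \<Longrightarrow> S \<subseteq> carrier T \<Longrightarrow> \<ominus>\<^bsub>T\<^esub> x \<in> additive_span S"
  using group.generate_m_inv_closed[OF T.add.is_group, of S x] unfolding additive_span_def
  by (simp add: a_inv_def)

lemma span_diff: "x \<in> additive_span S \<Longrightarrow> y \<in> additive_span S \<Longrightarrow> S \<subseteq> carrier T \<Longrightarrow> x -\<^sub>T y \<in> additive_span S"
  by (simp add: T.minus_eq span_add span_minus)

lemma span_induct [consumes 2, case_names zero incl diff]:
  assumes "x \<in> additive_span S" "S \<subseteq> carrier T" "P \<zero>\<^bsub>T\<^esub>" "\<And>x. x \<in> S \<Longrightarrow> P x"
    "\<And>x y. x \<in> additive_span S \<Longrightarrow> y \<in> additive_span S \<Longrightarrow> P x \<Longrightarrow> P y \<Longrightarrow> P (x -\<^sub>T y)"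
  shows "P x"
proof -
  have neg: "P (\<ominus>\<^bsub>T\<^esub> x)" if "P x" "x \<in> additive_span S" for x
    using assms(5)[OF span_zero that(2) assms(3) that(1)] that(2) span_carrier[OF assms(2)] by (auto simp: T.minus_eq)
  have pl: "P (x +\<^sub>T y)" if "P x" "P y" "x \<in> additive_span S" "y \<in> additive_span S" for x y
    using assms(5)[OF that(3) span_minus[OF that(4) assms(2)] that(1) neg[OF that(2,4)]] that(3,4) span_carrier[OF assms(2)]
    by (auto simp: T.minus_eq T.minus_minus)
  have "P x \<and> x \<in> additive_span S" using assms(1) unfolding additive_span_def
  proof (induction rule: generate.induct)
    case (inv h)
    then have "h \<in> carrier T" "h \<in> additive_span S" using assms(2) by (auto simp: span_incl)
    then have "P (\<ominus>\<^bsub>T\<^esub> h) \<and> \<ominus>\<^bsub>T\<^esub> h \<in> additive_span S"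
      using neg[of h] assms(4)[OF inv] span_minus assms(2) by blast
    then show ?case using inv_add_T[OF \<open>h \<in> carrier T\<close>] by (metis additive_span_def)
  next
    case (eng h1 h2)
    then show ?case using pl[of h1 h2] span_add[of h1 S h2] by (simp add: additive_span_def)
  next
    case one
    then show ?case using assms(3) span_zero[of S] by (simp add: additive_span_def)
  next
    case (incl h)
    then show ?case using assms(4) by (simp add: generate.incl)
  qed
  then show ?thesis ..
qed

lemma span_minimal:
  assumes "S \<subseteq> additive_span S'" "S' \<subseteq> carrier T"
  shows "additive_span S \<subseteq> additive_span S'"
proof
  fix x assume "x \<in> additive_span S"
  moreover have "S \<subseteq> carrier T" using assms span_carrier by blast
  ultimately show "x \<in> additive_span S'"
    by (induction rule: span_induct) (use assms span_diff in auto)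
qed

lemma span_mono: "S \<subseteq> S' \<Longrightarrow> S' \<subseteq> carrier T \<Longrightarrow> additive_span S \<subseteq> additive_span S'"
  by (rule span_minimal) (auto intro: span_incl)

lemma carrier_T_span: "carrier T = additive_span {pure c ms | c ms. c \<in> K \<and> ms \<in> lists gen_module}"
  (is "_ = additive_span ?S")
proof
  show "carrier T \<subseteq> additive_span ?S"
  proof
    fix t assume "t \<in> carrier T"
    then obtain x where "x \<in> carr" "t = cls x" by (auto simp: carrier_T)
    have "x \<in> carr \<and> cls x \<in> additive_span ?S" using \<open>x \<in> carr\<close>
    proof (induction x rule: carr_induct)
      case (one c ms)
      then show ?case by (auto simp: pure_cls[symmetric] intro!: span_incl)
    next
      case (diff a b)
      then show ?case by (auto simp: cls_diff intro!: span_diff)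
    qed auto
    then show "t \<in> additive_span ?S" using \<open>t = cls x\<close> by simp
  qed
  show "additive_span ?S \<subseteq> carrier T" by (rule span_carrier) auto
qed

subsection \<open>Generating the word modules\<close>

text \<open>The last clause is membership in the left \<open>K\<close>-span of \<open>B\<close>,
  phrased as an induction principle whose partial sums may leave \<open>U\<close>. Stability of
  \<open>U\<close> under right scalars is included because scalars split off from one slot are
  handed to the slot on its left.\<close>

definition decomposable :: "'r gens set \<Rightarrow> 'r gens set \<Rightarrow> bool" where
  "decomposable U B \<longleftrightarrow> U \<subseteq> gen_module \<and> B \<subseteq> gen_module \<and> (\<forall>u\<in>U. \<forall>k\<in>K. ract u k \<in> U) \<and>
    (\<forall>u\<in>U. \<forall>Q. Q 0 \<longrightarrow> (\<forall>x\<in>gen_module. \<forall>y\<in>gen_module. Q x \<longrightarrow> Q y \<longrightarrow> Q (x + y)) \<longrightarrow>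
       (\<forall>k\<in>K. \<forall>b\<in>B. Q (lact k b)) \<longrightarrow> Q u)"

lemma decomposable_induct:
  assumes dec: "decomposable U B" and u: "u \<in> U" and "Q 0"
    and "\<And>x y. x \<in> gen_module \<Longrightarrow> y \<in> gen_module \<Longrightarrow> Q x \<Longrightarrow> Q y \<Longrightarrow> Q (x + y)"
    and "\<And>k b. k \<in> K \<Longrightarrow> b \<in> B \<Longrightarrow> Q (lact k b)"
  shows "Q u"
proof -
  have "\<forall>u\<in>U. \<forall>Q. Q 0 \<longrightarrow> (\<forall>x\<in>gen_module. \<forall>y\<in>gen_module. Q x \<longrightarrow> Q y \<longrightarrow> Q (x + y)) \<longrightarrow>
       (\<forall>k\<in>K. \<forall>b\<in>B. Q (lact k b)) \<longrightarrow> Q u"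
    using dec unfolding decomposable_def by (elim conjE)
  from spec[OF bspec[OF this u], of Q] show ?thesis using assms(3-5) by simp
qed

text \<open>Slots are replaced by base elements from right to left; \<open>bs\<close> is the part
  already treated. A scalar split off from the current slot always travels left and ends up in the
  leading coefficient.\<close>

lemma pure_decompose:
  assumes "list_all2 (\<lambda>(U, B) m. m \<in> U) W ms" "\<forall>(U, B)\<in>set W. decomposable U B" "c \<in> K" "bs \<in> lists gen_module"
  shows "pure c (ms @ bs) \<in> additive_span {pure k (bs' @ bs) | k bs'. k \<in> K \<and> list_all2 (\<lambda>(U, B) b. b \<in> B) W bs'}"
  using assms
proof (induction "length ms" arbitrary: ms W bs)
  case 0
  then show ?case by (auto intro!: span_incl)
next
  case (Suc n)
  from Suc.hyps(2) obtain us u where ms: "ms = us @ [u]" by (cases ms rule: rev_cases) auto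
  from Suc.prems(1) obtain W' U B where W: "W = W' @ [(U, B)]" and us: "list_all2 (\<lambda>(U, B) m. m \<in> U) W' us" and u: "u \<in> U"
    unfolding ms by (auto simp: list_all2_append2 list_all2_Cons2)
  have dec: "decomposable U B" and dec': "\<forall>(U, B)\<in>set W'. decomposable U B" using Suc.prems(2) W by auto
  let ?S = "{pure k (bs' @ bs) | k bs'. k \<in> K \<and> list_all2 (\<lambda>(U, B) b. b \<in> B) W bs'}"
  have gm: "ms \<in> lists gen_module" if "list_all2 (\<lambda>(U, B) b. b \<in> B) V ms" "\<forall>(U, B)\<in>set V. decomposable U B" for V ms
    using that by (induction rule: list_all2_induct) (auto simp: decomposable_def)
  have gm': "ms \<in> lists gen_module" if "list_all2 (\<lambda>(U, B) b. b \<in> U) V ms" "\<forall>(U, B)\<in>set V. decomposable U B" for V ms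
    using that by (induction rule: list_all2_induct) (auto simp: decomposable_def)
  have S: "?S \<subseteq> carrier T"
  proof safe
    fix k bs' assume "k \<in> K" "list_all2 (\<lambda>(U, B) b. b \<in> B) W bs'"
    with gm[OF this(2) Suc.prems(2)] Suc.prems(4) show "pure k (bs' @ bs) \<in> carrier T" by (intro pure_in) auto
  qed
  have us_gm: "us \<in> lists gen_module" using gm'[OF us dec'] .
  \<comment> \<open>The claim with the last untreated slot as a variable; decomposability reduces it
    to zero, sums and scaled base elements.\<close>
  define Q where "Q u \<longleftrightarrow> pure c (us @ u # bs) \<in> additive_span ?S" for u
  have "pure c (us @ 0 # bs) = \<zero>\<^bsub>T\<^esub>"
  proof (rule T_idem)
    show "pure c (us @ 0 # bs) \<in> carrier T" using us_gm Suc.prems(3,4) by (intro pure_in) auto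
    show "pure c (us @ 0 # bs) +\<^sub>T pure c (us @ 0 # bs) = pure c (us @ 0 # bs)"
      using pure_add_slot[OF Suc.prems(3) gen_module_zero gen_module_zero us_gm Suc.prems(4), symmetric]
      by (simp only: add_0)
  qed
  then have "Q 0" by (simp add: Q_def)
  moreover have "Q (x + y)" if "x \<in> gen_module" "y \<in> gen_module" "Q x" "Q y" for x y
    using that us_gm Suc.prems by (simp add: Q_def pure_add_slot span_add)
  moreover have "Q (lact k b)" if "k \<in> K" "b \<in> B" for k b
  proof (cases us rule: rev_cases)
    case Nil
    have b: "b \<in> gen_module" using that dec by (auto simp: decomposable_def)
    then have "pure c (us @ lact k b # bs) = pure (c * k) ([b] @ bs)" using Nil that Suc.prems pure_first[of c k b bs] by simp
    moreover have "W' = []" using us Nil by simp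
    ultimately show ?thesis using that Suc.prems W unfolding Q_def
      by (intro span_incl CollectI exI[of _ "c * k"] exI[of _ "[b]"]) auto
  next
    case (snoc vs v)
    have b: "b \<in> gen_module" using that dec by (auto simp: decomposable_def)
    obtain W'' U' B' where W': "W' = W'' @ [(U', B')]" and vs: "list_all2 (\<lambda>(U, B) m. m \<in> U) W'' vs" and v: "v \<in> U'"
      using us snoc by (auto simp: list_all2_append2 list_all2_Cons2)
    \<comment> \<open>Balancing passes \<open>k\<close> to the slot on the left. The remaining word
      is shorter and still fits its modules, so the induction hypothesis applies with
      \<open>b\<close> added to the treated part.\<close>
    have "pure c (us @ lact k b # bs) = pure c ((vs @ [ract v k]) @ b # bs)"
      using pure_balance[of c k v b vs bs] us_gm snoc that b Suc.prems by simp
    also have "\<dots> \<in> additive_span {pure k (bs' @ b # bs) | k bs'. k \<in> K \<and> list_all2 (\<lambda>(U, B) b. b \<in> B) W' bs'}"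
    proof (rule Suc.hyps(1))
      show "n = length (vs @ [ract v k])" using Suc.hyps(2) ms snoc by simp
      show "list_all2 (\<lambda>(U, B) m. m \<in> U) W' (vs @ [ract v k])"
        using W' vs v dec' that by (auto simp: decomposable_def intro!: list_all2_appendI)
    qed (use dec' Suc.prems b in auto)
    also have "\<dots> \<subseteq> additive_span ?S"
    proof (rule span_mono[OF _ S], safe)
      fix l bs' assume "l \<in> K" "list_all2 (\<lambda>(U, B) b. b \<in> B) W' bs'"
      then show "\<exists>k bs''. pure l (bs' @ b # bs) = pure k (bs'' @ bs) \<and> k \<in> K \<and> list_all2 (\<lambda>(U, B) b. b \<in> B) W bs''"
        using W that by (intro exI[of _ l] exI[of _ "bs' @ [b]"]) (auto intro!: list_all2_appendI)
    qed
    finally show ?thesis unfolding Q_def .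
  qed
  ultimately have "Q u" using decomposable_induct[OF dec u, of Q] by simp
  then show ?case by (simp add: Q_def ms)
qed

text \<open>Left generators over \<open>K\<close> of the letter modules. The ring and the range of
  \<open>J\<close> generate themselves, since no basis over the constants is chosen; constants and
  symbols need one generator each.\<close>

fun letter_base :: "letter \<Rightarrow> 'r gens set" where
  "letter_base L\<^sub>R = range rg"
| "letter_base L\<^sub>K = {rg 1}"
| "letter_base L\<^sub>R\<^sub>t = rg ` range J"
| "letter_base L\<^sub>D = {D}"
| "letter_base L\<^sub>I = {I}"
| "letter_base L\<^sub>E = {F E}"
| "letter_base L\<^sub>\<Phi>\<^sub>t = F ` (\<Phi> - {E})"
| "letter_base L\<^sub>\<Phi> = F ` \<Phi>"

definition bases :: "'r gens set" where
  "bases = range rg \<union> {D, I} \<union> F ` \<Phi>"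

lemma bases_gen_module: "b \<in> bases \<Longrightarrow> b \<in> gen_module"
  by (auto simp: bases_def)

lemma gen_module_sum: "(\<And>s. s \<in> A \<Longrightarrow> g s \<in> gen_module) \<Longrightarrow> (\<Sum>s\<in>A. g s) \<in> gen_module"
  by (induction A rule: infinite_finite_induct) auto

lemma gens_sum_induct:
  assumes m: "m \<in> gen_module" "Q (rg (fst m))"
    and Q: "Q 0" "\<And>x y. x \<in> gen_module \<Longrightarrow> y \<in> gen_module \<Longrightarrow> Q x \<Longrightarrow> Q y \<Longrightarrow> Q (x + y)"
    "\<And>k s. k \<in> K \<Longrightarrow> s \<in> Poly_Mapping.keys (snd m) \<Longrightarrow> Q (lact k (sy 1 s))"
  shows "Q m"
proof -
  define g where "g s = sy (Poly_Mapping.lookup (snd m) s) s" for s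
  have g_in: "g s \<in> gen_module" if "s \<in> Poly_Mapping.keys (snd m)" for s
    using m(1) that unfolding gen_module_iff g_def by (auto simp: sy_def lookup_single when_def in_keys_iff)
  have Qg: "Q (g s)" if "s \<in> Poly_Mapping.keys (snd m)" for s
    using Q(3)[of "Poly_Mapping.lookup (snd m) s" s] that m(1) by (simp add: gen_module_iff g_def)
  have "finite A \<Longrightarrow> A \<subseteq> Poly_Mapping.keys (snd m) \<Longrightarrow> Q (\<Sum>s\<in>A. g s)" for A
  proof (induction A rule: finite_induct)
    case (insert s A)
    then show ?case using Q(2)[of "g s" "\<Sum>s\<in>A. g s"] g_in Qg by (simp add: gen_module_sum subset_iff)
  qed (use Q in simp)
  then have "Q (\<Sum>s\<in>Poly_Mapping.keys (snd m). g s)" by simp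
  then have "Q (rg (fst m) + (\<Sum>s\<in>Poly_Mapping.keys (snd m). g s))"
    using m g_in by (intro Q gen_module_sum) auto
  then show ?thesis using gens_decomp[of m] by (simp add: g_def)
qed

lemma decomposable_gen_module: "decomposable gen_module bases"
  unfolding decomposable_def
proof (intro conjI ballI allI impI)
  fix u Q
  assume u: "u \<in> gen_module" and Q: "Q (0 :: 'r gens)"
    "\<forall>x\<in>gen_module. \<forall>y\<in>gen_module. Q x \<longrightarrow> Q y \<longrightarrow> Q (x + y)" "\<forall>k\<in>K. \<forall>b\<in>bases. Q (lact k b)"
  have "Q (lact 1 (rg (fst u)))" using Q(3)[rule_format, OF constants_one, of "rg (fst u)"] by (simp add: bases_def)
  moreover have "sy 1 s \<in> bases" if "s \<in> Poly_Mapping.keys (snd u)" for s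
    using u that unfolding gen_module_iff by (auto simp: bases_def in_keys_iff)
  ultimately show "Q u" using u Q by (intro gens_sum_induct[of u Q]) (simp_all del: lact_sy lact_rg)
qed (auto simp: bases_gen_module)

lemma decomposable_letter: "decomposable (letter_module w) (letter_base w)"
proof -
  have scal: "decomposable {sy c s | c. c \<in> K} {sy 1 s}" if "s \<in> {Dsym, Isym} \<union> Fsym ` \<Phi>" for s
    unfolding decomposable_def
  proof (intro conjI ballI allI impI)
    fix u Q assume u: "u \<in> {sy c s | c. c \<in> K}" and Q: "\<forall>k\<in>K. \<forall>b\<in>{sy 1 s}. Q (lact k b)"
    then show "Q u" by auto
  qed (use that in \<open>auto simp del: Un_iff\<close>)
  have Phi: "decomposable {m \<in> gen_module. fst m = 0 \<and> Poly_Mapping.keys (snd m) \<subseteq> Fsym ` S} (F ` S)" if "S \<subseteq> \<Phi>" for S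
    unfolding decomposable_def
  proof (intro conjI ballI allI impI)
    fix u Q
    assume u: "u \<in> {m \<in> gen_module. fst m = 0 \<and> Poly_Mapping.keys (snd m) \<subseteq> Fsym ` S}" and Q: "Q (0 :: 'r gens)"
      "\<forall>x\<in>gen_module. \<forall>y\<in>gen_module. Q x \<longrightarrow> Q y \<longrightarrow> Q (x + y)" "\<forall>k\<in>K. \<forall>b\<in>F ` S. Q (lact k b)"
    have "Q (lact k (sy 1 s))" if "k \<in> K" "s \<in> Poly_Mapping.keys (snd u)" for k s
      using Q(3) u that by blast
    then show "Q u" using u Q by (intro gens_sum_induct[of u Q]) (simp_all del: lact_sy lact_rg)
  next
    fix u k assume u: "u \<in> {m \<in> gen_module. fst m = 0 \<and> Poly_Mapping.keys (snd m) \<subseteq> Fsym ` S}" and "k \<in> K"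
    have "Poly_Mapping.keys (snd (ract u k)) \<subseteq> Poly_Mapping.keys (snd u)"
      by (auto simp: in_keys_iff)
    with u \<open>k \<in> K\<close> show "ract u k \<in> {m \<in> gen_module. fst m = 0 \<and> Poly_Mapping.keys (snd m) \<subseteq> Fsym ` S}"
      by auto
  qed (use that in auto)
  show ?thesis
  proof (cases w)
    case L\<^sub>K
    have "Q (rg u)" if "\<forall>k\<in>K. Q (lact k (rg 1))" "u \<in> K" for Q u using that by auto
    then show ?thesis unfolding L\<^sub>K decomposable_def by (auto simp del: lact_rg)
  next
    case L\<^sub>R\<^sub>t
    have "rg (J f * k) \<in> rg ` range J" if "k \<in> K" for f k using that by (metis J_scale(2) rangeI imageI)
    moreover have "Q (rg (J f))" if "\<forall>k\<in>K. \<forall>b\<in>rg ` range J. Q (lact k b)" for Q f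
      using that constants_one by (metis lact_one rangeI imageI)
    ultimately show ?thesis unfolding L\<^sub>R\<^sub>t decomposable_def by auto
  next
    case L\<^sub>R
    have "Q (rg f)" if "\<forall>k\<in>K. \<forall>b\<in>range rg. Q (lact k b)" for Q f
      using that constants_one by (metis lact_one rangeI)
    then show ?thesis unfolding L\<^sub>R decomposable_def by auto
  qed (use scal Phi in simp_all)
qed

lemma letter_gen_module: "m \<in> letter_module w \<Longrightarrow> m \<in> gen_module" "m \<in> letter_base w \<Longrightarrow> m \<in> gen_module"
  by (erule subsetD[OF conjunct1[OF decomposable_letter[unfolded decomposable_def]]])
     (erule subsetD[OF conjunct1[OF conjunct2[OF decomposable_letter[unfolded decomposable_def]]]])

lemma list_all2_gen_module:
  "list_all2 (\<lambda>w m. m \<in> letter_module w) W ms \<Longrightarrow> ms \<in> lists gen_module"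
  "list_all2 (\<lambda>w m. m \<in> letter_base w) W ms \<Longrightarrow> ms \<in> lists gen_module"
  subgoal by (induction rule: list_all2_induct) (simp_all add: letter_gen_module)
  subgoal by (induction rule: list_all2_induct) (simp_all add: letter_gen_module)
  done

lemma letter_base_module: "b \<in> letter_base w \<Longrightarrow> b \<in> letter_module w"
  using letter_gen_module(2)[of b w]
  by (cases w) (auto simp: sy_def lookup_single in_keys_iff when_def split: if_splits)

lemma word_module_carrier: "word_module W \<subseteq> carrier T"
  unfolding word_module_def by (rule span_carrier) (auto simp del: in_lists_conv_set intro!: pure_in dest: list_all2_gen_module(1))

text \<open>The rules prescribe values only on tensors of base elements. This makes such tensors
  sufficient for checking a statement about all of \<open>word_module W\<close>.\<close>

lemma word_module_span:
  "word_module W = additive_span {pure k bs | k bs. k \<in> K \<and> list_all2 (\<lambda>w b. b \<in> letter_base w) W bs}" (is "_ = additive_span ?S")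
proof
  have S: "?S \<subseteq> carrier T" by (auto simp del: in_lists_conv_set intro!: pure_in dest: list_all2_gen_module(2))
  show "word_module W \<subseteq> additive_span ?S"
    unfolding word_module_def
  proof (rule span_minimal[OF _ S], safe)
    fix c ms assume c: "c \<in> K" and ms: "list_all2 (\<lambda>w m. m \<in> letter_module w) W ms"
    have "list_all2 (\<lambda>(U, B) m. m \<in> U) (map (\<lambda>w. (letter_module w, letter_base w)) W) ms"
      using ms by (simp add: list.rel_map)
    from pure_decompose[OF this _ c, of "[]"] show "pure c ms \<in> additive_span ?S"
      by (auto simp: list.rel_map decomposable_letter)
  qed
  have mono: "list_all2 (\<lambda>w b. b \<in> letter_module w) W bs" if "list_all2 (\<lambda>w b. b \<in> letter_base w) W bs" for bs
    using that by (rule list_all2_mono) (rule letter_base_module)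
  show "additive_span ?S \<subseteq> word_module W"
    unfolding word_module_def
  proof (rule span_mono)
    show "?S \<subseteq> {pure c ms |c ms. c \<in> K \<and> list_all2 (\<lambda>w m. m \<in> letter_module w) W ms}"
      using mono by blast
  qed (auto simp del: in_lists_conv_set intro!: pure_in dest: list_all2_gen_module(1))
qed

text \<open>Existence of normal forms thereby has to be shown only for words in ring elements and
  bare symbols.\<close>

lemma carrier_T_bases: "carrier T = additive_span {pure k bs | k bs. k \<in> K \<and> bs \<in> lists bases}" (is "_ = additive_span ?S")
proof
  have S: "?S \<subseteq> carrier T" by (auto intro!: pure_in simp: bases_gen_module)
  then show "additive_span ?S \<subseteq> carrier T" by (rule span_carrier)
  show "carrier T \<subseteq> additive_span ?S"
    unfolding carrier_T_span
  proof (rule span_minimal[OF _ S], safe)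
    fix c ms assume c: "c \<in> K" and ms: "\<forall>m\<in>set ms. m \<in> gen_module"
    let ?W = "replicate (length ms) (gen_module, bases)"
    have "list_all2 (\<lambda>(U, B) m. m \<in> U) ?W ms"
      using ms by (auto simp: list_all2_conv_all_nth)
    from pure_decompose[OF this _ c, of "[]"]
    have "pure c ms \<in> additive_span {pure k bs' |k bs'. k \<in> K \<and> list_all2 (\<lambda>(U, B) b. b \<in> B) ?W bs'}"
      by (auto simp: decomposable_gen_module)
    also have "\<dots> \<subseteq> additive_span ?S"
    proof (rule span_mono[OF _ S], safe)
      fix k bs assume "k \<in> K" "list_all2 (\<lambda>(U, B) b. b \<in> B) ?W bs"
      moreover from this have "bs \<in> lists bases" by (simp add: list_all2_conv_all_nth all_set_conv_all_nth)
      ultimately show "\<exists>k' bs'. pure k bs = pure k' bs' \<and> k' \<in> K \<and> bs' \<in> lists bases" by blast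
    qed
    finally show "pure c ms \<in> additive_span ?S" .
  qed
qed

subsection \<open>Homomorphisms out of the tensor ring\<close>

definition rep :: "'r tensor \<Rightarrow> ('r word \<Rightarrow>\<^sub>0 int)" where
  "rep t = (SOME x. x \<in> carr \<and> cls x = t)"

lemma rep: assumes "t \<in> carrier T" shows "rep t \<in> carr" "cls (rep t) = t"
proof -
  have "\<exists>x. x \<in> carr \<and> cls x = t" using assms by (auto simp: carrier_T)
  from someI_ex[OF this] show "rep t \<in> carr" "cls (rep t) = t" by (auto simp: rep_def)
qed

text \<open>The integer-linear extension of \<open>g\<close>. The combination is formed among
  representatives in the free word group, where \<open>frag_extend\<close> is available, and then
  projected to \<open>T\<close>.\<close>

definition lin :: "('a \<Rightarrow> 'r tensor) \<Rightarrow> ('a \<Rightarrow>\<^sub>0 int) \<Rightarrow> 'r tensor" where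
  "lin g x = cls (frag_extend (\<lambda>a. rep (g a)) x)"

lemma frag_extend_rep_carr:
  assumes "\<And>a. g a \<in> carrier T" shows "frag_extend (\<lambda>a. rep (g a)) x \<in> carr"
  using keys_frag_extend[of "\<lambda>a. rep (g a)" x] rep(1)[OF assms] unfolding carr_def by fast

lemma lin_closed [simp]: "(\<And>a. g a \<in> carrier T) \<Longrightarrow> lin g x \<in> carrier T"
  by (simp add: lin_def frag_extend_rep_carr)

lemma lin_of [simp]: "(\<And>a. g a \<in> carrier T) \<Longrightarrow> lin g (frag_of a) = g a"
  by (simp add: lin_def rep)

lemma lin_add: "(\<And>a. g a \<in> carrier T) \<Longrightarrow> lin g (x + y) = lin g x +\<^sub>T lin g y"
  by (simp add: lin_def frag_extend_add cls_add frag_extend_rep_carr)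

lemma lin_diff: "(\<And>a. g a \<in> carrier T) \<Longrightarrow> lin g (x - y) = lin g x -\<^sub>T lin g y"
  by (simp add: lin_def frag_extend_diff cls_diff frag_extend_rep_carr)

lemma lin_zero [simp]: "lin g 0 = \<zero>\<^bsub>T\<^esub>"
  by (simp add: lin_def)

lemma T_add_diff_diff: "x \<in> carrier T \<Longrightarrow> y \<in> carrier T \<Longrightarrow> x +\<^sub>T y -\<^sub>T x -\<^sub>T y = \<zero>\<^bsub>T\<^esub>"
  by (simp add: T.minus_eq T.a_comm[of x y] T.a_assoc T.r_neg T.r_neg2)

text \<open>The universal property of the tensor ring as an additive group: a function on words that
  respects the four kinds of relations descends to the quotient.\<close>

lemma tensor_hom_exists:
  assumes cl: "\<And>c ms. c \<in> K \<Longrightarrow> ms \<in> lists gen_module \<Longrightarrow> G c ms \<in> carrier T"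
    and scalar: "\<And>c c' ms. c \<in> K \<Longrightarrow> c' \<in> K \<Longrightarrow> ms \<in> lists gen_module \<Longrightarrow> G (c + c') ms = G c ms +\<^sub>T G c' ms"
    and slot: "\<And>c ms m m' ns. c \<in> K \<Longrightarrow> m \<in> gen_module \<Longrightarrow> m' \<in> gen_module \<Longrightarrow> ms \<in> lists gen_module \<Longrightarrow> ns \<in> lists gen_module \<Longrightarrow>
      G c (ms @ (m + m') # ns) = G c (ms @ m # ns) +\<^sub>T G c (ms @ m' # ns)"
    and first: "\<And>c k m ns. c \<in> K \<Longrightarrow> k \<in> K \<Longrightarrow> m \<in> gen_module \<Longrightarrow> ns \<in> lists gen_module \<Longrightarrow> G (c * k) (m # ns) = G c (lact k m # ns)"
    and balance: "\<And>c k ms m m' ns. c \<in> K \<Longrightarrow> k \<in> K \<Longrightarrow> m \<in> gen_module \<Longrightarrow> m' \<in> gen_module \<Longrightarrow> ms \<in> lists gen_module \<Longrightarrow> ns \<in> lists gen_module \<Longrightarrow>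
      G c (ms @ ract m k # m' # ns) = G c (ms @ m # lact k m' # ns)"
  shows "\<exists>h. (\<forall>x\<in>carrier T. h x \<in> carrier T) \<and> (\<forall>x\<in>carrier T. \<forall>y\<in>carrier T. h (x +\<^sub>T y) = h x +\<^sub>T h y) \<and>
    (\<forall>c ms. c \<in> K \<longrightarrow> ms \<in> lists gen_module \<longrightarrow> h (pure c ms) = G c ms)"
proof -
  \<comment> \<open>Zero outside the proper words, because \<open>lin\<close> asks for a value in
    \<open>T\<close> at every word of the type.\<close>
  define g where "g u = (if u \<in> words then G (fst u) (snd u) else \<zero>\<^bsub>T\<^esub>)" for u
  have g_in: "g u \<in> carrier T" for u using cl by (auto simp: g_def)
  have g_word: "g (c, ms) = G c ms" if "c \<in> K" "ms \<in> lists gen_module" for c ms using that by (simp add: g_def)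
  have null: "lin g x = \<zero>\<^bsub>T\<^esub>" if "x \<in> tensor_null" for x using that
  proof (induction x rule: tensor_null_induct)
    case (rel x)
    then show ?case
    proof (cases rule: tensor_relations_cases)
      case (scalar c c' ms)
      then show ?thesis using assms(2)[of c c' ms] cl[of c ms] cl[of c' ms]
        by (simp add: lin_diff g_in g_word T_add_diff_diff)
    next
      case (slot c ms m m' ns)
      then show ?thesis using assms(3)[of c m m' ms ns] cl[of c "ms @ m # ns"] cl[of c "ms @ m' # ns"]
        by (simp add: lin_diff g_in g_word T_add_diff_diff)
    next
      case (first c k m ns)
      then show ?thesis using assms(4)[of c k m ns] cl[of c "lact k m # ns"]
        by (simp add: lin_diff g_in g_word T.minus_eq T.r_neg)
    next
      case (balance c k ms m m' ns)
      then show ?thesis using assms(5)[of c k m m' ms ns] cl[of c "ms @ m # lact k m' # ns"]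
        by (simp add: lin_diff g_in g_word T.minus_eq T.r_neg)
    qed
  qed (simp_all add: lin_diff g_in T.minus_eq T.r_neg)
  have eq: "lin g x = lin g y" if "x \<in> carr" "y \<in> carr" "cls x = cls y" for x y
  proof -
    have "x - y \<in> tensor_null" using that cls_eq_zero[of "x - y"] by (simp add: cls_diff T.minus_eq T.r_neg)
    then show ?thesis using null[of "x - y"] by (simp add: lin_diff g_in)
  qed
  define h where "h t = lin g (rep t)" for t
  have h_cls: "h (cls x) = lin g x" if "x \<in> carr" for x
    using eq[of "rep (cls x)" x] rep[of "cls x"] that by (simp add: h_def)
  show ?thesis
  proof (intro exI conjI ballI allI impI)
    fix x y assume "x \<in> carrier T" "y \<in> carrier T"
    then obtain a b where "a \<in> carr" "b \<in> carr" "x = cls a" "y = cls b" by (auto simp: carrier_T)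
    then show "h (x +\<^sub>T y) = h x +\<^sub>T h y"
      using h_cls[of "a + b"] by (simp add: h_cls cls_add lin_add[of g, OF g_in])
    show "h x \<in> carrier T" by (simp add: h_def g_in)
  next
    fix c ms assume "c \<in> K" "ms \<in> lists gen_module"
    then show "h (pure c ms) = G c ms" by (simp add: pure_cls h_cls g_in g_word)
  qed
qed

text \<open>Data for a bimodule homomorphism from the \<open>n\<close>-th tensor power of \<open>M\<close> to the tensor ring.\<close>

definition multi_hom :: "nat \<Rightarrow> ('r gens list \<Rightarrow> 'r tensor) \<Rightarrow> bool" where
  "multi_hom n G \<longleftrightarrow>
    (\<forall>ms\<in>lists gen_module. length ms = n \<longrightarrow> G ms \<in> carrier T) \<and>
    (\<forall>ms m m' ns. m \<in> gen_module \<longrightarrow> m' \<in> gen_module \<longrightarrow> ms \<in> lists gen_module \<longrightarrow> ns \<in> lists gen_module \<longrightarrow>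
       length ms + Suc (length ns) = n \<longrightarrow> G (ms @ (m + m') # ns) = G (ms @ m # ns) +\<^sub>T G (ms @ m' # ns)) \<and>
    (\<forall>k\<in>K. \<forall>ms m m' ns. m \<in> gen_module \<longrightarrow> m' \<in> gen_module \<longrightarrow> ms \<in> lists gen_module \<longrightarrow> ns \<in> lists gen_module \<longrightarrow>
       length ms + Suc (Suc (length ns)) = n \<longrightarrow> G (ms @ ract m k # m' # ns) = G (ms @ m # lact k m' # ns)) \<and>
    (\<forall>k\<in>K. \<forall>m ns. m \<in> gen_module \<longrightarrow> ns \<in> lists gen_module \<longrightarrow> Suc (length ns) = n \<longrightarrow>
       G (lact k m # ns) = sc k *\<^sub>T G (m # ns)) \<and>
    (\<forall>k\<in>K. \<forall>m ms. m \<in> gen_module \<longrightarrow> ms \<in> lists gen_module \<longrightarrow> Suc (length ms) = n \<longrightarrow>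
       G (ms @ [ract m k]) = G (ms @ [m]) *\<^sub>T sc k)"

lemma letter_module_ract: "m \<in> letter_module w \<Longrightarrow> k \<in> K \<Longrightarrow> ract m k \<in> letter_module w"
  by (rule conjunct1[OF conjunct2[OF conjunct2[OF decomposable_letter[unfolded decomposable_def]]], rule_format])

lemma T_diff_distr:
  assumes "a \<in> carrier T" "b \<in> carrier T" "c \<in> carrier T"
  shows "(a -\<^sub>T b) *\<^sub>T c = a *\<^sub>T c -\<^sub>T b *\<^sub>T c" "c *\<^sub>T (a -\<^sub>T b) = c *\<^sub>T a -\<^sub>T c *\<^sub>T b"
  using assms by (simp_all add: T.minus_eq T.l_distr T.r_distr T.l_minus T.r_minus)

text \<open>\<open>word_module W\<close> is a subgroup of \<open>T\<close> and has no universal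
  property of its own. The data \<open>G\<close> are therefore multilinear on all of
  \<open>M\<close>; they define a map on \<open>T\<close>, which is then restricted. For the rules
  this means extending each prescription from the summand of the word to the whole tensor
  power.\<close>

lemma bimodule_hom_exists:
  assumes G: "multi_hom (length W) G" and "W \<noteq> []"
  obtains h where "h \<in> bimodule_homs W"
    "\<And>ms. list_all2 (\<lambda>w m. m \<in> letter_module w) W ms \<Longrightarrow> h (tens ms) = G ms"
proof -
  define n where "n = length W"
  have n: "n > 0" using \<open>W \<noteq> []\<close> by (simp add: n_def)
  note G' = G[unfolded multi_hom_def, folded n_def]
  have cl: "\<And>ms. ms \<in> lists gen_module \<Longrightarrow> length ms = n \<Longrightarrow> G ms \<in> carrier T"
    by (rule conjunct1[OF G', rule_format])
  have slot: "\<And>ms m m' ns. m \<in> gen_module \<Longrightarrow> m' \<in> gen_module \<Longrightarrow> ms \<in> lists gen_module \<Longrightarrow> ns \<in> lists gen_module \<Longrightarrow>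
       length ms + Suc (length ns) = n \<Longrightarrow> G (ms @ (m + m') # ns) = G (ms @ m # ns) +\<^sub>T G (ms @ m' # ns)"
    by (rule conjunct1[OF conjunct2[OF G'], rule_format])
  have bal: "\<And>k ms m m' ns. k \<in> K \<Longrightarrow> m \<in> gen_module \<Longrightarrow> m' \<in> gen_module \<Longrightarrow> ms \<in> lists gen_module \<Longrightarrow> ns \<in> lists gen_module \<Longrightarrow>
       length ms + Suc (Suc (length ns)) = n \<Longrightarrow> G (ms @ ract m k # m' # ns) = G (ms @ m # lact k m' # ns)"
    by (rule conjunct1[OF conjunct2[OF conjunct2[OF G']], rule_format])
  have left: "\<And>k m ns. k \<in> K \<Longrightarrow> m \<in> gen_module \<Longrightarrow> ns \<in> lists gen_module \<Longrightarrow> Suc (length ns) = n \<Longrightarrow>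
       G (lact k m # ns) = sc k *\<^sub>T G (m # ns)"
    by (rule conjunct1[OF conjunct2[OF conjunct2[OF conjunct2[OF G']]], rule_format])
  have right: "\<And>k m ms. k \<in> K \<Longrightarrow> m \<in> gen_module \<Longrightarrow> ms \<in> lists gen_module \<Longrightarrow> Suc (length ms) = n \<Longrightarrow>
       G (ms @ [ract m k]) = G (ms @ [m]) *\<^sub>T sc k"
    by (rule conjunct2[OF conjunct2[OF conjunct2[OF conjunct2[OF G']]], rule_format])
  \<comment> \<open>Other tensor degrees are sent to zero. Every relation is homogeneous, so both
    sides of a relation always fall into the same branch.\<close>
  define H where "H c ms = (if length ms = n then sc c *\<^sub>T G ms else \<zero>\<^bsub>T\<^esub>)" for c ms
  have Hcl: "H c ms \<in> carrier T" if "c \<in> K" "ms \<in> lists gen_module" for c ms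
    using that cl by (simp add: H_def)
  obtain h where h: "\<And>x. x \<in> carrier T \<Longrightarrow> h x \<in> carrier T"
    "\<And>x y. x \<in> carrier T \<Longrightarrow> y \<in> carrier T \<Longrightarrow> h (x +\<^sub>T y) = h x +\<^sub>T h y"
    "\<And>c ms. c \<in> K \<Longrightarrow> ms \<in> lists gen_module \<Longrightarrow> h (pure c ms) = H c ms"
  proof -
    have "\<exists>h. (\<forall>x\<in>carrier T. h x \<in> carrier T) \<and> (\<forall>x\<in>carrier T. \<forall>y\<in>carrier T. h (x +\<^sub>T y) = h x +\<^sub>T h y) \<and>
    (\<forall>c ms. c \<in> K \<longrightarrow> ms \<in> lists gen_module \<longrightarrow> h (pure c ms) = H c ms)"
    proof (rule tensor_hom_exists[OF Hcl])
      fix c c' ms assume "c \<in> K" "c' \<in> K" "ms \<in> lists gen_module"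
      then show "H (c + c') ms = H c ms +\<^sub>T H c' ms"
        using cl[of ms] by (simp add: H_def sc_add T.l_distr)
    next
      fix c m m' ms ns assume *: "c \<in> K" "m \<in> gen_module" "m' \<in> gen_module" "ms \<in> lists gen_module" "ns \<in> lists gen_module"
      then show "H c (ms @ (m + m') # ns) = H c (ms @ m # ns) +\<^sub>T H c (ms @ m' # ns)"
        using cl[of "ms @ m # ns"] cl[of "ms @ m' # ns"] slot[of m m' ms ns] by (simp add: H_def T.r_distr)
    next
      fix c k m ns assume "c \<in> K" "k \<in> K" "m \<in> gen_module" "ns \<in> lists gen_module"
      then show "H (c * k) (m # ns) = H c (lact k m # ns)"
        using cl[of "m # ns"] left[of k m ns] by (simp add: H_def sc_mult T.m_assoc)
    next
      fix c k ms m m' ns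
      assume "c \<in> K" "k \<in> K" "m \<in> gen_module" "m' \<in> gen_module" "ms \<in> lists gen_module" "ns \<in> lists gen_module"
      then show "H c (ms @ ract m k # m' # ns) = H c (ms @ m # lact k m' # ns)"
        using bal[of k m m' ms ns] by (simp add: H_def)
    qed
    then obtain h where h: "(\<forall>x\<in>carrier T. h x \<in> carrier T) \<and> (\<forall>x\<in>carrier T. \<forall>y\<in>carrier T. h (x +\<^sub>T y) = h x +\<^sub>T h y) \<and>
      (\<forall>c ms. c \<in> K \<longrightarrow> ms \<in> lists gen_module \<longrightarrow> h (pure c ms) = H c ms)" ..
    show ?thesis by (rule that[of h]; use h in simp)
  qed
  have h_zero: "h \<zero>\<^bsub>T\<^esub> = \<zero>\<^bsub>T\<^esub>"
  proof (rule T_idem)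
    show "h \<zero>\<^bsub>T\<^esub> +\<^sub>T h \<zero>\<^bsub>T\<^esub> = h \<zero>\<^bsub>T\<^esub>"
      using h(2)[OF T.zero_closed T.zero_closed] by (simp only: T.l_zero[OF T.zero_closed])
  qed (simp add: h(1))
  have h_diff: "h (x -\<^sub>T y) = h x -\<^sub>T h y" if "x \<in> carrier T" "y \<in> carrier T" for x y
  proof -
    have "x -\<^sub>T y +\<^sub>T y = x" using that by (simp add: T.minus_eq T.a_assoc T.l_neg)
    then have "h x = h (x -\<^sub>T y) +\<^sub>T h y" using h(2)[of "x -\<^sub>T y" y] that by simp
    then show ?thesis using that by (simp add: T.minus_eq T.a_assoc T.r_neg h(1))
  qed
  have lr: "h (sc k *\<^sub>T x) = sc k *\<^sub>T h x \<and> h (x *\<^sub>T sc k) = h x *\<^sub>T sc k" if k: "k \<in> K" and x: "x \<in> carrier T" for k x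
  proof -
    have S: "{pure c ms |c ms. c \<in> K \<and> ms \<in> lists gen_module} \<subseteq> carrier T" by auto
    show ?thesis
      using x[unfolded carrier_T_span] S
    proof (induction x rule: span_induct)
      case zero
      then show ?case using k by (simp add: h_zero)
    next
      case (incl x)
      then obtain c ms where x: "x = pure c ms" "c \<in> K" "ms \<in> lists gen_module" by blast
      have "h (sc k *\<^sub>T x) = sc k *\<^sub>T h x"
      proof -
        have "h (sc k *\<^sub>T x) = H (k * c) ms" "h x = H c ms" using x k by (simp_all add: sc_mult_pure h(3))
        then show ?thesis using x k cl[of ms] by (simp add: H_def sc_mult T.m_assoc)
      qed
      moreover have "h (x *\<^sub>T sc k) = h x *\<^sub>T sc k"
      \<comment> \<open>With \<open>n > 0\<close> the empty word has value zero; otherwise the right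
        scalar enters the last slot, where \<open>G\<close> is linear on the right if the length is
        \<open>n\<close>.\<close>
      proof (cases ms rule: rev_cases)
        case Nil
        then show ?thesis using x k n by (simp add: sc_mult_pure h(3) H_def)
      next
        case (snoc us u)
        then show ?thesis using x k cl[of ms] right[of k u us]
          by (simp add: pure_snoc_sc h(3) H_def T.m_assoc)
      qed
      ultimately show ?case ..
    next
      case (diff x y)
      then have xy: "x \<in> carrier T" "y \<in> carrier T" using span_carrier[OF S] by auto
      show ?case using diff xy k by (simp add: h_diff h(1) T_diff_distr)
    qed
  qed
  have sub: "x \<in> carrier T" if "x \<in> word_module W" for x using that word_module_carrier by blast
  have pure_mod: "pure c ms \<in> word_module W" if "c \<in> K" "list_all2 (\<lambda>w m. m \<in> letter_module w) W ms" for c ms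
    unfolding word_module_def using that by (intro span_incl) blast
  have S: "{pure c ms | c ms. c \<in> K \<and> list_all2 (\<lambda>w m. m \<in> letter_module w) W ms} \<subseteq> carrier T"
    by (auto simp del: in_lists_conv_set intro!: pure_in dest: list_all2_gen_module(1))
  have add_mod: "x +\<^sub>T y \<in> word_module W" if "x \<in> word_module W" "y \<in> word_module W" for x y
    using that unfolding word_module_def by (rule span_add)
  have mul_mod: "sc k *\<^sub>T x \<in> word_module W \<and> x *\<^sub>T sc k \<in> word_module W" if k: "k \<in> K" and x: "x \<in> word_module W" for k x
    using x S unfolding word_module_def
  proof (induction x rule: span_induct)
    case zero
    then show ?case using k by simp
  next
    case (incl x)
    then obtain c ms where x: "x = pure c ms" "c \<in> K" "list_all2 (\<lambda>w m. m \<in> letter_module w) W ms" by blast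
    have gm: "ms \<in> lists gen_module" using x list_all2_gen_module by blast
    obtain us u where ms: "ms = us @ [u]" using x(3) \<open>W \<noteq> []\<close> by (cases ms rule: rev_cases) auto
    obtain V v where W: "W = V @ [v]" and V: "list_all2 (\<lambda>w m. m \<in> letter_module w) V us" and u: "u \<in> letter_module v"
      using x(3) ms by (auto simp: list_all2_append2 list_all2_Cons2)
    have "ract u k \<in> letter_module v"
      using u k by (rule letter_module_ract)
    then have "list_all2 (\<lambda>w m. m \<in> letter_module w) W (us @ [ract u k])" using W V by (auto intro!: list_all2_appendI)
    moreover have "x *\<^sub>T sc k = pure c (us @ [ract u k])" using x ms gm k by (simp add: pure_snoc_sc)
    moreover have "sc k *\<^sub>T x = pure (k * c) ms" using x gm k by (simp add: sc_mult_pure)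
    ultimately show ?case using x k pure_mod[of "k * c" ms] pure_mod[of c "us @ [ract u k]"]
      unfolding word_module_def by simp
  next
    case (diff x y)
    have "x \<in> carrier T" "y \<in> carrier T" using diff(1,2) span_carrier[OF S] by auto
    then show ?case using diff k by (simp add: span_diff[OF _ _ S] T_diff_distr)
  qed
  let ?h = "restrict h (word_module W)"
  have "?h \<in> bimodule_homs W"
    unfolding bimodule_homs_def using h sub add_mod mul_mod lr by auto
  moreover have "?h (tens ms) = G ms" if "list_all2 (\<lambda>w m. m \<in> letter_module w) W ms" for ms
  proof -
    have "ms \<in> lists gen_module" "length ms = n" using that list_all2_gen_module list_all2_lengthD[OF that] by (auto simp: n_def)
    moreover have "sc 1 *\<^sub>T G ms = G ms" using cl[OF calculation] T_one T.l_one by simp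
    ultimately show ?thesis using pure_mod[OF constants_one that] by (simp add: h(3) H_def)
  qed
  ultimately show ?thesis using that by blast
qed

lemma multi_hom_1:
  assumes "\<And>m. m \<in> gen_module \<Longrightarrow> u m \<in> carrier T"
    and "\<And>m m'. m \<in> gen_module \<Longrightarrow> m' \<in> gen_module \<Longrightarrow> u (m + m') = u m +\<^sub>T u m'"
    and "\<And>k m. k \<in> K \<Longrightarrow> m \<in> gen_module \<Longrightarrow> u (lact k m) = sc k *\<^sub>T u m"
    and "\<And>k m. k \<in> K \<Longrightarrow> m \<in> gen_module \<Longrightarrow> u (ract m k) = u m *\<^sub>T sc k"
  shows "multi_hom 1 (\<lambda>ms. u (ms ! 0))"
  unfolding multi_hom_def by (auto simp: assms length_Suc_conv)

lemma multi_hom_2: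
  assumes cl: "\<And>a b. a \<in> gen_module \<Longrightarrow> b \<in> gen_module \<Longrightarrow> g a b \<in> carrier T"
    and add1: "\<And>a a' b. a \<in> gen_module \<Longrightarrow> a' \<in> gen_module \<Longrightarrow> b \<in> gen_module \<Longrightarrow> g (a + a') b = g a b +\<^sub>T g a' b"
    and add2: "\<And>a b b'. a \<in> gen_module \<Longrightarrow> b \<in> gen_module \<Longrightarrow> b' \<in> gen_module \<Longrightarrow> g a (b + b') = g a b +\<^sub>T g a b'"
    and bal: "\<And>k a b. k \<in> K \<Longrightarrow> a \<in> gen_module \<Longrightarrow> b \<in> gen_module \<Longrightarrow> g (ract a k) b = g a (lact k b)"
    and left: "\<And>k a b. k \<in> K \<Longrightarrow> a \<in> gen_module \<Longrightarrow> b \<in> gen_module \<Longrightarrow> g (lact k a) b = sc k *\<^sub>T g a b"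
    and right: "\<And>k a b. k \<in> K \<Longrightarrow> a \<in> gen_module \<Longrightarrow> b \<in> gen_module \<Longrightarrow> g a (ract b k) = g a b *\<^sub>T sc k"
  shows "multi_hom 2 (\<lambda>ms. g (ms ! 0) (ms ! 1))"
  unfolding multi_hom_def
proof (intro conjI allI ballI impI)
  fix ms m m' ns
  assume *: "m \<in> gen_module" "m' \<in> gen_module" "ms \<in> lists gen_module" "ns \<in> lists gen_module"
    and "length ms + Suc (length ns) = 2"
  then consider a where "ms = []" "ns = [a]" | a where "ms = [a]" "ns = []"
    by (cases ms; cases ns) auto
  then show "g ((ms @ (m + m') # ns) ! 0) ((ms @ (m + m') # ns) ! 1) =
     g ((ms @ m # ns) ! 0) ((ms @ m # ns) ! 1) +\<^sub>T g ((ms @ m' # ns) ! 0) ((ms @ m' # ns) ! 1)"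
    using * by cases (simp_all add: assms)
qed (auto simp: assms length_Suc_conv numeral_2_eq_2)

lemma multi_hom_3:
  assumes cl: "\<And>a b c. a \<in> gen_module \<Longrightarrow> b \<in> gen_module \<Longrightarrow> c \<in> gen_module \<Longrightarrow> g a b c \<in> carrier T"
    and add1: "\<And>a a' b c. a \<in> gen_module \<Longrightarrow> a' \<in> gen_module \<Longrightarrow> b \<in> gen_module \<Longrightarrow> c \<in> gen_module \<Longrightarrow> g (a + a') b c = g a b c +\<^sub>T g a' b c"
    and add2: "\<And>a b b' c. a \<in> gen_module \<Longrightarrow> b \<in> gen_module \<Longrightarrow> b' \<in> gen_module \<Longrightarrow> c \<in> gen_module \<Longrightarrow> g a (b + b') c = g a b c +\<^sub>T g a b' c"
    and add3: "\<And>a b c c'. a \<in> gen_module \<Longrightarrow> b \<in> gen_module \<Longrightarrow> c \<in> gen_module \<Longrightarrow> c' \<in> gen_module \<Longrightarrow> g a b (c + c') = g a b c +\<^sub>T g a b c'"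
    and bal1: "\<And>k a b c. k \<in> K \<Longrightarrow> a \<in> gen_module \<Longrightarrow> b \<in> gen_module \<Longrightarrow> c \<in> gen_module \<Longrightarrow> g (ract a k) b c = g a (lact k b) c"
    and bal2: "\<And>k a b c. k \<in> K \<Longrightarrow> a \<in> gen_module \<Longrightarrow> b \<in> gen_module \<Longrightarrow> c \<in> gen_module \<Longrightarrow> g a (ract b k) c = g a b (lact k c)"
    and left: "\<And>k a b c. k \<in> K \<Longrightarrow> a \<in> gen_module \<Longrightarrow> b \<in> gen_module \<Longrightarrow> c \<in> gen_module \<Longrightarrow> g (lact k a) b c = sc k *\<^sub>T g a b c"
    and right: "\<And>k a b c. k \<in> K \<Longrightarrow> a \<in> gen_module \<Longrightarrow> b \<in> gen_module \<Longrightarrow> c \<in> gen_module \<Longrightarrow> g a b (ract c k) = g a b c *\<^sub>T sc k"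
  shows "multi_hom 3 (\<lambda>ms. g (ms ! 0) (ms ! 1) (ms ! 2))"
  unfolding multi_hom_def
proof (intro conjI allI ballI impI)
  fix ms m m' ns
  assume *: "m \<in> gen_module" "m' \<in> gen_module" "ms \<in> lists gen_module" "ns \<in> lists gen_module"
    and "length ms + Suc (length ns) = 3"
  then consider a b where "ms = []" "ns = [a, b]" | a b where "ms = [a]" "ns = [b]" | a b where "ms = [a, b]" "ns = []"
    by (cases ms; cases "tl ms"; cases ns; cases "tl ns") auto
  then show "g ((ms @ (m + m') # ns) ! 0) ((ms @ (m + m') # ns) ! 1) ((ms @ (m + m') # ns) ! 2) =
     g ((ms @ m # ns) ! 0) ((ms @ m # ns) ! 1) ((ms @ m # ns) ! 2) +\<^sub>T
     g ((ms @ m' # ns) ! 0) ((ms @ m' # ns) ! 1) ((ms @ m' # ns) ! 2)"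
    using * by cases (simp_all add: assms)
next
  fix k ms m m' ns
  assume *: "k \<in> K" "m \<in> gen_module" "m' \<in> gen_module" "ms \<in> lists gen_module" "ns \<in> lists gen_module"
    and "length ms + Suc (Suc (length ns)) = 3"
  then consider a where "ms = []" "ns = [a]" | a where "ms = [a]" "ns = []"
    by (cases ms; cases ns) auto
  then show "g ((ms @ ract m k # m' # ns) ! 0) ((ms @ ract m k # m' # ns) ! 1) ((ms @ ract m k # m' # ns) ! 2) =
     g ((ms @ m # lact k m' # ns) ! 0) ((ms @ m # lact k m' # ns) ! 1) ((ms @ m # lact k m' # ns) ! 2)"
    using * by cases (simp_all add: assms)
qed (auto simp: assms length_Suc_conv numeral_3_eq_3 nth_Cons')

section \<open>Homomorphisms on single slots\<close>

definition bihom :: "('r gens \<Rightarrow> 'r tensor) \<Rightarrow> bool" where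
  "bihom u \<longleftrightarrow> (\<forall>m\<in>gen_module. u m \<in> carrier T) \<and> (\<forall>m\<in>gen_module. \<forall>m'\<in>gen_module. u (m + m') = u m +\<^sub>T u m') \<and>
    (\<forall>k\<in>K. \<forall>m\<in>gen_module. u (lact k m) = sc k *\<^sub>T u m \<and> u (ract m k) = u m *\<^sub>T sc k)"

lemma bihomD:
  assumes "bihom u" "m \<in> gen_module"
  shows "u m \<in> carrier T" "m' \<in> gen_module \<Longrightarrow> u (m + m') = u m +\<^sub>T u m'"
    "k \<in> K \<Longrightarrow> u (lact k m) = sc k *\<^sub>T u m" "k \<in> K \<Longrightarrow> u (ract m k) = u m *\<^sub>T sc k"
  using assms by (auto simp: bihom_def)

lemma multi_hom_prod_1: "bihom u \<Longrightarrow> multi_hom 1 (\<lambda>ms. u (ms ! 0))"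
  by (rule multi_hom_1) (auto simp: bihomD)

text \<open>Balancedness is associativity: a scalar leaves the right of \<open>u\<close> and enters
  the left of \<open>v\<close>.\<close>

lemma multi_hom_prod_2: "bihom u \<Longrightarrow> bihom v \<Longrightarrow> multi_hom 2 (\<lambda>ms. u (ms ! 0) *\<^sub>T v (ms ! 1))"
  by (rule multi_hom_2[of "\<lambda>a b. u a *\<^sub>T v b"]) (simp_all add: bihomD T.l_distr T.r_distr T.m_assoc)

lemma multi_hom_prod_3: "bihom u \<Longrightarrow> bihom v \<Longrightarrow> bihom w \<Longrightarrow> multi_hom 3 (\<lambda>ms. u (ms ! 0) *\<^sub>T v (ms ! 1) *\<^sub>T w (ms ! 2))"
  by (rule multi_hom_3[of "\<lambda>a b c. u a *\<^sub>T v b *\<^sub>T w c"]) (simp_all add: bihomD T.l_distr T.r_distr T.m_assoc)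

lemma multi_hom_zero: "multi_hom n (\<lambda>_. \<zero>\<^bsub>T\<^esub>)"
  unfolding multi_hom_def by auto

lemma T_four: "a \<in> carrier T \<Longrightarrow> b \<in> carrier T \<Longrightarrow> x \<in> carrier T \<Longrightarrow> y \<in> carrier T \<Longrightarrow>
   (a +\<^sub>T b) +\<^sub>T (x +\<^sub>T y) = (a +\<^sub>T x) +\<^sub>T (b +\<^sub>T y)"
  "a \<in> carrier T \<Longrightarrow> b \<in> carrier T \<Longrightarrow> x \<in> carrier T \<Longrightarrow> y \<in> carrier T \<Longrightarrow>
   (a +\<^sub>T b) -\<^sub>T (x +\<^sub>T y) = (a -\<^sub>T x) +\<^sub>T (b -\<^sub>T y)"
  by (simp_all add: T.minus_eq T.minus_add T.a_ac)

lemma multi_hom_add: "multi_hom n G \<Longrightarrow> multi_hom n H \<Longrightarrow> multi_hom n (\<lambda>ms. G ms +\<^sub>T H ms)"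
  unfolding multi_hom_def by (simp add: T.l_distr T.r_distr T_four)

lemma multi_hom_diff: "multi_hom n G \<Longrightarrow> multi_hom n H \<Longrightarrow> multi_hom n (\<lambda>ms. G ms -\<^sub>T H ms)"
  unfolding multi_hom_def by (simp add: T_diff_distr T_four)

lemma bihom_scalar:
  assumes "\<And>m. m \<in> gen_module \<Longrightarrow> u m \<in> K" "\<And>m m'. u (m + m') = u m + u m'"
    "\<And>k m. k \<in> K \<Longrightarrow> u (lact k m) = k * u m" "\<And>k m. k \<in> K \<Longrightarrow> m \<in> gen_module \<Longrightarrow> u (ract m k) = u m * k"
  shows "bihom (\<lambda>m. sc (u m))"
  unfolding bihom_def by (auto simp: assms sc_add sc_mult)

lemma bihom_gen:
  assumes "\<And>m. m \<in> gen_module \<Longrightarrow> v m \<in> gen_module" "\<And>m m'. v (m + m') = v m + v m'"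
    "\<And>k m. k \<in> K \<Longrightarrow> v (lact k m) = lact k (v m)" "\<And>k m. k \<in> K \<Longrightarrow> v (ract m k) = ract (v m) k"
  shows "bihom (\<lambda>m. tens [v m])"
  unfolding bihom_def by (auto simp: assms gen_add gen_lact gen_ract)

text \<open>Multiplication by a fixed tensor is a bimodule map once that tensor commutes with
  scalars, as the symbols and the ring element \<open>J 1\<close> do.\<close>

lemma bihom_central:
  assumes u: "bihom u" and x: "x \<in> carrier T" "\<And>k. k \<in> K \<Longrightarrow> x *\<^sub>T sc k = sc k *\<^sub>T x"
  shows "bihom (\<lambda>m. x *\<^sub>T u m)" "bihom (\<lambda>m. u m *\<^sub>T x)"
proof -
  have "x *\<^sub>T (sc k *\<^sub>T y) = sc k *\<^sub>T (x *\<^sub>T y)" if "k \<in> K" "y \<in> carrier T" for k y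
    using that x T.m_assoc[of x "sc k" y] T.m_assoc[of "sc k" x y] by simp
  then show "bihom (\<lambda>m. x *\<^sub>T u m)"
    using x unfolding bihom_def by (simp add: bihomD[OF u] T.r_distr T.m_assoc)
  show "bihom (\<lambda>m. u m *\<^sub>T x)"
    using x unfolding bihom_def by (simp add: bihomD[OF u] T.l_distr T.m_assoc)
qed

subsection \<open>The reduction rules exist\<close>

abbreviation coord :: "'r symb \<Rightarrow> 'r gens \<Rightarrow> 'r" where
  "coord s m \<equiv> Poly_Mapping.lookup (snd m) s"

definition Phi_part :: "'r gens \<Rightarrow> 'r gens" where
  "Phi_part m = m - rg (fst m) - sy (coord Dsym m) Dsym - sy (coord Isym m) Isym"

lemma fst_Phi_part [simp]: "fst (Phi_part m) = 0"
  and coord_Phi_part: "coord s (Phi_part m) = (if s = Dsym \<or> s = Isym then 0 else coord s m)"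
  by (auto simp: Phi_part_def rg_def sy_def lookup_minus lookup_single when_def)

text \<open>The functional part of \<open>m\<close> is a left combination of functionals; this is
  the value of that combination at \<open>f\<close>. The coefficients of \<partial> and \<integral>
  do not enter.\<close>

definition pairing :: "'r gens \<Rightarrow> 'r \<Rightarrow> 'r" where
  "pairing m f = (\<Sum>s\<in>Poly_Mapping.keys (snd m). case s of Fsym \<phi> \<Rightarrow> coord s m * \<phi> f | _ \<Rightarrow> 0)"

lemma pairing_superset:
  assumes "finite A" "Poly_Mapping.keys (snd m) \<subseteq> A"
  shows "pairing m f = (\<Sum>s\<in>A. case s of Fsym \<phi> \<Rightarrow> coord s m * \<phi> f | _ \<Rightarrow> 0)"
  unfolding pairing_def using assms
  by (intro sum.mono_neutral_left) (auto simp: in_keys_iff split: symb.splits)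

lemma pairing_add_left: "pairing (m + m') f = pairing m f + pairing m' f"
proof -
  let ?A = "Poly_Mapping.keys (snd m) \<union> Poly_Mapping.keys (snd m')"
  have "pairing (m + m') f = (\<Sum>s\<in>?A. case s of Fsym \<phi> \<Rightarrow> coord s (m + m') * \<phi> f | _ \<Rightarrow> 0)"
    using keys_add[of "snd m" "snd m'"] by (intro pairing_superset) auto
  also have "\<dots> = (\<Sum>s\<in>?A. (case s of Fsym \<phi> \<Rightarrow> coord s m * \<phi> f | _ \<Rightarrow> 0) + (case s of Fsym \<phi> \<Rightarrow> coord s m' * \<phi> f | _ \<Rightarrow> 0))"
    by (intro sum.cong refl) (auto simp: lookup_add distrib_right split: symb.splits)
  also have "\<dots> = pairing m f + pairing m' f"
    by (simp add: sum.distrib pairing_superset[of ?A])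
  finally show ?thesis .
qed

lemma pairing_lact: "pairing (lact k m) f = k * pairing m f"
proof -
  have "pairing (lact k m) f = (\<Sum>s\<in>Poly_Mapping.keys (snd m). case s of Fsym \<phi> \<Rightarrow> coord s (lact k m) * \<phi> f | _ \<Rightarrow> 0)"
    by (intro pairing_superset) (auto simp: in_keys_iff)
  also have "\<dots> = (\<Sum>s\<in>Poly_Mapping.keys (snd m). k * (case s of Fsym \<phi> \<Rightarrow> coord s m * \<phi> f | _ \<Rightarrow> 0))"
    by (intro sum.cong refl) (auto simp: mult.assoc split: symb.splits)
  finally show ?thesis by (simp add: pairing_def sum_distrib_left)
qed

lemma keys_gen_module: "m \<in> gen_module \<Longrightarrow> Fsym \<phi> \<in> Poly_Mapping.keys (snd m) \<Longrightarrow> \<phi> \<in> \<Phi>"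
  unfolding gen_module_iff in_keys_iff by blast

text \<open>Left linearity of the functionals turns a right scalar on the symbol into a left scalar
  on the argument, which is the balancing condition for the first two slots of the rule for \<Phi>,
  R, \<Phi>.\<close>

lemma pairing_ract:
  assumes "m \<in> gen_module" "k \<in> K" shows "pairing (ract m k) f = pairing m (k * f)"
proof -
  have "pairing (ract m k) f = (\<Sum>s\<in>Poly_Mapping.keys (snd m). case s of Fsym \<phi> \<Rightarrow> coord s (ract m k) * \<phi> f | _ \<Rightarrow> 0)"
    by (intro pairing_superset) (auto simp: in_keys_iff)
  also have "\<dots> = pairing m (k * f)" unfolding pairing_def
    by (intro sum.cong refl) (auto simp: mult.assoc assms dest!: keys_gen_module[OF assms(1)] split: symb.splits)
  finally show ?thesis .
qed

lemma pairing_add_right: "m \<in> gen_module \<Longrightarrow> pairing m (f + g) = pairing m f + pairing m g"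
  unfolding pairing_def sum.distrib[symmetric]
  by (intro sum.cong refl) (auto simp: functional_add distrib_left dest!: keys_gen_module split: symb.splits)

lemma pairing_scale_right: "m \<in> gen_module \<Longrightarrow> k \<in> K \<Longrightarrow> pairing m (f * k) = pairing m f * k"
  unfolding pairing_def sum_distrib_right
  by (intro sum.cong refl) (auto simp: mult.assoc dest!: keys_gen_module split: symb.splits)

lemma constants_sum: "(\<And>s. s \<in> A \<Longrightarrow> g s \<in> K) \<Longrightarrow> (\<Sum>s\<in>A. g s) \<in> K"
  by (induction A rule: infinite_finite_induct) auto

lemma pairing_in [simp]: "m \<in> gen_module \<Longrightarrow> pairing m f \<in> K"
  unfolding pairing_def
  by (rule constants_sum) (auto simp: gen_module_iff dest: keys_gen_module split: symb.splits)

lemma pairing_F [simp]: "pairing (F \<phi>) f = \<phi> f"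
  by (simp add: pairing_def sy_def)

lemma coord_in [simp]: "m \<in> gen_module \<Longrightarrow> coord s m \<in> K"
  by (simp add: gen_module_iff)

lemma Phi_part_in [simp]: "m \<in> gen_module \<Longrightarrow> Phi_part m \<in> gen_module"
  unfolding gen_module_iff[of "Phi_part m"] coord_Phi_part by (auto simp: gen_module_iff)

lemma bihom_coord: "bihom (\<lambda>m. sc (coord s m))"
  by (rule bihom_scalar) (auto simp: lookup_add)

lemma bihom_coord_sy: "s' \<in> {Dsym, Isym} \<union> Fsym ` \<Phi> \<Longrightarrow> bihom (\<lambda>m. tens [sy (coord s m) s'])"
  by (rule bihom_gen) (auto simp: lookup_add sy_add simp del: Un_iff)

lemma bihom_evaluation: "bihom (\<lambda>m. sc (E (fst m)))"
  by (rule bihom_scalar) (auto simp: evaluation_add)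

lemma bihom_ring: "bihom (\<lambda>m. tens [rg (fst m)])" "bihom (\<lambda>m. tens [rg (d (fst m))])" "bihom (\<lambda>m. tens [rg (J (fst m))])"
  by (rule bihom_gen; simp add: rg_add d_add J_add)+

lemma bihom_Phi: "bihom (\<lambda>m. tens [Phi_part m])"
  by (rule bihom_gen) (auto intro!: gens_eqI simp: lookup_add coord_Phi_part)

text \<open>A right scalar moves to the argument as \<open>k * 1\<close>, which equals
  \<open>1 * k\<close>, and leaves on the right by right linearity.\<close>

lemma bihom_pairing_1: "bihom (\<lambda>m. sc (pairing m 1))"
proof (rule bihom_scalar)
  fix k m assume "k \<in> K" "m \<in> gen_module"
  then show "pairing (ract m k) 1 = pairing m 1 * k"
    using pairing_ract[of m k 1] pairing_scale_right[of m k 1] by simp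
qed (simp_all add: pairing_add_left pairing_lact)

text \<open>Both sides come from \<open>J k\<close>, read as \<open>J (1 * k)\<close> and as
  \<open>J (k * 1)\<close>.\<close>

lemma J_1_central: "k \<in> K \<Longrightarrow> tens [rg (J 1)] *\<^sub>T sc k = sc k *\<^sub>T tens [rg (J 1)]"
  using gen_ract[of k "rg (J 1)"] gen_lact[of k "rg (J 1)"] J_scale(1)[of k 1] J_scale(2)[of k 1] by simp

text \<open>A rule set contains something only if a homomorphism with the prescribed values exists.
  This predicate joins the existence of such a rule with its value on one base word.\<close>

definition redex :: "letter list \<Rightarrow> 'r gens list \<Rightarrow> 'r tensor \<Rightarrow> bool" where
  "redex W bs v \<longleftrightarrow> (\<exists>h. (W, h) \<in> \<Sigma>_IDO \<and> list_all2 (\<lambda>w b. b \<in> letter_base w) W bs \<and> h (tens bs) = v)"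

text \<open>All prescriptions concern base tensors, so knowing the constructed homomorphism on them
  is enough to recognise it as a rule.\<close>

lemma redexI:
  assumes G: "multi_hom n G" "length W = n" "n > 0"
    and rule: "\<And>h. h \<in> bimodule_homs W \<Longrightarrow> (\<And>ms. list_all2 (\<lambda>w b. b \<in> letter_base w) W ms \<Longrightarrow> h (tens ms) = G ms) \<Longrightarrow> (W, h) \<in> \<Sigma>_IDO"
    and bs: "list_all2 (\<lambda>w b. b \<in> letter_base w) W bs" "G bs = v"
  shows "redex W bs v"
proof -
  obtain h where hom: "h \<in> bimodule_homs W" and val: "\<And>ms. list_all2 (\<lambda>w m. m \<in> letter_module w) W ms \<Longrightarrow> h (tens ms) = G ms"
    using bimodule_hom_exists[of W G] G by auto
  have val': "h (tens ms) = G ms" if "list_all2 (\<lambda>w b. b \<in> letter_base w) W ms" for ms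
    using that by (intro val) (erule list_all2_mono, erule letter_base_module)
  have "(W, h) \<in> \<Sigma>_IDO" using hom val' by (rule rule)
  then show ?thesis unfolding redex_def using bs val'[OF bs(1)] by blast
qed

lemma tens_one [simp]: "x \<in> carrier T \<Longrightarrow> \<epsilon> *\<^sub>T x = x" "x \<in> carrier T \<Longrightarrow> x *\<^sub>T \<epsilon> = x"
  using T.l_one T.r_one by (simp_all add: T_one)

lemma coord_sy [simp]: "coord s (sy c s') = (if s' = s then c else 0)"
  and coord_rg [simp]: "coord s (rg f) = 0" and fst_sy [simp]: "fst (sy c s) = 0" and fst_rg [simp]: "fst (rg f) = f"
  by (auto simp: sy_def rg_def lookup_single when_def)

lemma Phi_part_F [simp]: "Phi_part (F \<phi>) = F \<phi>"
  by (rule gens_eqI) (auto simp: coord_Phi_part)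

lemma gen_sy: "k \<in> K \<Longrightarrow> s \<in> {Dsym, Isym} \<union> Fsym ` \<Phi> \<Longrightarrow> tens [sy k s] = sc k *\<^sub>T tens [sy 1 s]"
  using gen_lact[of k "sy 1 s"] by simp

lemma sy_central: "k \<in> K \<Longrightarrow> s \<in> {Dsym, Isym} \<union> Fsym ` \<Phi> \<Longrightarrow> tens [sy 1 s] *\<^sub>T sc k = sc k *\<^sub>T tens [sy 1 s]"
  using gen_lact[of k "sy 1 s"] gen_ract[of k "sy 1 s"] by simp

text \<open>The evaluation is the identity on constants and is \<open>K\<close>-linear on both
  sides, so it extends the rule from \<open>K\<close> to all ring elements; the symbols are sent to
  zero.\<close>

lemma redex_K: "redex [L\<^sub>K] [rg 1] \<epsilon>"
  by (rule redexI[OF multi_hom_prod_1[OF bihom_evaluation], of "[L\<^sub>K]"]) (simp_all add: \<Sigma>_IDO_def rule_def)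

lemma redex_RR: "redex [L\<^sub>R, L\<^sub>R] [rg f, rg g] (tens [rg (f * g)])"
proof -
  have "multi_hom 2 (\<lambda>ms. tens [rg (fst (ms ! 0) * fst (ms ! 1))])"
  proof (rule multi_hom_2[of "\<lambda>a b. tens [rg (fst a * fst b)]"])
    fix k and a b :: "'r gens" assume "k \<in> K"
    then show "tens [rg (fst (lact k a) * fst b)] = sc k *\<^sub>T tens [rg (fst a * fst b)]"
      "tens [rg (fst a * fst (ract b k))] = tens [rg (fst a * fst b)] *\<^sub>T sc k"
      using gen_lact[of k "rg (fst a * fst b)"] gen_ract[of k "rg (fst a * fst b)"] by (simp_all add: mult.assoc)
  qed (simp_all add: distrib_left distrib_right rg_add gen_add mult.assoc)
  from redexI[OF this, of "[L\<^sub>R, L\<^sub>R]"] show ?thesis by (simp add: \<Sigma>_IDO_def rule_def)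
qed

text \<open>Both summands are products of one-slot maps: the coefficient of \<partial> times the
  second slot, once followed by \<partial>, which is harmless since \<partial> commutes with
  scalars, and once differentiated.\<close>

lemma redex_DR: "redex [L\<^sub>D, L\<^sub>R] [D, rg f] (tens [rg f, D] +\<^sub>T tens [rg (d f)])"
proof -
  have "bihom (\<lambda>m. tens [rg (fst m)] *\<^sub>T tens [D])"
    by (rule bihom_central[OF bihom_ring(1)]) (simp_all add: sy_central)
  from multi_hom_add[OF multi_hom_prod_2[OF bihom_coord this] multi_hom_prod_2[OF bihom_coord bihom_ring(2)]]
  have "multi_hom 2 (\<lambda>ms. sc (coord Dsym (ms ! 0)) *\<^sub>T (tens [rg (fst (ms ! 1))] *\<^sub>T tens [D]) +\<^sub>T
      sc (coord Dsym (ms ! 0)) *\<^sub>T tens [rg (d (fst (ms ! 1)))])" .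
  from redexI[OF this, of "[L\<^sub>D, L\<^sub>R]"] show ?thesis
    by (simp add: \<Sigma>_IDO_def rule_def pure_mult_tens)
qed

lemma redex_DPhi: "\<phi> \<in> \<Phi> \<Longrightarrow> redex [L\<^sub>D, L\<^sub>\<Phi>] [D, F \<phi>] \<zero>\<^bsub>T\<^esub>"
  by (rule redexI[OF multi_hom_zero, of "[L\<^sub>D, L\<^sub>\<Phi>]"]) (auto simp: \<Sigma>_IDO_def rule_def)

lemma redex_EI: "redex [L\<^sub>E, L\<^sub>I] [F E, I] \<zero>\<^bsub>T\<^esub>"
  by (rule redexI[OF multi_hom_zero, of "[L\<^sub>E, L\<^sub>I]"]) (auto simp: \<Sigma>_IDO_def rule_def)

lemma redex_DI: "redex [L\<^sub>D, L\<^sub>I] [D, I] \<epsilon>"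
  using redexI[OF multi_hom_prod_2[OF bihom_coord[of Dsym] bihom_coord[of Isym]], of "[L\<^sub>D, L\<^sub>I]"]
  by (simp add: \<Sigma>_IDO_def rule_def)

text \<open>The first two slots interact through the functional, so the witness is no product of
  one-slot maps and multilinearity is checked directly with \<open>pairing\<close>.\<close>

lemma redex_PhiRPhi: "\<phi> \<in> \<Phi> \<Longrightarrow> \<psi> \<in> \<Phi> \<Longrightarrow> redex [L\<^sub>\<Phi>, L\<^sub>R, L\<^sub>\<Phi>] [F \<phi>, rg f, F \<psi>] (tens [sy (\<phi> f) (Fsym \<psi>)])"
proof -
  assume *: "\<phi> \<in> \<Phi>" "\<psi> \<in> \<Phi>"
  have "multi_hom 3 (\<lambda>ms. sc (pairing (ms ! 0) (fst (ms ! 1))) *\<^sub>T tens [Phi_part (ms ! 2)])"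
    by (rule multi_hom_3[of "\<lambda>a b c. sc (pairing a (fst b)) *\<^sub>T tens [Phi_part c]"])
       (simp_all add: bihomD[OF bihom_Phi] pairing_add_left pairing_add_right pairing_lact pairing_ract pairing_scale_right
          sc_add sc_mult T.l_distr T.r_distr T.m_assoc)
  from redexI[OF this, of "[L\<^sub>\<Phi>, L\<^sub>R, L\<^sub>\<Phi>]"] * show ?thesis
    by (force simp: \<Sigma>_IDO_def rule_def gen_sy[of "_ _"])
qed

lemma redex_PhiPhi: "\<phi> \<in> \<Phi> \<Longrightarrow> \<psi> \<in> \<Phi> \<Longrightarrow> redex [L\<^sub>\<Phi>, L\<^sub>\<Phi>] [F \<phi>, F \<psi>] (tens [sy (\<phi> 1) (Fsym \<psi>)])"
  using redexI[OF multi_hom_prod_2[OF bihom_pairing_1 bihom_Phi], of "[L\<^sub>\<Phi>, L\<^sub>\<Phi>]"]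
  by (force simp: \<Sigma>_IDO_def rule_def gen_sy[of "_ _"])

text \<open>The first map renames \<integral> to \<open>E\<close> and keeps the coefficient; it
  yields the boundary terms of integration by parts.\<close>

lemma bihom_coord_IE: "bihom (\<lambda>m. tens [sy (coord Isym m) (Fsym E)])"
  and bihom_coord_II: "bihom (\<lambda>m. tens [sy (coord Isym m) Isym])"
  by (auto intro!: bihom_coord_sy)

lemma redex_IRD: "redex [L\<^sub>I, L\<^sub>R, L\<^sub>D] [I, rg f, D] (tens [rg f] -\<^sub>T tens [F E, rg f] -\<^sub>T tens [I, rg (d f)])"
  using redexI[OF multi_hom_diff[OF multi_hom_diff[OF
    multi_hom_prod_3[OF bihom_coord[of Isym] bihom_ring(1) bihom_coord[of Dsym]]
    multi_hom_prod_3[OF bihom_coord_IE bihom_ring(1) bihom_coord[of Dsym]]]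
    multi_hom_prod_3[OF bihom_coord_II bihom_ring(2) bihom_coord[of Dsym]]], of "[L\<^sub>I, L\<^sub>R, L\<^sub>D]"]
  by (simp add: \<Sigma>_IDO_def rule_def pure_mult_tens)

lemma redex_IRPhi: "\<phi> \<in> \<Phi> \<Longrightarrow> redex [L\<^sub>I, L\<^sub>R, L\<^sub>\<Phi>] [I, rg f, F \<phi>] (tens [rg (J f), F \<phi>])"
  using redexI[OF multi_hom_prod_3[OF bihom_coord[of Isym] bihom_ring(3) bihom_Phi], of "[L\<^sub>I, L\<^sub>R, L\<^sub>\<Phi>]"]
  by (force simp: \<Sigma>_IDO_def rule_def pure_mult_tens)

lemma redex_IRI: "redex [L\<^sub>I, L\<^sub>R, L\<^sub>I] [I, rg f, I] (tens [rg (J f), I] -\<^sub>T tens [F E, rg (J f), I] -\<^sub>T tens [I, rg (J f)])"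
  using redexI[OF multi_hom_diff[OF multi_hom_diff[OF
    multi_hom_prod_3[OF bihom_coord[of Isym] bihom_ring(3) bihom_coord_II]
    multi_hom_prod_3[OF bihom_coord_IE bihom_ring(3) bihom_coord_II]]
    multi_hom_prod_3[OF bihom_coord_II bihom_ring(3) bihom_coord[of Isym]]], of "[L\<^sub>I, L\<^sub>R, L\<^sub>I]"]
  by (simp add: \<Sigma>_IDO_def rule_def pure_mult_tens)

lemma redex_ID: "redex [L\<^sub>I, L\<^sub>D] [I, D] (\<epsilon> -\<^sub>T tens [F E])"
  using redexI[OF multi_hom_diff[OF
    multi_hom_prod_2[OF bihom_coord[of Isym] bihom_coord[of Dsym]]
    multi_hom_prod_2[OF bihom_coord_IE bihom_coord[of Dsym]]], of "[L\<^sub>I, L\<^sub>D]"]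
  by (simp add: \<Sigma>_IDO_def rule_def pure_mult_tens)

lemma redex_IPhi: "\<phi> \<in> \<Phi> \<Longrightarrow> redex [L\<^sub>I, L\<^sub>\<Phi>] [I, F \<phi>] (tens [rg (J 1), F \<phi>])"
proof -
  have "bihom (\<lambda>m. sc (coord Isym m) *\<^sub>T tens [rg (J 1)])"
    by (rule bihom_central[OF bihom_coord]) (simp_all add: J_1_central)
  from redexI[OF multi_hom_prod_2[OF this bihom_Phi], of "[L\<^sub>I, L\<^sub>\<Phi>]"]
  show "\<phi> \<in> \<Phi> \<Longrightarrow> ?thesis" by (force simp: \<Sigma>_IDO_def rule_def pure_mult_tens)
qed

text \<open>The constant factor \<open>J 1\<close> must stand between or beside the two symbols;
  because it commutes with scalars it can be merged into either one-slot map.\<close>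

lemma redex_II: "redex [L\<^sub>I, L\<^sub>I] [I, I] (tens [rg (J 1), I] -\<^sub>T tens [F E, rg (J 1), I] -\<^sub>T tens [I, rg (J 1)])"
proof -
  have 1: "bihom (\<lambda>m. sc (coord Isym m) *\<^sub>T tens [rg (J 1)])"
    by (rule bihom_central[OF bihom_coord]) (simp_all add: J_1_central)
  have 2: "bihom (\<lambda>m. tens [rg (J 1)] *\<^sub>T tens [sy (coord Isym m) Isym])"
    by (rule bihom_central[OF bihom_coord_II]) (simp_all add: J_1_central)
  have 3: "bihom (\<lambda>m. tens [rg (J 1)] *\<^sub>T sc (coord Isym m))"
    by (rule bihom_central[OF bihom_coord]) (simp_all add: J_1_central)
  from redexI[OF multi_hom_diff[OF multi_hom_diff[OF
    multi_hom_prod_2[OF 1 bihom_coord_II]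
    multi_hom_prod_2[OF bihom_coord_IE 2]]
    multi_hom_prod_2[OF bihom_coord_II 3]], of "[L\<^sub>I, L\<^sub>I]"]
  show ?thesis by (simp add: \<Sigma>_IDO_def rule_def pure_mult_tens)
qed

end

subsection \<open>The rules hold modulo the defining ideal\<close>

context ring
begin

text \<open>The relation is not among the generators. Evaluating \<iota>\<delta>\<iota> in two ways
  gives \<iota> = \<iota> - e\<iota>.\<close>

lemma ido_EI:
  assumes [simp]: "\<delta> \<in> carrier R" "\<iota> \<in> carrier R" "e \<in> carrier R"
    and "\<delta> \<otimes> \<iota> = \<one>" "\<iota> \<otimes> \<delta> = \<one> \<ominus> e"
  shows "e \<otimes> \<iota> = \<zero>"
proof -
  have "\<iota> = \<iota> \<otimes> (\<delta> \<otimes> \<iota>)" using assms(4) by simp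
  also have "\<dots> = (\<one> \<ominus> e) \<otimes> \<iota>" using assms(5) by (simp add: m_assoc[symmetric])
  also have "\<dots> = \<iota> \<ominus> e \<otimes> \<iota>" by (simp add: minus_eq l_distr l_minus)
  finally have 1: "\<iota> = \<iota> \<ominus> e \<otimes> \<iota>" .
  have "e \<otimes> \<iota> = \<iota> \<ominus> (\<iota> \<ominus> e \<otimes> \<iota>)" by (simp add: minus_eq minus_add r_neg2)
  also have "\<dots> = \<zero>" unfolding 1[symmetric] by (simp add: minus_eq r_neg)
  finally show ?thesis .
qed

text \<open>Multiply the Leibniz relation by \<iota> on the left and replace \<iota>\<delta> by 1 -
  e: integration by parts for operators.\<close>

lemma ido_IRD:
  assumes [simp]: "\<delta> \<in> carrier R" "\<iota> \<in> carrier R" "e \<in> carrier R" "f \<in> carrier R" "f' \<in> carrier R"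
    and "\<iota> \<otimes> \<delta> = \<one> \<ominus> e" "\<delta> \<otimes> f = f \<otimes> \<delta> \<oplus> f'"
  shows "\<iota> \<otimes> f \<otimes> \<delta> = f \<ominus> e \<otimes> f \<ominus> \<iota> \<otimes> f'"
proof -
  have "\<iota> \<otimes> f \<otimes> \<delta> \<oplus> \<iota> \<otimes> f' = \<iota> \<otimes> (\<delta> \<otimes> f)" using assms(7) by (simp add: m_assoc r_distr)
  also have "\<dots> = (\<one> \<ominus> e) \<otimes> f" using assms(6) by (simp add: m_assoc[symmetric])
  also have "\<dots> = f \<ominus> e \<otimes> f" by (simp add: minus_eq l_distr l_minus)
  finally have "f \<ominus> e \<otimes> f = \<iota> \<otimes> f \<otimes> \<delta> \<oplus> \<iota> \<otimes> f'" by simp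
  then show ?thesis by (simp add: minus_eq a_assoc r_neg)
qed

text \<open>Here g is an antiderivative of f. The Leibniz relation for g is put between two copies
  of \<iota>, after which \<delta>\<iota> = 1 and \<iota>\<delta> = 1 - e remove all occurrences of
  \<delta>.\<close>

lemma ido_IRI:
  assumes [simp]: "\<delta> \<in> carrier R" "\<iota> \<in> carrier R" "e \<in> carrier R" "f \<in> carrier R" "g \<in> carrier R"
    and "\<iota> \<otimes> \<delta> = \<one> \<ominus> e" "\<delta> \<otimes> \<iota> = \<one>" "\<delta> \<otimes> g = g \<otimes> \<delta> \<oplus> f"
  shows "\<iota> \<otimes> f \<otimes> \<iota> = g \<otimes> \<iota> \<ominus> e \<otimes> g \<otimes> \<iota> \<ominus> \<iota> \<otimes> g"
proof -
  have "\<iota> \<otimes> (\<delta> \<otimes> g) \<otimes> \<iota> = \<iota> \<otimes> g \<otimes> (\<delta> \<otimes> \<iota>) \<oplus> \<iota> \<otimes> f \<otimes> \<iota>"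
    unfolding assms(8) by (simp add: l_distr r_distr m_assoc)
  then have "\<iota> \<otimes> g \<oplus> \<iota> \<otimes> f \<otimes> \<iota> = (\<iota> \<otimes> \<delta>) \<otimes> g \<otimes> \<iota>"
    using assms(7) by (simp add: m_assoc)
  also have "\<dots> = g \<otimes> \<iota> \<ominus> e \<otimes> g \<otimes> \<iota>"
    unfolding assms(6) by (simp add: minus_eq l_distr l_minus)
  finally have "g \<otimes> \<iota> \<ominus> e \<otimes> g \<otimes> \<iota> = \<iota> \<otimes> f \<otimes> \<iota> \<oplus> \<iota> \<otimes> g" by (simp add: a_comm)
  then show ?thesis by (simp add: minus_eq a_assoc r_neg)
qed

end

context ido_functionals
begin

lemma tens_in [simp]: "ms \<in> lists gen_module \<Longrightarrow> tens ms \<in> carrier T" by simp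

lemma IDO_generators_carrier: "IDO_generators \<subseteq> carrier T"
  unfolding IDO_generators_def by auto

sublocale Id: ideal IDO_ideal T
  unfolding IDO_ideal_def by (rule T.genideal_ideal[OF IDO_generators_carrier])

abbreviation Q :: "'r tensor set ring" where "Q \<equiv> T Quot IDO_ideal"

sublocale Q: ring Q by (rule Id.quotient_is_ring)

definition q :: "'r tensor \<Rightarrow> 'r tensor set" where "q x = IDO_ideal +>\<^bsub>T\<^esub> x"

lemma q_in [simp]: "x \<in> carrier T \<Longrightarrow> q x \<in> carrier Q"
  and q_mult: "x \<in> carrier T \<Longrightarrow> y \<in> carrier T \<Longrightarrow> q (x *\<^sub>T y) = q x \<otimes>\<^bsub>Q\<^esub> q y"
  and q_add: "x \<in> carrier T \<Longrightarrow> y \<in> carrier T \<Longrightarrow> q (x +\<^sub>T y) = q x \<oplus>\<^bsub>Q\<^esub> q y"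
  and q_one: "q \<one>\<^bsub>T\<^esub> = \<one>\<^bsub>Q\<^esub>"
  using Id.rcos_ring_hom by (auto simp: ring_hom_def q_def)

lemma carrier_Q: "carrier Q = q ` carrier T"
  by (auto simp: FactRing_def A_RCOSETS_def' q_def)

lemma q_zero: "q \<zero>\<^bsub>T\<^esub> = \<zero>\<^bsub>Q\<^esub>"
  unfolding q_def by (simp add: FactRing_def Id.a_rcos_const)

lemma q_diff: assumes "x \<in> carrier T" "y \<in> carrier T" shows "q (x -\<^sub>T y) = q x \<ominus>\<^bsub>Q\<^esub> q y"
proof -
  have "x -\<^sub>T y +\<^sub>T y = x" using assms by (simp add: T.minus_eq T.a_assoc T.l_neg)
  then have "q x = q (x -\<^sub>T y) \<oplus>\<^bsub>Q\<^esub> q y" using q_add[of "x -\<^sub>T y" y] assms by simp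
  then show ?thesis using assms by (simp add: Q.minus_eq Q.a_assoc Q.r_neg)
qed

lemma q_eq_iff: "x \<in> carrier T \<Longrightarrow> y \<in> carrier T \<Longrightarrow> q x = q y \<longleftrightarrow> x -\<^sub>T y \<in> IDO_ideal"
  unfolding q_def using T.quotient_eq_iff_same_a_r_cos[OF Id.ideal_axioms] by metis

lemma q_generator: "x -\<^sub>T y \<in> IDO_generators \<Longrightarrow> x \<in> carrier T \<Longrightarrow> y \<in> carrier T \<Longrightarrow> q x = q y"
  using T.genideal_self[OF IDO_generators_carrier] by (auto simp: q_eq_iff IDO_ideal_def)

abbreviation "qr f \<equiv> q (tens [rg f])"
abbreviation "qD \<equiv> q (tens [D])"
abbreviation "qI \<equiv> q (tens [I])"
abbreviation "qF \<phi> \<equiv> q (tens [F \<phi>])"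

lemma q_tens_Cons: "m \<in> gen_module \<Longrightarrow> ms \<in> lists gen_module \<Longrightarrow> ms \<noteq> [] \<Longrightarrow> q (tens (m # ms)) = q (tens [m]) \<otimes>\<^bsub>Q\<^esub> q (tens ms)"
  by (subst tens_Cons) (simp_all add: q_mult)

lemma q_eps [simp]: "q \<epsilon> = \<one>\<^bsub>Q\<^esub>" using q_one T_one by simp

lemma q_rg_one: "qr 1 = \<one>\<^bsub>Q\<^esub>"
  using q_generator[of "tens [rg 1]" \<epsilon>] by (simp add: IDO_generators_def)

lemma q_rg_mult: "qr f \<otimes>\<^bsub>Q\<^esub> qr g = qr (f * g)"
proof -
  have "q (tens [rg f, rg g]) = q (tens [rg (f * g)])"
    by (rule q_generator) ((unfold IDO_generators_def, blast) | simp)+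
  then show ?thesis by (simp add: q_tens_Cons)
qed

lemma q_rg_zero: "qr 0 = \<zero>\<^bsub>Q\<^esub>"
  by (simp add: q_zero)

lemma T_diff_add: "x \<in> carrier T \<Longrightarrow> y \<in> carrier T \<Longrightarrow> z \<in> carrier T \<Longrightarrow> x -\<^sub>T y -\<^sub>T z = x -\<^sub>T (y +\<^sub>T z)"
  "x \<in> carrier T \<Longrightarrow> y \<in> carrier T \<Longrightarrow> z \<in> carrier T \<Longrightarrow> x -\<^sub>T y +\<^sub>T z = x -\<^sub>T (y -\<^sub>T z)"
  by (simp_all add: T.minus_eq T.minus_add T.a_assoc)

lemma q_DR: "qD \<otimes>\<^bsub>Q\<^esub> qr f = qr f \<otimes>\<^bsub>Q\<^esub> qD \<oplus>\<^bsub>Q\<^esub> qr (d f)"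
proof -
  have "q (tens [D, rg f]) = q (tens [rg f, D] +\<^sub>T tens [rg (d f)])"
    by (rule q_generator) (simp_all add: T_diff_add[symmetric], unfold IDO_generators_def, blast)
  then show ?thesis by (simp add: q_add q_tens_Cons)
qed

lemma q_DI: "qD \<otimes>\<^bsub>Q\<^esub> qI = \<one>\<^bsub>Q\<^esub>"
  using q_generator[of "tens [D, I]" \<epsilon>] by (simp add: IDO_generators_def q_tens_Cons)

lemma q_ID: "qI \<otimes>\<^bsub>Q\<^esub> qD = \<one>\<^bsub>Q\<^esub> \<ominus>\<^bsub>Q\<^esub> qF E"
proof -
  have "q (tens [I, D]) = q (\<epsilon> -\<^sub>T tens [F E])"
    by (rule q_generator) (simp_all add: T_diff_add[symmetric], unfold IDO_generators_def, blast)
  then show ?thesis by (simp add: q_diff q_tens_Cons)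
qed

lemma q_DRPhi: "\<phi> \<in> \<Phi> \<Longrightarrow> qD \<otimes>\<^bsub>Q\<^esub> (qr f \<otimes>\<^bsub>Q\<^esub> qF \<phi>) = qr (d f) \<otimes>\<^bsub>Q\<^esub> qF \<phi>"
proof -
  assume *: "\<phi> \<in> \<Phi>"
  have "q (tens [D, rg f, F \<phi>]) = q (tens [rg (d f), F \<phi>])"
    by (rule q_generator) (use * in \<open>(unfold IDO_generators_def, blast) | simp\<close>)+
  then show ?thesis using * by (simp add: q_tens_Cons)
qed

lemma q_IRPhi: "\<phi> \<in> \<Phi> \<Longrightarrow> qI \<otimes>\<^bsub>Q\<^esub> (qr f \<otimes>\<^bsub>Q\<^esub> qF \<phi>) = qr (J f) \<otimes>\<^bsub>Q\<^esub> qF \<phi>"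
proof -
  assume *: "\<phi> \<in> \<Phi>"
  have "q (tens [I, rg f, F \<phi>]) = q (tens [rg (J f), F \<phi>])"
    by (rule q_generator) (use * in \<open>(unfold IDO_generators_def, blast) | simp\<close>)+
  then show ?thesis using * by (simp add: q_tens_Cons)
qed

lemma q_PhiRPhi: "\<phi> \<in> \<Phi> \<Longrightarrow> \<psi> \<in> \<Phi> \<Longrightarrow> qF \<phi> \<otimes>\<^bsub>Q\<^esub> (qr f \<otimes>\<^bsub>Q\<^esub> qF \<psi>) = q (tens [sy (\<phi> f) (Fsym \<psi>)])"
proof -
  assume *: "\<phi> \<in> \<Phi>" "\<psi> \<in> \<Phi>"
  have "q (tens [F \<phi>, rg f, F \<psi>]) = q (tens [sy (\<phi> f) (Fsym \<psi>)])"
    by (rule q_generator) (use * in \<open>(unfold IDO_generators_def, blast) | simp\<close>)+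
  then show ?thesis using * by (simp add: q_tens_Cons)
qed

lemma q_EI: "qF E \<otimes>\<^bsub>Q\<^esub> qI = \<zero>\<^bsub>Q\<^esub>"
  by (rule Q.ido_EI[OF _ _ _ q_DI q_ID]) auto

lemma q_rule:
  assumes "(W, h) \<in> \<Sigma>_IDO" "list_all2 (\<lambda>w b. b \<in> letter_base w) W bs"
  shows "h (tens bs) \<in> carrier T" "q (h (tens bs)) = q (tens bs)" "h \<in> bimodule_homs W"
proof -
  have IRD: "qI \<otimes>\<^bsub>Q\<^esub> (qr f \<otimes>\<^bsub>Q\<^esub> qD) = qr f \<ominus>\<^bsub>Q\<^esub> qF E \<otimes>\<^bsub>Q\<^esub> qr f \<ominus>\<^bsub>Q\<^esub> qI \<otimes>\<^bsub>Q\<^esub> qr (d f)" for f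
    using Q.ido_IRD[OF _ _ _ _ _ q_ID q_DR[of f]] by (simp add: Q.m_assoc)
  have IRI: "qI \<otimes>\<^bsub>Q\<^esub> (qr f \<otimes>\<^bsub>Q\<^esub> qI) = qr (J f) \<otimes>\<^bsub>Q\<^esub> qI \<ominus>\<^bsub>Q\<^esub> qF E \<otimes>\<^bsub>Q\<^esub> (qr (J f) \<otimes>\<^bsub>Q\<^esub> qI) \<ominus>\<^bsub>Q\<^esub> qI \<otimes>\<^bsub>Q\<^esub> qr (J f)" for f
    using Q.ido_IRI[OF _ _ _ _ _ q_ID q_DI, of "qr f" "qr (J f)"] q_DR[of "J f"] by (simp add: Q.m_assoc d_J)
  show "h \<in> bimodule_homs W"
    using assms(1) unfolding \<Sigma>_IDO_def rule_def by blast
  \<comment> \<open>The rules without a ring letter are the instances f = 1 of those with one, since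
    the ring element 1 is identified with the empty tensor in the quotient; here also
    \<open>d 1 = 0\<close> is used.\<close>
  have [simp]: "\<phi> \<in> \<Phi> \<Longrightarrow> qD \<otimes>\<^bsub>Q\<^esub> qF \<phi> = \<zero>\<^bsub>Q\<^esub>" for \<phi>
    using q_DRPhi[of \<phi> 1] by (simp add: q_rg_one q_rg_zero q_zero)
  have [simp]: "\<phi> \<in> \<Phi> \<Longrightarrow> qI \<otimes>\<^bsub>Q\<^esub> qF \<phi> = qr (J 1) \<otimes>\<^bsub>Q\<^esub> qF \<phi>" for \<phi>
    using q_IRPhi[of \<phi> 1] by (simp add: q_rg_one)
  have [simp]: "\<phi> \<in> \<Phi> \<Longrightarrow> \<psi> \<in> \<Phi> \<Longrightarrow> qF \<phi> \<otimes>\<^bsub>Q\<^esub> qF \<psi> = q (tens [sy (\<phi> 1) (Fsym \<psi>)])" for \<phi> \<psi>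
    using q_PhiRPhi[of \<phi> \<psi> 1] by (simp add: q_rg_one)
  have II: "qI \<otimes>\<^bsub>Q\<^esub> qI = qr (J 1) \<otimes>\<^bsub>Q\<^esub> qI \<ominus>\<^bsub>Q\<^esub> qF E \<otimes>\<^bsub>Q\<^esub> (qr (J 1) \<otimes>\<^bsub>Q\<^esub> qI) \<ominus>\<^bsub>Q\<^esub> qI \<otimes>\<^bsub>Q\<^esub> qr (J 1)"
    using IRI[of 1] by (simp add: q_rg_one)
  have "h (tens bs) \<in> carrier T \<and> q (h (tens bs)) = q (tens bs)"
    using assms unfolding \<Sigma>_IDO_def rule_def Un_iff
    by (elim disjE; clarsimp simp: list_all2_Cons1; force simp: q_tens_Cons q_add q_diff q_zero q_rg_one q_rg_mult q_DR q_DI q_ID q_EI q_PhiRPhi q_IRPhi IRD IRI II)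
  then show "h (tens bs) \<in> carrier T" "q (h (tens bs)) = q (tens bs)" by auto
qed

text \<open>The class of \<open>h w\<close> is known for base tensors only; linearity of
  \<open>h\<close> carries it along the span to every \<open>w\<close>, and the context is respected
  because the quotient map is a ring homomorphism.\<close>

lemma q_step:
  assumes "reduces_step \<Sigma>_IDO t s"
  shows "t \<in> carrier T" "s \<in> carrier T" "q t = q s"
proof -
  from assms obtain W h A B a w b r where Wh: "(W, h) \<in> \<Sigma>_IDO" and a: "a \<in> word_module A" and w: "w \<in> word_module W"
    and b: "b \<in> word_module B" and r: "r \<in> carrier T" and ts: "t = r +\<^sub>T a *\<^sub>T w *\<^sub>T b" "s = r +\<^sub>T a *\<^sub>T h w *\<^sub>T b"
    unfolding reduces_step_def by blast
  have cl: "a \<in> carrier T" "b \<in> carrier T" "w \<in> carrier T" using a b w word_module_carrier by auto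
  let ?S = "{pure k bs | k bs. k \<in> K \<and> list_all2 (\<lambda>w b. b \<in> letter_base w) W bs}"
  have S: "?S \<subseteq> carrier T" by (auto simp del: in_lists_conv_set intro!: pure_in dest: list_all2_gen_module(2))
  have "h \<in> bimodule_homs W" using Wh unfolding \<Sigma>_IDO_def rule_def by blast
  then have h: "\<And>x. x \<in> word_module W \<Longrightarrow> h x \<in> carrier T"
    "\<And>x y. x \<in> word_module W \<Longrightarrow> y \<in> word_module W \<Longrightarrow> h (x +\<^sub>T y) = h x +\<^sub>T h y"
    "\<And>k x. k \<in> K \<Longrightarrow> x \<in> word_module W \<Longrightarrow> h (sc k *\<^sub>T x) = sc k *\<^sub>T h x"
    unfolding bimodule_homs_def by auto
  have sub: "x \<in> word_module W \<Longrightarrow> x \<in> carrier T" for x using word_module_carrier by blast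
  have "q (h w) = q w"
    using w S unfolding word_module_span
  proof (induction w rule: span_induct)
    case zero
    have z: "\<zero>\<^bsub>T\<^esub> \<in> word_module W" unfolding word_module_def by simp
    have "h \<zero>\<^bsub>T\<^esub> = \<zero>\<^bsub>T\<^esub>"
      using T_idem[OF h(1)[OF z]] h(2)[OF z z] by (simp only: T.l_zero[OF T.zero_closed])
    then show ?case by simp
  next
    case (incl x)
    then obtain k bs where x: "x = pure k bs" "k \<in> K" "list_all2 (\<lambda>w b. b \<in> letter_base w) W bs" by blast
    have gm: "bs \<in> lists gen_module" using x(3) list_all2_gen_module by blast
    have "tens bs \<in> word_module W" unfolding word_module_span using x(3) by (intro span_incl CollectI exI[of _ 1] exI[of _ bs]) simp
    then have "h x = sc k *\<^sub>T h (tens bs)" using h(3)[of k "tens bs"] x gm by (simp add: sc_mult_pure)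
    then have "q (h x) = q (sc k *\<^sub>T tens bs)" using q_rule[OF Wh x(3)] x(2) gm by (simp add: q_mult)
    then show ?case using x gm by (simp add: sc_mult_pure)
  next
    case (diff x y)
    then have xy: "x \<in> word_module W" "y \<in> word_module W" "x -\<^sub>T y \<in> word_module W"
      unfolding word_module_span by (auto intro: span_diff[OF _ _ S])
    have "x -\<^sub>T y +\<^sub>T y = x" using xy sub by (simp add: T.minus_eq T.a_assoc T.l_neg)
    then have "h x = h (x -\<^sub>T y) +\<^sub>T h y" using h(2)[OF xy(3,2)] by simp
    then have "h (x -\<^sub>T y) = h x -\<^sub>T h y" using h(1) xy by (simp add: T.minus_eq T.a_assoc T.r_neg)
    then show ?case using diff xy sub h(1) by (simp add: q_diff)
  qed
  then show "t \<in> carrier T" "s \<in> carrier T" "q t = q s"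
    unfolding ts using cl r h(1)[OF w] by (simp_all add: q_add q_mult)
qed

lemma q_steps: "(reduces_step \<Sigma>_IDO)\<^sup>*\<^sup>* t s \<Longrightarrow> t \<in> carrier T \<Longrightarrow> s \<in> carrier T \<and> q t = q s"
  by (induction rule: rtranclp_induct) (auto dest: q_step)

end

subsection \<open>A model of the irreducible tensors\<close>

text \<open>\<open>(None, Deriv f j)\<close> and \<open>(None, Integ f g)\<close> stand for \<open>f \<partial>\<^sup>j\<close> and \<open>f \<integral> g\<close>; a first component
  \<open>Some (f, \<phi>)\<close> stands for a prefix \<open>f \<phi>\<close>.\<close>

datatype 'r core = Deriv 'r nat | Integ 'r 'r

type_synonym 'r nword = "('r \<times> ('r \<Rightarrow> 'r)) option \<times> 'r core"

fun core_scale :: "'r::ring_1 \<Rightarrow> 'r core \<Rightarrow> 'r core" where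
  "core_scale k (Deriv f j) = Deriv (k * f) j"
| "core_scale k (Integ f g) = Integ (k * f) g"

fun nword_scale :: "'r::ring_1 \<Rightarrow> 'r nword \<Rightarrow> 'r nword" where
  "nword_scale k (None, w) = (None, core_scale k w)"
| "nword_scale k (Some (f, \<phi>), w) = (Some (k * f, \<phi>), w)"

text \<open>The factor may be any ring element, so the same map is the action of the ring and that
  of the scalars.\<close>

definition lmul :: "'r::ring_1 \<Rightarrow> ('r nword \<Rightarrow>\<^sub>0 int) \<Rightarrow> ('r nword \<Rightarrow>\<^sub>0 int)" where
  "lmul f = frag_extend (\<lambda>w. frag_of (nword_scale f w))"

lemma lmul_of [simp]: "lmul f (frag_of w) = frag_of (nword_scale f w)"
  and lmul_add: "lmul f (x + y) = lmul f x + lmul f y"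
  and lmul_diff: "lmul f (x - y) = lmul f x - lmul f y"
  and lmul_zero [simp]: "lmul f 0 = 0"
  by (simp_all add: lmul_def frag_extend_add frag_extend_diff)

lemma frag_UNIV_induct [case_names zero one diff]:
  assumes "P 0" "\<And>w. P (frag_of w)" "\<And>a b. P a \<Longrightarrow> P b \<Longrightarrow> P (a - b)"
  shows "P x"
  using assms by (intro frag_induction[of x UNIV P]) auto

lemma core_scale_scale: "core_scale k (core_scale l w) = core_scale (k * l) w"
  by (cases w) (simp_all add: mult.assoc)

lemma nword_cases [case_names core phi]:
  fixes w :: "'r nword"
  obtains v where "w = (None, v)" | f \<phi> v where "w = (Some (f, \<phi>), v)"
  by (cases w; cases "fst w") auto

lemma nword_scale_scale: "nword_scale k (nword_scale l w) = nword_scale (k * l) w"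
  by (cases w rule: nword_cases) (auto simp: mult.assoc core_scale_scale)

lemma nword_scale_one [simp]: "nword_scale 1 w = w"
proof (cases w rule: nword_cases)
  case (core w)
  then show ?thesis by (cases w) auto
qed auto

lemma lmul_lmul: "lmul f (lmul g x) = lmul (f * g) x"
  by (induction x rule: frag_UNIV_induct) (simp_all add: lmul_diff nword_scale_scale)

lemma lmul_one [simp]: "lmul 1 x = x"
  by (induction x rule: frag_UNIV_induct) (simp_all add: lmul_diff)

context ido_functionals
begin

text \<open>\<open>r1\<close>, \<open>r2\<close>, \<open>r3\<close> and \<open>r5\<close> are
  additivity in each ring entry, \<open>r4\<close> and \<open>r6\<close> move a constant across
  \<integral> and across a functional. \<open>r7\<close> is stable under all the operators because
  they only change what stands in front of \<open>E\<close>.\<close>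

inductive_set nrel :: "('r nword \<Rightarrow>\<^sub>0 int) set" where
  zero: "0 \<in> nrel"
| diff: "x \<in> nrel \<Longrightarrow> y \<in> nrel \<Longrightarrow> x - y \<in> nrel"
| r1: "frag_of (p, Deriv (f + g) j) - frag_of (p, Deriv f j) - frag_of (p, Deriv g j) \<in> nrel"
| r2: "frag_of (p, Integ (f + g) h) - frag_of (p, Integ f h) - frag_of (p, Integ g h) \<in> nrel"
| r3: "frag_of (p, Integ f (g + h)) - frag_of (p, Integ f g) - frag_of (p, Integ f h) \<in> nrel"
| r4: "k \<in> K \<Longrightarrow> frag_of (p, Integ (f * k) g) - frag_of (p, Integ f (k * g)) \<in> nrel"
| r5: "frag_of (Some (f + g, \<phi>), w) - frag_of (Some (f, \<phi>), w) - frag_of (Some (g, \<phi>), w) \<in> nrel"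
| r6: "k \<in> K \<Longrightarrow> frag_of (Some (f * k, \<phi>), w) - frag_of (Some (f, \<phi>), core_scale k w) \<in> nrel"
| r7: "k \<in> K \<Longrightarrow> frag_of (Some (f, E), Integ k g) \<in> nrel"

lemma nrel_minus: "x \<in> nrel \<Longrightarrow> - x \<in> nrel"
  using nrel.diff[OF nrel.zero] by simp

lemma nrel_add: "x \<in> nrel \<Longrightarrow> y \<in> nrel \<Longrightarrow> x + y \<in> nrel"
  using nrel.diff[OF _ nrel_minus, of x y] by simp

lemma nrel_sum: "(\<And>s. s \<in> A \<Longrightarrow> g s \<in> nrel) \<Longrightarrow> (\<Sum>s\<in>A. g s) \<in> nrel"
  by (induction A rule: infinite_finite_induct) (auto intro: nrel.zero nrel_add)

definition ncong :: "('r nword \<Rightarrow>\<^sub>0 int) \<Rightarrow> ('r nword \<Rightarrow>\<^sub>0 int) \<Rightarrow> bool" (infix "\<sim>\<^sub>V" 50) where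
  "x \<sim>\<^sub>V y \<longleftrightarrow> x - y \<in> nrel"

lemma ncong_refl [simp]: "x \<sim>\<^sub>V x" by (simp add: ncong_def nrel.zero)
lemma ncong_sym: "x \<sim>\<^sub>V y \<Longrightarrow> y \<sim>\<^sub>V x" using nrel_minus[of "x - y"] by (simp add: ncong_def)
lemma ncong_trans [trans]: "x \<sim>\<^sub>V y \<Longrightarrow> y \<sim>\<^sub>V z \<Longrightarrow> x \<sim>\<^sub>V z" using nrel_add[of "x - y" "y - z"] by (simp add: ncong_def)
lemma ncong_add: "x \<sim>\<^sub>V y \<Longrightarrow> x' \<sim>\<^sub>V y' \<Longrightarrow> x + x' \<sim>\<^sub>V y + y'"
  using nrel_add[of "x - y" "x' - y'"] by (simp add: ncong_def algebra_simps)
lemma ncong_diff: "x \<sim>\<^sub>V y \<Longrightarrow> x' \<sim>\<^sub>V y' \<Longrightarrow> x - x' \<sim>\<^sub>V y - y'"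
  using nrel.diff[of "x - y" "x' - y'"] by (simp add: ncong_def algebra_simps)
lemma ncong_sum: "(\<And>s. s \<in> A \<Longrightarrow> g s \<sim>\<^sub>V h s) \<Longrightarrow> (\<Sum>s\<in>A. g s) \<sim>\<^sub>V (\<Sum>s\<in>A. h s)"
  using nrel_sum[of A "\<lambda>s. g s - h s"] by (simp add: ncong_def sum_subtractf)

lemma ncong_r1: "frag_of (p, Deriv (f + g) j) \<sim>\<^sub>V frag_of (p, Deriv f j) + frag_of (p, Deriv g j)"
  and ncong_r2: "frag_of (p, Integ (f + g) h) \<sim>\<^sub>V frag_of (p, Integ f h) + frag_of (p, Integ g h)"
  and ncong_r3: "frag_of (p, Integ f (g + h)) \<sim>\<^sub>V frag_of (p, Integ f g) + frag_of (p, Integ f h)"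
  and ncong_r4: "k \<in> K \<Longrightarrow> frag_of (p, Integ (f * k) g) \<sim>\<^sub>V frag_of (p, Integ f (k * g))"
  and ncong_r5: "frag_of (Some (f + g, \<phi>), w) \<sim>\<^sub>V frag_of (Some (f, \<phi>), w) + frag_of (Some (g, \<phi>), w)"
  and ncong_r6: "k \<in> K \<Longrightarrow> frag_of (Some (f * k, \<phi>), w) \<sim>\<^sub>V frag_of (Some (f, \<phi>), core_scale k w)"
  and ncong_r7: "k \<in> K \<Longrightarrow> frag_of (Some (f, E), Integ k g) \<sim>\<^sub>V 0"
  using nrel.intros(3-9) by (simp_all add: ncong_def diff_diff_eq)

fun deriv_word :: "'r nword \<Rightarrow> ('r nword \<Rightarrow>\<^sub>0 int)" where
  "deriv_word (None, Deriv f j) = frag_of (None, Deriv f (Suc j)) + frag_of (None, Deriv (d f) j)"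
| "deriv_word (None, Integ f g) = frag_of (None, Integ (d f) g) + frag_of (None, Deriv (f * g) 0)"
| "deriv_word (Some (f, \<phi>), w) = frag_of (Some (d f, \<phi>), w)"

fun phi_word :: "('r \<Rightarrow> 'r) \<Rightarrow> 'r nword \<Rightarrow> ('r nword \<Rightarrow>\<^sub>0 int)" where
  "phi_word \<psi> (None, w) = frag_of (Some (1, \<psi>), w)"
| "phi_word \<psi> (Some (f, \<phi>), w) = frag_of (Some (\<psi> f, \<phi>), w)"

text \<open>The expansion of \<integral> f \<partial>^j by repeated integration by parts: each round
  lowers the order by one and differentiates \<open>f\<close>. The end is the bare word with
  coefficient 1 in front of \<integral>.\<close>

fun integ_deriv :: "'r \<Rightarrow> nat \<Rightarrow> ('r nword \<Rightarrow>\<^sub>0 int)" where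
  "integ_deriv f 0 = frag_of (None, Integ 1 f)"
| "integ_deriv f (Suc j) = frag_of (None, Deriv f j) - frag_of (Some (1, E), Deriv f j) - integ_deriv (d f) j"

text \<open>The case of two integrals is integration by parts with \<open>J f\<close> as the
  antiderivative. Once a functional is present, everything from it onwards is inert and only the
  coefficient in front is integrated.\<close>

fun integ_word :: "'r nword \<Rightarrow> ('r nword \<Rightarrow>\<^sub>0 int)" where
  "integ_word (None, Deriv f j) = integ_deriv f j"
| "integ_word (None, Integ f g) = frag_of (None, Integ (J f) g) - frag_of (Some (1, E), Integ (J f) g) - frag_of (None, Integ 1 (J f * g))"
| "integ_word (Some (f, \<phi>), w) = frag_of (Some (J f, \<phi>), w)"

fun symb_word :: "'r symb \<Rightarrow> 'r nword \<Rightarrow> ('r nword \<Rightarrow>\<^sub>0 int)" where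
  "symb_word Dsym = deriv_word"
| "symb_word Isym = integ_word"
| "symb_word (Fsym \<phi>) = phi_word \<phi>"

definition sact :: "'r symb \<Rightarrow> ('r nword \<Rightarrow>\<^sub>0 int) \<Rightarrow> ('r nword \<Rightarrow>\<^sub>0 int)" where
  "sact s = frag_extend (symb_word s)"

lemma sact_of [simp]: "sact s (frag_of w) = symb_word s w"
  and sact_add: "sact s (x + y) = sact s x + sact s y"
  and sact_diff: "sact s (x - y) = sact s x - sact s y"
  and sact_zero [simp]: "sact s 0 = 0"
  by (simp_all add: sact_def frag_extend_add frag_extend_diff)

subsection \<open>The operators respect the relations\<close>

lemma lmul_nrel: "x \<in> nrel \<Longrightarrow> lmul f x \<in> nrel"
proof (induction x rule: nrel.induct)
  case (r1 p g h j)
  then show ?case by (cases p) (auto simp: lmul_diff distrib_left intro: nrel.intros)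
next
  case (r2 p g h l)
  then show ?case by (cases p) (auto simp: lmul_diff distrib_left intro: nrel.intros)
next
  case (r3 p g h l)
  then show ?case by (cases p) (auto simp: lmul_diff distrib_left intro: nrel.intros)
next
  case (r4 k p g h)
  then show ?case using nrel.r4[of k None "f * g" h] by (cases p) (auto simp: lmul_diff mult.assoc intro: nrel.intros)
next
  case (r6 k g \<phi> w)
  then show ?case using nrel.r6[of k "f * g" \<phi> w] by (simp add: lmul_diff mult.assoc)
qed (auto simp: lmul_diff distrib_left intro: nrel.intros)

lemma lmul_cong: "x \<sim>\<^sub>V y \<Longrightarrow> lmul f x \<sim>\<^sub>V lmul f y"
  using lmul_nrel[of "x - y"] by (simp add: ncong_def lmul_diff)

text \<open>With a functional prefix the operator changes only the prefix and a relation between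
  cores survives as it is; the computations concern bare cores. The same division recurs for the
  integral.\<close>

lemma deriv_nrel: "x \<in> nrel \<Longrightarrow> sact Dsym x \<in> nrel"
proof (induction x rule: nrel.induct)
  case (r1 p f g j)
  show ?case
  proof (cases p)
    case None
    then show ?thesis using nrel_add[OF nrel.r1[of None f g "Suc j"] nrel.r1[of None "d f" "d g" j]]
      by (simp add: sact_diff sact_add d_add algebra_simps)
  qed (auto simp: sact_diff sact_add intro: nrel.intros)
next
  case (r2 p f g h)
  show ?case
  proof (cases p)
    case None
    then show ?thesis using nrel_add[OF nrel.r2[of None "d f" "d g" h] nrel.r1[of None "f * h" "g * h" 0]]
      by (simp add: sact_diff sact_add d_add algebra_simps)
  qed (auto simp: sact_diff sact_add intro: nrel.intros)
next
  case (r3 p f g h)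
  show ?case
  proof (cases p)
    case None
    then show ?thesis using nrel_add[OF nrel.r3[of None "d f" g h] nrel.r1[of None "f * g" "f * h" 0]]
      by (simp add: sact_diff sact_add algebra_simps)
  qed (auto simp: sact_diff sact_add intro: nrel.intros)
next
  case (r4 k p f g)
  show ?case
  proof (cases p)
    case None
    then show ?thesis using nrel.r4[OF r4, of None "d f" g] r4
      by (simp add: sact_diff sact_add mult.assoc)
  qed (use r4 in \<open>auto simp: sact_diff sact_add intro: nrel.intros\<close>)
qed (auto simp: sact_diff sact_add d_add intro: nrel.intros)

lemma phi_nrel: "x \<in> nrel \<Longrightarrow> \<psi> \<in> \<Phi> \<Longrightarrow> sact (Fsym \<psi>) x \<in> nrel"
proof (induction x rule: nrel.induct)
  case (r1 p f g j)
  show ?case by (cases p) (auto simp: sact_diff sact_add intro: nrel.intros)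
next
  case (r2 p f g j)
  show ?case by (cases p) (auto simp: sact_diff sact_add intro: nrel.intros)
next
  case (r3 p f g j)
  show ?case by (cases p) (auto simp: sact_diff sact_add intro: nrel.intros)
next
  case (r4 k p f g)
  then show ?case by (cases p) (auto simp: sact_diff sact_add intro: nrel.intros)
qed (auto simp: sact_diff sact_add functional_add intro: nrel.intros)

lemma integ_deriv_add: "integ_deriv (f + g) j \<sim>\<^sub>V integ_deriv f j + integ_deriv g j"
proof (induction j arbitrary: f g)
  case 0
  then show ?case by (simp add: ncong_r3)
next
  case (Suc j)
  have "integ_deriv (f + g) (Suc j) \<sim>\<^sub>V
     (frag_of (None, Deriv f j) + frag_of (None, Deriv g j)) - (frag_of (Some (1, E), Deriv f j) + frag_of (Some (1, E), Deriv g j)) -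
     (integ_deriv (d f) j + integ_deriv (d g) j)"
    using Suc[of "d f" "d g"] by (auto simp: d_add intro!: ncong_diff ncong_r1)
  then show ?case by (simp add: algebra_simps)
qed

lemma integ_nrel: "x \<in> nrel \<Longrightarrow> sact Isym x \<in> nrel"
proof (induction x rule: nrel.induct)
  case (r1 p f g j)
  show ?case
  proof (cases p)
    case None
    then show ?thesis using integ_deriv_add[of f g j] by (simp add: sact_diff sact_add ncong_def diff_diff_eq)
  qed (auto simp: sact_diff sact_add intro: nrel.intros)
next
  case (r2 p f g h)
  show ?case
  proof (cases p)
    case None
    then show ?thesis using nrel.diff[OF nrel.diff[OF nrel.r2[of None "J f" "J g" h] nrel.r2[of "Some (1, E)" "J f" "J g" h]]
        nrel.r3[of None 1 "J f * h" "J g * h"]]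
      by (simp add: sact_diff sact_add J_add algebra_simps)
  qed (auto simp: sact_diff sact_add intro: nrel.intros)
next
  case (r3 p f g h)
  show ?case
  proof (cases p)
    case None
    then show ?thesis using nrel.diff[OF nrel.diff[OF nrel.r3[of None "J f" g h] nrel.r3[of "Some (1, E)" "J f" g h]]
        nrel.r3[of None 1 "J f * g" "J f * h"]]
      by (simp add: sact_diff sact_add algebra_simps)
  qed (auto simp: sact_diff sact_add intro: nrel.intros)
next
  case (r4 k p f g)
  show ?case
  proof (cases p)
    case None
    then show ?thesis using nrel.diff[OF nrel.r4[OF r4, of None "J f" g] nrel.r4[OF r4, of "Some (1, E)" "J f" g]] r4
      by (simp add: sact_diff sact_add algebra_simps)
  qed (use r4 in \<open>auto simp: sact_diff sact_add intro: nrel.intros\<close>)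
qed (auto simp: sact_diff sact_add J_add intro: nrel.intros)

abbreviation symbols :: "'r symb set" where "symbols \<equiv> {Dsym, Isym} \<union> Fsym ` \<Phi>"

lemma sact_cong: "s \<in> symbols \<Longrightarrow> x \<sim>\<^sub>V y \<Longrightarrow> sact s x \<sim>\<^sub>V sact s y"
  using deriv_nrel[of "x - y"] integ_nrel[of "x - y"] phi_nrel[of "x - y"] by (auto simp: ncong_def sact_diff)

lemma lmul_add_scalar: "lmul (f + g) x \<sim>\<^sub>V lmul f x + lmul g x"
proof (induction x rule: frag_UNIV_induct)
  case (one w)
  show ?case
  proof (cases w rule: nword_cases)
    case (core v)
    then show ?thesis by (cases v) (auto simp: distrib_right ncong_r1 ncong_r2)
  qed (auto simp: distrib_right ncong_r5)
next
  case (diff a b)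
  then show ?case using ncong_diff[OF diff] by (simp add: lmul_diff algebra_simps)
qed simp

text \<open>Words with coefficient 0 are still generators of the free group; they vanish only modulo
  additivity, applied to 0 + 0.\<close>

lemma lmul_zero_scalar: "lmul 0 x \<sim>\<^sub>V 0"
  using lmul_add_scalar[of 0 0 x] nrel_minus by (fastforce simp: ncong_def)

lemma integ_deriv_scale: "k \<in> K \<Longrightarrow> integ_deriv (k * f) j \<sim>\<^sub>V lmul k (integ_deriv f j)"
proof (induction j arbitrary: f)
  case 0
  then show ?case using ncong_sym[OF ncong_r4[of k None 1 f]] by simp
next
  case (Suc j)
  have "frag_of (Some (1, E), Deriv (k * f) j) \<sim>\<^sub>V frag_of (Some (k, E), Deriv f j)"
    using ncong_sym[OF ncong_r6[OF Suc.prems, of 1 E "Deriv f j"]] by simp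
  then show ?case using Suc.IH[OF Suc.prems, of "d f"] Suc.prems by (auto simp: lmul_diff intro!: ncong_diff)
qed

text \<open>The operators are linear over the constants only modulo the relations: a constant left
  behind \<integral> is brought to the front by \<open>r4\<close>, one left behind a functional by
  \<open>r6\<close>.\<close>

lemma sact_scale:
  assumes "s \<in> symbols" "k \<in> K" shows "sact s (lmul k x) \<sim>\<^sub>V lmul k (sact s x)"
proof (induction x rule: frag_UNIV_induct)
  case (one w)
  obtain p v where w: "w = (p, v)" by (cases w)
  show ?case
  proof (cases s)
    case Dsym
    then show ?thesis using assms w by (cases p; cases v) (auto simp: lmul_add mult.assoc)
  next
    case Isym
    show ?thesis
    proof (cases p)
      case None
      show ?thesis
      proof (cases v)
        case (Deriv f j)
        then show ?thesis using Isym None w assms integ_deriv_scale[of k f j] by simp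
      next
        case (Integ f g)
        have "frag_of (Some (1, E), Integ (k * J f) g) \<sim>\<^sub>V frag_of (Some (k, E), Integ (J f) g)"
          using ncong_sym[OF ncong_r6[OF assms(2), of 1 E "Integ (J f) g"]] by simp
        moreover have "frag_of (None, Integ 1 (k * J f * g)) \<sim>\<^sub>V frag_of (None, Integ k (J f * g))"
          using ncong_sym[OF ncong_r4[OF assms(2), of None 1 "J f * g"]] by (simp add: mult.assoc)
        ultimately show ?thesis using Isym None w assms Integ by (auto simp: lmul_diff intro!: ncong_diff)
      qed
    qed (use Isym w assms in auto)
  next
    case (Fsym \<phi>)
    show ?thesis
    proof (cases p)
      case None
      then show ?thesis using ncong_sym[OF ncong_r6[OF assms(2), of 1 \<phi> v]] Fsym w by simp
    qed (use Fsym w assms in auto)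
  qed
next
  case (diff a b)
  then show ?case using ncong_diff[OF diff] by (simp add: lmul_diff sact_diff)
qed simp

subsection \<open>The defining relations hold for the operators\<close>

lemma sact_DR: "sact Dsym (lmul f x) \<sim>\<^sub>V lmul f (sact Dsym x) + lmul (d f) x"
proof (induction x rule: frag_UNIV_induct)
  case (one w)
  obtain p v where w: "w = (p, v)" by (cases w)
  show ?case
  proof (cases p)
    case None
    show ?thesis
    proof (cases v)
      case (Deriv g j)
      have "frag_of (None, Deriv (f * g) (Suc j)) + frag_of (None, Deriv (d f * g + f * d g) j) \<sim>\<^sub>V
        frag_of (None, Deriv (f * g) (Suc j)) + (frag_of (None, Deriv (d f * g) j) + frag_of (None, Deriv (f * d g) j))"
        by (intro ncong_add ncong_refl ncong_r1)
      then show ?thesis using w None Deriv by (simp add: lmul_add d_mult algebra_simps)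
    next
      case (Integ g h)
      have "frag_of (None, Integ (d f * g + f * d g) h) + frag_of (None, Deriv (f * g * h) 0) \<sim>\<^sub>V
        (frag_of (None, Integ (d f * g) h) + frag_of (None, Integ (f * d g) h)) + frag_of (None, Deriv (f * g * h) 0)"
        by (intro ncong_add ncong_refl ncong_r2)
      then show ?thesis using w None Integ by (simp add: lmul_add d_mult algebra_simps)
    qed
  next
    case (Some a)
    then show ?thesis using w ncong_r5[of "d f * fst a" "f * d (fst a)" "snd a" v]
      by (cases a) (simp add: d_mult add.commute)
  qed
next
  case (diff a b)
  then show ?case using ncong_diff[OF diff] by (simp add: lmul_diff sact_diff algebra_simps)
qed simp

lemma ncong_one_scale: "k \<in> K \<Longrightarrow> frag_of (None, Integ 1 (k * g)) \<sim>\<^sub>V frag_of (None, Integ k g)"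
  using ncong_sym[OF ncong_r4[of k None 1 g]] by simp

lemma ncong_zero_words: "frag_of (p, Integ 0 g) \<sim>\<^sub>V 0" "frag_of (p, Deriv 0 j) \<sim>\<^sub>V 0" "frag_of (Some (0, \<phi>), w) \<sim>\<^sub>V 0"
  using nrel_minus[OF nrel.r2[of p 0 0 g]] nrel_minus[OF nrel.r1[of p 0 0 j]] nrel_minus[OF nrel.r5[of 0 0 \<phi> w]]
  by (simp_all add: ncong_def)

text \<open>The recursion telescopes: \<partial> produces two terms from f \<partial>^j, the
  induction hypothesis cancels the second, and the \<open>E\<close> term dies because its
  coefficient 1 is differentiated.\<close>

lemma sact_DI_deriv: "sact Dsym (integ_deriv f j) \<sim>\<^sub>V frag_of (None, Deriv f j)"
proof (induction j arbitrary: f)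
  case 0
  then show ?case using ncong_add[OF ncong_zero_words(1)[of None f] ncong_refl[of "frag_of (None, Deriv f 0)"]] by simp
next
  case (Suc j)
  have "frag_of (None, Deriv f (Suc j)) + frag_of (None, Deriv (d f) j) - frag_of (Some (0, E), Deriv f j) - sact Dsym (integ_deriv (d f) j)
    \<sim>\<^sub>V frag_of (None, Deriv f (Suc j)) + frag_of (None, Deriv (d f) j) - 0 - frag_of (None, Deriv (d f) j)"
    by (intro ncong_diff ncong_refl ncong_zero_words Suc)
  then show ?case by (simp add: sact_diff sact_add)
qed

lemma sact_DI: "sact Dsym (sact Isym x) \<sim>\<^sub>V x"
proof (induction x rule: frag_UNIV_induct)
  case (one w)
  obtain p v where w: "w = (p, v)" by (cases w)
  show ?case
  proof (cases p)
    case None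
    show ?thesis
    proof (cases v)
      case (Deriv g j)
      then show ?thesis using w None sact_DI_deriv by simp
    next
      case (Integ f g)
      have "frag_of (None, Integ f g) + frag_of (None, Deriv (J f * g) 0) - frag_of (Some (0, E), Integ (J f) g) -
          (frag_of (None, Integ 0 (J f * g)) + frag_of (None, Deriv (J f * g) 0)) \<sim>\<^sub>V
        frag_of (None, Integ f g) + frag_of (None, Deriv (J f * g) 0) - 0 - (0 + frag_of (None, Deriv (J f * g) 0))"
        by (intro ncong_diff ncong_add ncong_refl ncong_zero_words)
      then show ?thesis using w None Integ by (simp add: sact_diff sact_add d_J)
    qed
  qed (use w in \<open>auto simp: d_J\<close>)
next
  case (diff a b)
  then show ?case using ncong_diff[OF diff] by (simp add: sact_diff sact_add)
qed simp

text \<open>Everything rests on f = E f + J (d f). For powers of \<partial> the claim is the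
  recursion of \<open>integ_deriv\<close>. For f\<integral>g the part with \<open>J (d f)\<close>
  matches the integration by parts, and the constant part \<open>E f\<close> has to pass through
  \<integral> on one side and to vanish behind \<open>E\<close> on the other.\<close>

lemma sact_ID: "sact Isym (sact Dsym x) \<sim>\<^sub>V x - sact (Fsym E) x"
proof (induction x rule: frag_UNIV_induct)
  case (one w)
  obtain p v where w: "w = (p, v)" by (cases w)
  show ?case
  proof (cases p)
    case None
    show ?thesis
    proof (cases v)
      case (Deriv f j)
      then show ?thesis using w None by (simp add: sact_add)
    next
      case (Integ f g)
      have J: "J (d f) = f - E f" by (simp add: evaluation_def)
      have fJ: "E f + J (d f) = f" by (simp add: evaluation_def)
      have 1: "frag_of (p, Integ f g) \<sim>\<^sub>V frag_of (p, Integ (E f) g) + frag_of (p, Integ (J (d f)) g)" for p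
        using ncong_r2[of p "E f" "J (d f)" g] by (simp only: fJ)
      \<comment> \<open>The constant part stands between \<open>E\<close> and \<integral> and is
        killed by \<open>r7\<close>.\<close>
      have 2: "frag_of (Some (1, E), Integ f g) \<sim>\<^sub>V 0 + frag_of (Some (1, E), Integ (J (d f)) g)"
        using ncong_trans[OF 1 ncong_add[OF ncong_r7 ncong_refl]] by simp
      have "f * g = E f * g + J (d f) * g" by (simp add: fJ flip: distrib_right)
      then have "frag_of (None, Integ 1 (f * g)) \<sim>\<^sub>V frag_of (None, Integ 1 (E f * g)) + frag_of (None, Integ 1 (J (d f) * g))"
        using ncong_r3[of None 1 "E f * g" "J (d f) * g"] by simp
      also have "\<dots> \<sim>\<^sub>V frag_of (None, Integ (E f) g) + frag_of (None, Integ 1 (J (d f) * g))"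
        by (intro ncong_add ncong_one_scale ncong_refl) simp
      finally have 3: "frag_of (None, Integ 1 (f * g)) \<sim>\<^sub>V frag_of (None, Integ (E f) g) + frag_of (None, Integ 1 (J (d f) * g))" .
      have "frag_of (None, Integ (J (d f)) g) - frag_of (Some (1, E), Integ (J (d f)) g) - frag_of (None, Integ 1 (J (d f) * g)) + frag_of (None, Integ 1 (f * g))
        \<sim>\<^sub>V frag_of (None, Integ (J (d f)) g) - frag_of (Some (1, E), Integ (J (d f)) g) - frag_of (None, Integ 1 (J (d f) * g)) + (frag_of (None, Integ (E f) g) + frag_of (None, Integ 1 (J (d f) * g)))"
        by (intro ncong_add ncong_refl 3)
      also have "\<dots> = frag_of (None, Integ (E f) g) + frag_of (None, Integ (J (d f)) g) - (0 + frag_of (Some (1, E), Integ (J (d f)) g))"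
        by (simp add: algebra_simps)
      also have "\<dots> \<sim>\<^sub>V frag_of (None, Integ f g) - frag_of (Some (1, E), Integ f g)"
        by (intro ncong_diff ncong_sym[OF 1] ncong_sym[OF 2])
      finally show ?thesis using w None Integ by (simp add: sact_add)
    qed
  next
    case (Some a)
    obtain f \<phi> where a: "a = (f, \<phi>)" by (cases a)
    have fJ: "E f + J (d f) = f" by (simp add: evaluation_def)
    have "frag_of (Some (f, \<phi>), v) \<sim>\<^sub>V frag_of (Some (E f, \<phi>), v) + frag_of (Some (J (d f), \<phi>), v)"
      using ncong_r5[of "E f" "J (d f)" \<phi> v] by (simp only: fJ)
    from ncong_sym[OF ncong_diff[OF this ncong_refl[of "frag_of (Some (E f, \<phi>), v)"]]]
    show ?thesis using w Some a by simp
  qed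
next
  case (diff a b)
  then show ?case using ncong_diff[OF diff] by (simp add: sact_diff sact_add algebra_simps)
qed simp

text \<open>After a functional has acted, the front coefficient is a constant k and a functional
  follows. So \<partial> and \<integral> act on f k alone, giving (\<partial> f) k and (\<integral>
  f) k; this yields the three relations that end in a functional.\<close>

lemma sact_Phi_word: "\<phi> \<in> \<Phi> \<Longrightarrow> \<exists>k\<in>K. \<exists>\<psi> v. symb_word (Fsym \<phi>) w = frag_of (Some (k, \<psi>), v)"
proof -
  assume "\<phi> \<in> \<Phi>"
  obtain p v where w: "w = (p, v)" by (cases w)
  show ?thesis
  proof (cases p)
    case None
    then show ?thesis using w by (auto intro!: bexI[of _ 1])
  next
    case (Some a)
    obtain f \<chi> where "a = (f, \<chi>)" by (cases a)
    then have "symb_word (Fsym \<phi>) w = frag_of (Some (\<phi> f, \<chi>), v)" using w Some by simp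
    then show ?thesis using functional_in_constants[OF \<open>\<phi> \<in> \<Phi>\<close>, of f] by blast
  qed
qed

lemma sact_DRPhi: "\<phi> \<in> \<Phi> \<Longrightarrow> sact Dsym (lmul f (sact (Fsym \<phi>) x)) \<sim>\<^sub>V lmul (d f) (sact (Fsym \<phi>) x)"
proof (induction x rule: frag_UNIV_induct)
  case (one w)
  then obtain k \<psi> v where "k \<in> K" "symb_word (Fsym \<phi>) w = frag_of (Some (k, \<psi>), v)" using sact_Phi_word by blast
  then show ?case by (simp del: symb_word.simps(3))
qed (auto simp: sact_diff sact_add lmul_diff intro: ncong_diff)

lemma sact_IRPhi: "\<phi> \<in> \<Phi> \<Longrightarrow> sact Isym (lmul f (sact (Fsym \<phi>) x)) \<sim>\<^sub>V lmul (J f) (sact (Fsym \<phi>) x)"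
proof (induction x rule: frag_UNIV_induct)
  case (one w)
  then obtain k \<psi> v where "k \<in> K" "symb_word (Fsym \<phi>) w = frag_of (Some (k, \<psi>), v)" using sact_Phi_word by blast
  then show ?case by (simp del: symb_word.simps(3))
qed (auto simp: sact_diff sact_add lmul_diff intro: ncong_diff)

lemma sact_PhiRPhi: "\<phi> \<in> \<Phi> \<Longrightarrow> \<psi> \<in> \<Phi> \<Longrightarrow> sact (Fsym \<psi>) (lmul f (sact (Fsym \<phi>) x)) \<sim>\<^sub>V lmul (\<psi> f) (sact (Fsym \<phi>) x)"
proof (induction x rule: frag_UNIV_induct)
  case (one w)
  then obtain k \<chi> v where "k \<in> K" "symb_word (Fsym \<phi>) w = frag_of (Some (k, \<chi>), v)" using sact_Phi_word by blast
  then show ?case using one by (simp del: symb_word.simps(3)) simp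
qed (auto simp: sact_diff sact_add lmul_diff intro: ncong_diff)

section \<open>Tensors as operators on the model\<close>

definition act :: "'r gens \<Rightarrow> ('r nword \<Rightarrow>\<^sub>0 int) \<Rightarrow> ('r nword \<Rightarrow>\<^sub>0 int)" where
  "act m x = lmul (fst m) x + (\<Sum>s\<in>Poly_Mapping.keys (snd m). lmul (coord s m) (sact s x))"

lemma act_diff: "act m (x - y) = act m x - act m y"
  by (simp add: act_def lmul_diff sact_diff sum_subtractf)

lemma keys_symbols: "m \<in> gen_module \<Longrightarrow> s \<in> Poly_Mapping.keys (snd m) \<Longrightarrow> s \<in> symbols"
  unfolding gen_module_iff in_keys_iff by blast

lemma act_cong: "m \<in> gen_module \<Longrightarrow> x \<sim>\<^sub>V y \<Longrightarrow> act m x \<sim>\<^sub>V act m y"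
  unfolding act_def by (intro ncong_add ncong_sum lmul_cong sact_cong keys_symbols)

text \<open>Symbols with coefficient 0 contribute words that vanish only modulo the relations, hence
  a congruence. It allows generators with different supports to be compared over a common index
  set.\<close>

lemma act_superset:
  assumes "finite A" "Poly_Mapping.keys (snd m) \<subseteq> A"
  shows "act m x \<sim>\<^sub>V lmul (fst m) x + (\<Sum>s\<in>A. lmul (coord s m) (sact s x))"
proof -
  have "(\<Sum>s\<in>A - Poly_Mapping.keys (snd m). lmul (coord s m) (sact s x)) \<sim>\<^sub>V (\<Sum>s\<in>A - Poly_Mapping.keys (snd m). 0)"
    using lmul_zero_scalar by (intro ncong_sum) (simp add: in_keys_iff)
  then have "lmul (fst m) x + (\<Sum>s\<in>Poly_Mapping.keys (snd m). lmul (coord s m) (sact s x)) + (\<Sum>s\<in>A - Poly_Mapping.keys (snd m). lmul (coord s m) (sact s x)) \<sim>\<^sub>V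
    lmul (fst m) x + (\<Sum>s\<in>Poly_Mapping.keys (snd m). lmul (coord s m) (sact s x)) + 0"
    by (intro ncong_add ncong_refl) simp
  from ncong_sym[OF this] show ?thesis
    unfolding act_def using sum.subset_diff[OF assms(2,1), of "\<lambda>s. lmul (coord s m) (sact s x)"] by (simp add: add_ac)
qed

lemma act_add_left: "act (m + m') x \<sim>\<^sub>V act m x + act m' x"
proof -
  let ?A = "Poly_Mapping.keys (snd m) \<union> Poly_Mapping.keys (snd m')"
  let ?g = "\<lambda>m. lmul (fst m) x + (\<Sum>s\<in>?A. lmul (coord s m) (sact s x))"
  have "act (m + m') x \<sim>\<^sub>V ?g (m + m')"
    using keys_add[of "snd m" "snd m'"] by (intro act_superset) auto
  also have "\<dots> \<sim>\<^sub>V (lmul (fst m) x + lmul (fst m') x) + (\<Sum>s\<in>?A. lmul (coord s m) (sact s x) + lmul (coord s m') (sact s x))"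
    by (auto simp: lookup_add intro!: ncong_add ncong_sum lmul_add_scalar)
  also have "\<dots> = ?g m + ?g m'" by (simp add: sum.distrib add_ac)
  also have "\<dots> \<sim>\<^sub>V act m x + act m' x"
    by (intro ncong_add ncong_sym[OF act_superset]) auto
  finally show ?thesis .
qed

lemma lmul_sum: "lmul k (\<Sum>s\<in>A. g s) = (\<Sum>s\<in>A. lmul k (g s))"
  by (induction A rule: infinite_finite_induct) (simp_all add: lmul_add)

lemma act_lact: "act (lact k m) x \<sim>\<^sub>V lmul k (act m x)"
proof -
  have "act (lact k m) x \<sim>\<^sub>V lmul (fst (lact k m)) x + (\<Sum>s\<in>Poly_Mapping.keys (snd m). lmul (coord s (lact k m)) (sact s x))"
    by (intro act_superset) (auto simp: in_keys_iff)
  also have "\<dots> = lmul k (act m x)" by (simp add: act_def lmul_add lmul_sum lmul_lmul)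
  finally show ?thesis .
qed

text \<open>A right scalar on a symbol has been stored as part of its coefficient, so the operator
  of the symbol must commute with constants; this is \<open>sact_scale\<close>.\<close>

lemma act_ract:
  assumes "m \<in> gen_module" "k \<in> K" shows "act (ract m k) x \<sim>\<^sub>V act m (lmul k x)"
proof -
  have "act (ract m k) x \<sim>\<^sub>V lmul (fst (ract m k)) x + (\<Sum>s\<in>Poly_Mapping.keys (snd m). lmul (coord s (ract m k)) (sact s x))"
    by (intro act_superset) (auto simp: in_keys_iff)
  also have "\<dots> = lmul (fst m) (lmul k x) + (\<Sum>s\<in>Poly_Mapping.keys (snd m). lmul (coord s m) (lmul k (sact s x)))" by (simp add: lmul_lmul)
  also have "\<dots> \<sim>\<^sub>V act m (lmul k x)" unfolding act_def
    by (intro ncong_add ncong_refl ncong_sum lmul_cong ncong_sym[OF sact_scale] keys_symbols[OF assms(1)] assms)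
  finally show ?thesis .
qed

lemma act_rg [simp]: "act (rg f) x = lmul f x"
  by (simp add: act_def rg_def)

lemma act_sy: "act (sy c s) x \<sim>\<^sub>V lmul c (sact s x)"
proof -
  have "act (sy c s) x \<sim>\<^sub>V lmul 0 x + (\<Sum>s'\<in>{s}. lmul (coord s' (sy c s)) (sact s' x))"
    using act_superset[of "{s}" "sy c s" x] by (simp add: sy_def)
  also have "\<dots> \<sim>\<^sub>V 0 + (\<Sum>s'\<in>{s}. lmul (coord s' (sy c s)) (sact s' x))"
    by (intro ncong_add ncong_refl lmul_zero_scalar)
  finally show ?thesis by simp
qed

lemma act_symb: "act (sy 1 s) x \<sim>\<^sub>V sact s x"
  using act_sy[of 1 s x] by simp

lemma foldr_act_diff: "foldr act ms (x - y) = foldr act ms x - foldr act ms y"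
  by (induction ms) (simp_all add: act_diff)

lemma foldr_act_add: "foldr act ms (x + y) = foldr act ms x + foldr act ms y"
  using foldr_act_diff[of ms "x + y" y] by simp

lemma foldr_act_cong: "ms \<in> lists gen_module \<Longrightarrow> x \<sim>\<^sub>V y \<Longrightarrow> foldr act ms x \<sim>\<^sub>V foldr act ms y"
  by (induction ms) (auto intro: act_cong)

text \<open>The slots act in the order of composition of operators: the rightmost one first, the
  leading scalar last.\<close>

definition EV :: "('r word \<Rightarrow>\<^sub>0 int) \<Rightarrow> ('r nword \<Rightarrow>\<^sub>0 int) \<Rightarrow> ('r nword \<Rightarrow>\<^sub>0 int)" where
  "EV t x = frag_extend (\<lambda>(c, ms). lmul c (foldr act ms x)) t"

lemma EV_of [simp]: "EV (frag_of (c, ms)) x = lmul c (foldr act ms x)"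
  and EV_add_left: "EV (t + u) x = EV t x + EV u x"
  and EV_diff_left: "EV (t - u) x = EV t x - EV u x"
  and EV_zero_left [simp]: "EV 0 x = 0"
  by (simp_all add: EV_def frag_extend_add frag_extend_diff)

lemma EV_diff_right: "EV t (x - y) = EV t x - EV t y"
  by (induction t rule: frag_UNIV_induct) (auto simp: EV_diff_left lmul_diff foldr_act_diff)

lemma EV_cong: "t \<in> carr \<Longrightarrow> x \<sim>\<^sub>V y \<Longrightarrow> EV t x \<sim>\<^sub>V EV t y"
  by (induction t rule: carr_induct) (auto simp: EV_diff_left intro!: ncong_diff lmul_cong foldr_act_cong)

text \<open>Each relation corresponds to one law of the action: additivity in the scalar, additivity
  in the generator, compatibility with left scalars, and compatibility of right with left
  scalars.\<close>

lemma EV_relation: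
  assumes "t \<in> tensor_relations" shows "EV t x \<sim>\<^sub>V 0"
  using assms
proof (cases rule: tensor_relations_cases)
  case (scalar c c' ms)
  then show ?thesis using lmul_add_scalar[of c c' "foldr act ms x"]
    by (simp add: EV_diff_left EV_add_left ncong_def diff_diff_eq)
next
  case (slot c ms m m' ns)
  have "lmul c (foldr act ms (act (m + m') (foldr act ns x))) \<sim>\<^sub>V lmul c (foldr act ms (act m (foldr act ns x) + act m' (foldr act ns x)))"
    using slot by (intro lmul_cong foldr_act_cong act_add_left) auto
  then show ?thesis using slot
    by (simp add: EV_diff_left EV_add_left ncong_def diff_diff_eq foldr_act_add lmul_add)
next
  case (first c k m ns)
  have "lmul c (lmul k (act m (foldr act ns x))) \<sim>\<^sub>V lmul c (act (lact k m) (foldr act ns x))"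
    by (intro lmul_cong ncong_sym[OF act_lact])
  then show ?thesis using first by (simp add: EV_diff_left ncong_def lmul_lmul)
next
  case (balance c k ms m m' ns)
  have "act (ract m k) (act m' (foldr act ns x)) \<sim>\<^sub>V act m (lmul k (act m' (foldr act ns x)))"
    using balance by (intro act_ract) auto
  also have "\<dots> \<sim>\<^sub>V act m (act (lact k m') (foldr act ns x))"
    using balance by (intro act_cong ncong_sym[OF act_lact]) auto
  finally have "lmul c (foldr act ms (act (ract m k) (act m' (foldr act ns x)))) \<sim>\<^sub>V lmul c (foldr act ms (act m (act (lact k m') (foldr act ns x))))"
    using balance by (intro lmul_cong foldr_act_cong) auto
  then show ?thesis using balance by (simp add: EV_diff_left ncong_def)
qed

lemma EV_null: "t \<in> tensor_null \<Longrightarrow> EV t x \<sim>\<^sub>V 0"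
proof (induction t rule: tensor_null_induct)
  case (diff a b)
  then show ?case using ncong_diff[OF diff] by (simp add: EV_diff_left)
qed (auto intro: EV_relation)

lemma EV_word_mult:
  assumes "c \<in> K" "c' \<in> K" "ms \<in> lists gen_module" "ns \<in> lists gen_module"
  shows "EV (frag_of (word_mult (c, ms) (c', ns))) x \<sim>\<^sub>V lmul c (foldr act ms (lmul c' (foldr act ns x)))"
proof (cases ms rule: rev_cases)
  case Nil
  then show ?thesis by (simp add: lmul_lmul)
next
  case (snoc us u)
  have "lmul c (foldr act us (act (ract u c') (foldr act ns x))) \<sim>\<^sub>V lmul c (foldr act us (act u (lmul c' (foldr act ns x))))"
    using assms snoc by (intro lmul_cong foldr_act_cong act_ract) auto
  then show ?thesis using snoc by simp
qed

lemma EV_mult: "t \<in> carr \<Longrightarrow> u \<in> carr \<Longrightarrow> EV (frag_mult t u) x \<sim>\<^sub>V EV t (EV u x)"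
proof (induction t rule: carr_induct)
  case (one c ms)
  from \<open>u \<in> carr\<close> show ?case
  proof (induction u rule: carr_induct)
    case (one c' ns)
    then show ?case using EV_word_mult[of c c' ms ns x] \<open>c \<in> K\<close> \<open>ms \<in> lists gen_module\<close> by (simp del: word_mult.simps)
  next
    case (diff a b)
    then show ?case using ncong_diff[OF diff] by (simp add: frag_extend_diff EV_diff_left lmul_diff foldr_act_diff)
  qed (use EV_diff_right[of "frag_of (c, ms)" 0 0] in simp)
next
  case (diff a b)
  then show ?case using ncong_diff[of "EV (frag_mult a u) x" "EV a (EV u x)" "EV (frag_mult b u) x" "EV b (EV u x)"]
    by (simp add: frag_mult_diff_left EV_diff_left)
qed simp

subsection \<open>The defining ideal acts as zero\<close>

text \<open>Some representative is asked to act as zero; since the tensor relations act as zero,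
  every representative then does.\<close>

definition annihilator :: "'r tensor set" where
  "annihilator = {cls t | t. t \<in> carr \<and> (\<forall>x. EV t x \<sim>\<^sub>V 0)}"

lemma cls_annihilator: "t \<in> carr \<Longrightarrow> cls t \<in> annihilator \<longleftrightarrow> (\<forall>x. EV t x \<sim>\<^sub>V 0)"
proof
  assume t: "t \<in> carr" and "cls t \<in> annihilator"
  then obtain u where u: "u \<in> carr" "\<And>x. EV u x \<sim>\<^sub>V 0" "cls t = cls u" unfolding annihilator_def by blast
  have "t - u \<in> tensor_null" using t u cls_eq_zero[of "t - u"] by (simp add: cls_diff T.minus_eq T.r_neg)
  from ncong_add[OF EV_null[OF this] u(2)] show "\<forall>x. EV t x \<sim>\<^sub>V 0" by (simp add: EV_diff_left) (metis diff_add_cancel)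
qed (auto simp: annihilator_def)

lemma annihilator_carrier: "x \<in> annihilator \<Longrightarrow> x \<in> carrier T"
  by (auto simp: annihilator_def)

lemma ideal_annihilator: "ideal annihilator T"
proof (rule idealI)
  show "ring T" by (rule T.ring_axioms)
  have diff: "x -\<^sub>T y \<in> annihilator" if xy: "x \<in> annihilator" "y \<in> annihilator" for x y
  proof -
    obtain t u where "t \<in> carr" "x = cls t" "u \<in> carr" "y = cls u" using xy by (auto simp: annihilator_def)
    then show ?thesis using xy ncong_diff[of "EV t _" 0 "EV u _" 0]
      by (simp add: cls_annihilator cls_diff[symmetric] EV_diff_left)
  qed
  have zero: "\<zero>\<^bsub>T\<^esub> \<in> annihilator" using cls_annihilator[of 0] by simp
  show "subgroup annihilator (add_monoid T)"
  proof (rule group.subgroupI[OF T.add.is_group])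
    fix x assume x: "x \<in> annihilator"
    have "\<ominus>\<^bsub>T\<^esub> x \<in> annihilator" using diff[OF zero x] annihilator_carrier[OF x] by (simp add: T.minus_eq)
    then show "inv\<^bsub>add_monoid T\<^esub> x \<in> annihilator" using inv_add_T[OF annihilator_carrier[OF x]] by metis
    fix y assume y: "y \<in> annihilator"
    have "y -\<^sub>T (\<ominus>\<^bsub>T\<^esub> x) \<in> annihilator" using diff[OF y \<open>\<ominus>\<^bsub>T\<^esub> x \<in> annihilator\<close>] .
    then show "x \<otimes>\<^bsub>add_monoid T\<^esub> y \<in> annihilator"
      using annihilator_carrier[OF x] annihilator_carrier[OF y] by (simp add: T.minus_eq T.minus_minus T.a_comm)
  qed (use zero annihilator_carrier in auto)
next
  fix a x assume "a \<in> annihilator" "x \<in> carrier T"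
  then obtain t u where tu: "t \<in> carr" "a = cls t" "u \<in> carr" "x = cls u" by (auto simp: annihilator_def carrier_T)
  have t0: "EV t y \<sim>\<^sub>V 0" for y using tu \<open>a \<in> annihilator\<close> cls_annihilator by blast
  have z: "EV u 0 = 0" using EV_diff_right[of u 0 0] by simp
  have "EV (frag_mult u t) y \<sim>\<^sub>V 0" for y
    using ncong_trans[OF EV_mult[OF tu(3,1)] EV_cong[OF tu(3) t0[of y]]] z by simp
  then show "x *\<^sub>T a \<in> annihilator" using tu cls_annihilator[of "frag_mult u t"] by (simp add: cls_mult)
  have "EV (frag_mult t u) y \<sim>\<^sub>V 0" for y using ncong_trans[OF EV_mult[OF tu(1,3)] t0] .
  then show "a *\<^sub>T x \<in> annihilator" using tu cls_annihilator[of "frag_mult t u"] by (simp add: cls_mult)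
qed

lemma IDO_generators_annihilate: "IDO_generators \<subseteq> annihilator"
proof -
  \<comment> \<open>The generator of a symbol has ring component 0, which adds a term
    \<open>lmul 0 x\<close> that is zero only modulo the relations. These facts replace the
    generator by the operator of its symbol in all positions that occur below.\<close>
  have 2: "act (sy 1 s) (act (sy 1 s') x) \<sim>\<^sub>V sact s (sact s' x)" if "s \<in> symbols" "s' \<in> symbols" for s s' x
    using ncong_trans[OF act_symb sact_cong[OF _ act_symb]] that by blast
  have 3: "act (sy 1 s) (lmul f (act (sy 1 s') x)) \<sim>\<^sub>V sact s (lmul f (sact s' x))" if "s \<in> symbols" "s' \<in> symbols" for s s' f x
    using ncong_trans[OF act_symb sact_cong[OF _ lmul_cong[OF act_symb]]] that by blast
  have 4: "lmul f (act (sy 1 s) x) \<sim>\<^sub>V lmul f (sact s x)" for f s x by (intro lmul_cong act_symb)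
  have diff0: "a - b \<sim>\<^sub>V 0 \<longleftrightarrow> a \<sim>\<^sub>V b" for a b by (simp add: ncong_def)
  have D: "Dsym \<in> symbols" and I: "Isym \<in> symbols" and F: "\<And>\<phi>. \<phi> \<in> \<Phi> \<Longrightarrow> Fsym \<phi> \<in> symbols" by auto
  have "tens [rg 1] -\<^sub>T \<epsilon> \<in> annihilator"
    using cls_annihilator[of "frag_of (1, [rg 1]) - frag_of (1, [])"] by (simp add: cls_diff pure_cls EV_diff_left)
  moreover have "tens [rg f, rg g] -\<^sub>T tens [rg (f * g)] \<in> annihilator" for f g
    using cls_annihilator[of "frag_of (1, [rg f, rg g]) - frag_of (1, [rg (f * g)])"]
    by (simp add: cls_diff pure_cls EV_diff_left lmul_lmul)
  moreover have "tens [D, rg f] -\<^sub>T tens [rg f, D] -\<^sub>T tens [rg (d f)] \<in> annihilator" for f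
  proof -
    have "act D (lmul f x) \<sim>\<^sub>V lmul f (act D x) + lmul (d f) x" for x
      by (rule ncong_trans[OF act_symb ncong_trans[OF sact_DR ncong_add[OF ncong_sym[OF 4] ncong_refl]]])
    then have "act D (lmul f x) - lmul f (act D x) - lmul (d f) x \<sim>\<^sub>V 0" for x by (simp add: ncong_def diff_diff_eq)
    then show ?thesis
      using cls_annihilator[of "frag_of (1, [D, rg f]) - frag_of (1, [rg f, D]) - frag_of (1, [rg (d f)])"]
      by (simp add: cls_diff pure_cls EV_diff_left)
  qed
  moreover have "tens [D, I] -\<^sub>T \<epsilon> \<in> annihilator"
    using cls_annihilator[of "frag_of (1, [D, I]) - frag_of (1, [])"] ncong_trans[OF 2[OF D I] sact_DI]
    by (simp add: cls_diff pure_cls EV_diff_left diff0)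
  moreover have "tens [I, D] -\<^sub>T \<epsilon> +\<^sub>T tens [F E] \<in> annihilator"
  proof -
    have "act I (act D x) \<sim>\<^sub>V x - act (F E) x" for x
      by (rule ncong_trans[OF 2[OF I D] ncong_trans[OF sact_ID ncong_diff[OF ncong_refl ncong_sym[OF act_symb]]]])
    then have "act I (act D x) - x + act (F E) x \<sim>\<^sub>V 0" for x by (simp add: ncong_def diff_diff_eq2 algebra_simps)
    then show ?thesis
      using cls_annihilator[of "frag_of (1, [I, D]) - frag_of (1, []) + frag_of (1, [F E])"]
      by (simp add: cls_diff cls_add pure_cls EV_diff_left EV_add_left)
  qed
  moreover have "tens [D, rg f, F \<phi>] -\<^sub>T tens [rg (d f), F \<phi>] \<in> annihilator" if "\<phi> \<in> \<Phi>" for f \<phi>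
    using cls_annihilator[of "frag_of (1, [D, rg f, F \<phi>]) - frag_of (1, [rg (d f), F \<phi>])"] that
      ncong_trans[OF 3[OF D F[OF that]] ncong_trans[OF sact_DRPhi[OF that] ncong_sym[OF 4]]]
    by (simp add: cls_diff pure_cls EV_diff_left diff0)
  moreover have "tens [I, rg f, F \<phi>] -\<^sub>T tens [rg (J f), F \<phi>] \<in> annihilator" if "\<phi> \<in> \<Phi>" for f \<phi>
    using cls_annihilator[of "frag_of (1, [I, rg f, F \<phi>]) - frag_of (1, [rg (J f), F \<phi>])"] that
      ncong_trans[OF 3[OF I F[OF that]] ncong_trans[OF sact_IRPhi[OF that] ncong_sym[OF 4]]]
    by (simp add: cls_diff pure_cls EV_diff_left diff0)
  moreover have "tens [F \<phi>, rg f, F \<psi>] -\<^sub>T tens [sy (\<phi> f) (Fsym \<psi>)] \<in> annihilator" if "\<phi> \<in> \<Phi>" "\<psi> \<in> \<Phi>" for f \<phi> \<psi>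
    using cls_annihilator[of "frag_of (1, [F \<phi>, rg f, F \<psi>]) - frag_of (1, [sy (\<phi> f) (Fsym \<psi>)])"] that
      ncong_trans[OF 3[OF F F, OF that] ncong_trans[OF sact_PhiRPhi[OF that(2,1)] ncong_sym[OF act_sy]]]
    by (simp add: cls_diff pure_cls EV_diff_left diff0)
  ultimately show ?thesis unfolding IDO_generators_def by auto
qed

lemma IDO_ideal_annihilates: "IDO_ideal \<subseteq> annihilator"
  unfolding IDO_ideal_def by (rule T.genideal_minimal[OF ideal_annihilator IDO_generators_annihilate])

subsection \<open>Irreducible tensors are determined by their action\<close>

text \<open>A constant in the ring reduces to a multiple of the empty tensor, so the constant part
  becomes a scalar and only the part in the range of \<open>J\<close> stays a tensor factor.\<close>

definition sp :: "'r \<Rightarrow> 'r tensor" where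
  "sp f = sc (E f) +\<^sub>T tens [rg (J (d f))]"

lemma sp_in [simp]: "sp f \<in> carrier T" by (simp add: sp_def)

lemma sp_add: "sp (f + g) = sp f +\<^sub>T sp g"
  by (simp add: sp_def evaluation_add d_add J_add rg_add gen_add sc_add T_four)

lemma sp_left: "k \<in> K \<Longrightarrow> sp (k * f) = sc k *\<^sub>T sp f"
  using gen_lact[of k "rg (J (d f))"] by (simp add: sp_def sc_mult T.r_distr)

lemma sp_right: "k \<in> K \<Longrightarrow> sp (f * k) = sp f *\<^sub>T sc k"
  using gen_ract[of k "rg (J (d f))"] by (simp add: sp_def sc_mult T.l_distr)

lemma sp_constant: "k \<in> K \<Longrightarrow> sp k = sc k"
  by (simp add: sp_def)

lemma sp_J: "sp (J f) = tens [rg (J f)]"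
  by (simp add: sp_def d_J)

definition sp_after :: "bool \<Rightarrow> 'r \<Rightarrow> 'r tensor" where
  "sp_after b f = (if b then tens [rg (J (d f))] else sp f)"

lemma sp_after: "sp_after b f \<in> carrier T" "sp_after b (f + g) = sp_after b f +\<^sub>T sp_after b g"
  "k \<in> K \<Longrightarrow> sp_after b (k * f) = sc k *\<^sub>T sp_after b f"
  "k \<in> K \<Longrightarrow> sp_after b (f * k) = sp_after b f *\<^sub>T sc k"
  "k \<in> K \<Longrightarrow> sp_after True k = \<zero>\<^bsub>T\<^esub>"
  using gen_lact[of k "rg (J (d f))"] gen_ract[of k "rg (J (d f))"]
  by (simp_all add: sp_after_def sp_add sp_left sp_right d_add J_add rg_add gen_add)

fun core_rho :: "bool \<Rightarrow> 'r core \<Rightarrow> 'r tensor" where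
  "core_rho b (Deriv f j) = sp f *\<^sub>T tens (replicate j D)"
| "core_rho b (Integ f g) = sp_after b f *\<^sub>T tens [I] *\<^sub>T sp g"

lemma core_rho_in [simp]: "core_rho b w \<in> carrier T"
  by (cases w) (auto simp: sp_after)

lemma core_rho_scale: "k \<in> K \<Longrightarrow> core_rho b (core_scale k w) = sc k *\<^sub>T core_rho b w"
  by (cases w) (auto simp: sp_after sp_left T.m_assoc)

text \<open>Model words admit any function as a functional; those outside \<Phi> have no symbol in
  \<open>M\<close> and are sent to zero.\<close>

fun rho_prefix :: "('r \<times> ('r \<Rightarrow> 'r)) option \<Rightarrow> 'r tensor" where
  "rho_prefix None = \<epsilon>"
| "rho_prefix (Some (f, \<phi>)) = (if \<phi> \<in> \<Phi> then sp f *\<^sub>T tens [F \<phi>] else \<zero>\<^bsub>T\<^esub>)"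

lemma rho_prefix_in [simp]: "rho_prefix p \<in> carrier T"
  by (cases p rule: rho_prefix.cases) auto

text \<open>After \<open>E\<close>, the constant part of the element in front of \<open>\<integral>\<close> is dropped.\<close>

definition rho :: "'r nword \<Rightarrow> 'r tensor" where
  "rho w = rho_prefix (fst w) *\<^sub>T core_rho (map_option snd (fst w) = Some E) (snd w)"

lemma rho_pair: "rho (p, w) = rho_prefix p *\<^sub>T core_rho (map_option snd p = Some E) w"
  by (simp add: rho_def)

lemma rho_in [simp]: "rho w \<in> carrier T" by (simp add: rho_def)

lemma lin_rho [simp]: "lin rho (frag_of w) = rho w" "lin rho (x + y) = lin rho x +\<^sub>T lin rho y"
    "lin rho (x - y) = lin rho x -\<^sub>T lin rho y" "lin rho x \<in> carrier T"
  by (auto simp: lin_add lin_diff)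

lemma T_self_diff [simp]: "x \<in> carrier T \<Longrightarrow> x -\<^sub>T x = \<zero>\<^bsub>T\<^esub>"
  by (simp add: T.minus_eq T.r_neg)

lemma T_add_diff: "x \<in> carrier T \<Longrightarrow> y \<in> carrier T \<Longrightarrow> x +\<^sub>T y -\<^sub>T x = y"
  by (simp add: T.minus_eq T.a_comm[of x y] T.a_assoc T.r_neg)

text \<open>Additivity is inherited from \<open>sp\<close>. For \<open>r4\<close> and
  \<open>r6\<close> a scalar crosses \<integral> or a functional symbol, which commute with it. For
  \<open>r7\<close> the constant is dropped by \<open>sp_after\<close>.\<close>

lemma rho_nrel: "x \<in> nrel \<Longrightarrow> lin rho x = \<zero>\<^bsub>T\<^esub>"
proof (induction x rule: nrel.induct)
  case (r6 k f \<phi> w)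
  have "sp f *\<^sub>T sc k *\<^sub>T tens [F \<phi>] *\<^sub>T y = sp f *\<^sub>T tens [F \<phi>] *\<^sub>T (sc k *\<^sub>T y)"
    if "\<phi> \<in> \<Phi>" "y \<in> carrier T" for y
  proof -
    have "sp f *\<^sub>T sc k *\<^sub>T tens [F \<phi>] = sp f *\<^sub>T tens [F \<phi>] *\<^sub>T sc k"
      using that r6 by (simp add: T.m_assoc sy_central)
    then show ?thesis using that r6 by (simp add: T.m_assoc)
  qed
  then show ?case using r6 by (simp add: rho_pair sp_right core_rho_scale)
next
  case (r7 k f g)
  then show ?case by (simp add: rho_pair sp_after)
next
  case (r4 k p f g)
  have "y *\<^sub>T sc k *\<^sub>T tens [I] *\<^sub>T z = y *\<^sub>T tens [I] *\<^sub>T (sc k *\<^sub>T z)" if "y \<in> carrier T" "z \<in> carrier T" for y z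
  proof -
    have "y *\<^sub>T sc k *\<^sub>T tens [I] = y *\<^sub>T tens [I] *\<^sub>T sc k"
      using that r4 by (simp add: T.m_assoc sy_central)
    then show ?thesis using that r4 by (simp add: T.m_assoc)
  qed
  then show ?case using r4 by (simp add: rho_pair sp_after sp_left)
qed (simp_all add: rho_pair sp_add sp_after T.l_distr T.r_distr T_add_diff_diff T_add_diff)

text \<open>The word \<open>Deriv 1 0\<close> is the unit operator, so acting on it records the
  whole operator in the model.\<close>

definition rho_value :: "'r tensor \<Rightarrow> 'r tensor" where
  "rho_value t = lin rho (EV (rep t) (frag_of (None, Deriv 1 0)))"

lemma lin_rho_cong: "x \<sim>\<^sub>V y \<Longrightarrow> lin rho x = lin rho y"
  using rho_nrel[of "x - y"] by (simp add: ncong_def T_eq_iff)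

lemma rho_value_cls: assumes "t \<in> carr" shows "rho_value (cls t) = lin rho (EV t (frag_of (None, Deriv 1 0)))"
proof -
  have r: "rep (cls t) \<in> carr" "cls (rep (cls t)) = cls t" using rep[of "cls t"] assms by auto
  have "rep (cls t) - t \<in> tensor_null" using r assms cls_eq_zero[of "rep (cls t) - t"] by (simp add: cls_diff)
  from EV_null[OF this, of "frag_of (None, Deriv 1 0)"] show ?thesis
    unfolding rho_value_def by (intro lin_rho_cong) (simp add: EV_diff_left ncong_def)
qed

lemma rho_value_diff: "x \<in> carrier T \<Longrightarrow> y \<in> carrier T \<Longrightarrow> rho_value (x -\<^sub>T y) = rho_value x -\<^sub>T rho_value y"
  by (auto simp: carrier_T rho_value_cls cls_diff[symmetric] EV_diff_left)

lemma rho_value_ideal: "x \<in> IDO_ideal \<Longrightarrow> rho_value x = \<zero>\<^bsub>T\<^esub>"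
proof -
  assume "x \<in> IDO_ideal"
  then obtain t where t: "t \<in> carr" "x = cls t" "\<forall>y. EV t y \<sim>\<^sub>V 0" using IDO_ideal_annihilates by (auto simp: annihilator_def)
  then show ?thesis using lin_rho_cong[of _ 0] by (simp add: rho_value_cls)
qed

section \<open>Normal tensors and their action\<close>

definition normal_lists :: "'r gens list set" where
  "normal_lists =
    {f @ replicate j D | f j. f \<in> optional_JR} \<union>
    {f @ [I] @ g | f g. f \<in> optional_JR \<and> g \<in> optional_JR} \<union>
    {f @ [F \<phi>] @ h @ replicate j D | f \<phi> h j. f \<in> optional_JR \<and> \<phi> \<in> \<Phi> \<and> h \<in> optional_JR} \<union>
    {f @ [F \<phi>] @ h @ [I] @ g | f \<phi> h g.
       f \<in> optional_JR \<and> \<phi> \<in> \<Phi> \<and> h \<in> optional_JR \<and> g \<in> optional_JR \<and> \<not> (\<phi> = E \<and> h = [])}"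

lemma optional_JR_gen_module: "f \<in> optional_JR \<Longrightarrow> f \<in> lists gen_module"
  by (auto simp: optional_JR_def)

lemma normal_lists_gen_module: "bs \<in> normal_lists \<Longrightarrow> bs \<in> lists gen_module"
  using optional_JR_gen_module by (fastforce simp: normal_lists_def)

text \<open>The witness is the ring element of the factor, or 1 if the factor is absent. The last
  property needs a present factor: dropping the constant part of 1 would give zero.\<close>

lemma optional_JR_value:
  assumes "f \<in> optional_JR"
  obtains a where "\<And>x. foldr act f x = lmul a x" "\<And>k. k \<in> K \<Longrightarrow> sp (k * a) = sc k *\<^sub>T tens f" "f \<noteq> [] \<Longrightarrow> sp_after True a = tens f"
proof (cases "f = []")
  case True
  show ?thesis by (rule that[of 1]) (simp_all add: True sp_constant)
next
  case False
  then obtain g where f: "f = [rg (J g)]" using assms by (auto simp: optional_JR_def)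
  show ?thesis by (rule that[of "J g"]) (simp_all add: f sp_left sp_J sp_after_def d_J del: J_scale)
qed

lemma act_replicate_D: "foldr act (replicate j D) (frag_of (None, Deriv 1 0)) \<sim>\<^sub>V frag_of (None, Deriv 1 j)"
proof (induction j)
  case (Suc j)
  have "foldr act (replicate (Suc j) D) (frag_of (None, Deriv 1 0)) \<sim>\<^sub>V act D (frag_of (None, Deriv 1 j))"
    using act_cong[OF _ Suc, of D] by simp
  also have "\<dots> \<sim>\<^sub>V sact Dsym (frag_of (None, Deriv 1 j))" by (rule act_symb)
  also have "\<dots> \<sim>\<^sub>V frag_of (None, Deriv 1 (Suc j))"
    using ncong_add[OF ncong_refl[of "frag_of (None, Deriv 1 (Suc j))"] ncong_zero_words(2)[of None j]] by simp
  finally show ?case .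
qed simp

text \<open>In each of the four shapes the tensor acts on the unit by producing one model word whose
  entries are those of the tensor, with 1 for absent factors. The splitting sends 1 back to the
  empty tensor and integrals to themselves.\<close>

lemma rho_value_normal:
  assumes k: "k \<in> K" and bs: "bs \<in> normal_lists"
  shows "rho_value (pure k bs) = pure k bs"
proof -
  let ?v = "frag_of (None, Deriv 1 0)"
  have gm: "bs \<in> lists gen_module" using bs by (rule normal_lists_gen_module)
  have main: "rho_value (pure k bs) = pure k bs" if "foldr act bs ?v \<sim>\<^sub>V y" "lin rho (lmul k y) = pure k bs" for y
    using that rho_value_cls[of "frag_of (k, bs)"] k gm lin_rho_cong[OF lmul_cong[OF that(1), of k]] by (simp add: pure_cls)
  note [simp del] = tens_one foldr_replicate
  note one = tens_one
  from bs show ?thesis unfolding normal_lists_def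
  proof (elim UnE CollectE exE conjE)
    fix f j assume b: "bs = f @ replicate j D" and f: "f \<in> optional_JR"
    obtain a where a: "\<And>x. foldr act f x = lmul a x" "\<And>k. k \<in> K \<Longrightarrow> sp (k * a) = sc k *\<^sub>T tens f" "f \<noteq> [] \<Longrightarrow> sp_after True a = tens f" by (rule optional_JR_value[OF f], rule that)
    show ?thesis
    proof (rule main)
      show "foldr act bs ?v \<sim>\<^sub>V lmul a (frag_of (None, Deriv 1 j))"
        unfolding b by (simp add: a lmul_cong act_replicate_D del: lmul_of)
      show "lin rho (lmul k (lmul a (frag_of (None, Deriv 1 j)))) = pure k bs"
        using optional_JR_gen_module[OF f] k by (simp add: rho_pair one a b pure_eq[of k "f @ _"] tens_append T.m_assoc)
    qed
  next
    fix f g assume b: "bs = f @ [I] @ g" and f: "f \<in> optional_JR" and g: "g \<in> optional_JR"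
    obtain a where a: "\<And>x. foldr act f x = lmul a x" "\<And>k. k \<in> K \<Longrightarrow> sp (k * a) = sc k *\<^sub>T tens f" "f \<noteq> [] \<Longrightarrow> sp_after True a = tens f" by (rule optional_JR_value[OF f], rule that)
    obtain c where c: "\<And>x. foldr act g x = lmul c x" "\<And>k. k \<in> K \<Longrightarrow> sp (k * c) = sc k *\<^sub>T tens g" "g \<noteq> [] \<Longrightarrow> sp_after True c = tens g" by (rule optional_JR_value[OF g], rule that)
    have c1: "sp c = tens g" using c(2)[of 1] optional_JR_gen_module[OF g] by (simp add: one)
    have "act I (frag_of (None, Deriv c 0)) \<sim>\<^sub>V frag_of (None, Integ 1 c)" using act_symb[of Isym "frag_of (None, Deriv c 0)"] by simp
    show ?thesis
    proof (rule main)
      show "foldr act bs ?v \<sim>\<^sub>V lmul a (frag_of (None, Integ 1 c))"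
        unfolding b using lmul_cong[OF \<open>act I _ \<sim>\<^sub>V _\<close>] by (simp add: a c)
      show "lin rho (lmul k (lmul a (frag_of (None, Integ 1 c)))) = pure k bs"
        using optional_JR_gen_module[OF f] optional_JR_gen_module[OF g] k
        by (simp add: rho_pair one a c1 b pure_eq[of k "f @ _"] sp_after_def tens_append tens_Cons[of I g] T.m_assoc)
    qed
  next
    fix f \<phi> h j assume b: "bs = f @ [F \<phi>] @ h @ replicate j D" and f: "f \<in> optional_JR" and h: "h \<in> optional_JR" and \<phi>: "\<phi> \<in> \<Phi>"
    obtain a where a: "\<And>x. foldr act f x = lmul a x" "\<And>k. k \<in> K \<Longrightarrow> sp (k * a) = sc k *\<^sub>T tens f" "f \<noteq> [] \<Longrightarrow> sp_after True a = tens f" by (rule optional_JR_value[OF f], rule that)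
    obtain c where c: "\<And>x. foldr act h x = lmul c x" "\<And>k. k \<in> K \<Longrightarrow> sp (k * c) = sc k *\<^sub>T tens h" "h \<noteq> [] \<Longrightarrow> sp_after True c = tens h" by (rule optional_JR_value[OF h], rule that)
    have c1: "sp c = tens h" using c(2)[of 1] optional_JR_gen_module[OF h] by (simp add: one)
    have "foldr act (h @ replicate j D) ?v \<sim>\<^sub>V frag_of (None, Deriv c j)"
      using lmul_cong[OF act_replicate_D[of j], of c] by (simp add: c)
    from act_cong[OF _ this, of "F \<phi>"] \<phi> have "act (F \<phi>) (foldr act (h @ replicate j D) ?v) \<sim>\<^sub>V act (F \<phi>) (frag_of (None, Deriv c j))" by simp
    also have "\<dots> \<sim>\<^sub>V frag_of (Some (1, \<phi>), Deriv c j)" using act_symb[of "Fsym \<phi>" "frag_of (None, Deriv c j)"] by simp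
    finally have *: "act (F \<phi>) (foldr act (h @ replicate j D) ?v) \<sim>\<^sub>V frag_of (Some (1, \<phi>), Deriv c j)" .
    show ?thesis
    proof (rule main)
      show "foldr act bs ?v \<sim>\<^sub>V lmul a (frag_of (Some (1, \<phi>), Deriv c j))"
        unfolding b using lmul_cong[OF *, of a] by (simp add: a)
      show "lin rho (lmul k (lmul a (frag_of (Some (1, \<phi>), Deriv c j)))) = pure k bs"
        using optional_JR_gen_module[OF f] optional_JR_gen_module[OF h] k \<phi>
        by (simp add: rho_pair one a c1 b pure_eq[of k "f @ _"] tens_append tens_Cons[of "F \<phi>" "h @ replicate j D"] T.m_assoc)
    qed
  next
    fix f \<phi> h g assume b: "bs = f @ [F \<phi>] @ h @ [I] @ g" and f: "f \<in> optional_JR" and h: "h \<in> optional_JR" and g: "g \<in> optional_JR"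
      and \<phi>: "\<phi> \<in> \<Phi>" and nE: "\<not> (\<phi> = E \<and> h = [])"
    obtain a where a: "\<And>x. foldr act f x = lmul a x" "\<And>k. k \<in> K \<Longrightarrow> sp (k * a) = sc k *\<^sub>T tens f" "f \<noteq> [] \<Longrightarrow> sp_after True a = tens f" by (rule optional_JR_value[OF f], rule that)
    obtain c where c: "\<And>x. foldr act h x = lmul c x" "\<And>k. k \<in> K \<Longrightarrow> sp (k * c) = sc k *\<^sub>T tens h" "h \<noteq> [] \<Longrightarrow> sp_after True c = tens h"
      by (rule optional_JR_value[OF h], rule that)
    obtain e where e: "\<And>x. foldr act g x = lmul e x" "\<And>k. k \<in> K \<Longrightarrow> sp (k * e) = sc k *\<^sub>T tens g" "g \<noteq> [] \<Longrightarrow> sp_after True e = tens g" by (rule optional_JR_value[OF g], rule that)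
    have c1: "sp c = tens h" using c(2)[of 1] optional_JR_gen_module[OF h] by (simp add: one)
    have e1: "sp e = tens g" using e(2)[of 1] optional_JR_gen_module[OF g] by (simp add: one)
    \<comment> \<open>The one place where the exclusion of \<open>E\<close> directly before
      \<integral> is used: behind \<open>E\<close> the factor \<open>h\<close> is present, hence has
      no constant part to lose.\<close>
    have c2: "sp_after (\<phi> = E) c = tens h" using nE c(3) c1 by (cases "\<phi> = E") (auto simp: sp_after_def)
    have "act I (frag_of (None, Deriv e 0)) \<sim>\<^sub>V frag_of (None, Integ 1 e)" using act_symb[of Isym "frag_of (None, Deriv e 0)"] by simp
    from lmul_cong[OF this, of c] have "foldr act (h @ [I] @ g) ?v \<sim>\<^sub>V frag_of (None, Integ c e)" by (simp add: c e)
    from act_cong[OF _ this, of "F \<phi>"] \<phi> have "act (F \<phi>) (foldr act (h @ [I] @ g) ?v) \<sim>\<^sub>V act (F \<phi>) (frag_of (None, Integ c e))" by simp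
    also have "\<dots> \<sim>\<^sub>V frag_of (Some (1, \<phi>), Integ c e)" using act_symb[of "Fsym \<phi>" "frag_of (None, Integ c e)"] by simp
    finally have *: "act (F \<phi>) (foldr act (h @ [I] @ g) ?v) \<sim>\<^sub>V frag_of (Some (1, \<phi>), Integ c e)" .
    show ?thesis
    proof (rule main)
      show "foldr act bs ?v \<sim>\<^sub>V lmul a (frag_of (Some (1, \<phi>), Integ c e))"
        unfolding b using lmul_cong[OF *, of a] by (simp add: a)
      show "lin rho (lmul k (lmul a (frag_of (Some (1, \<phi>), Integ c e)))) = pure k bs"
        using optional_JR_gen_module[OF f] optional_JR_gen_module[OF h] optional_JR_gen_module[OF g] k \<phi>
        by (simp add: rho_pair one a c2 e1 b pure_eq[of k "f @ _"] tens_append tens_Cons[of "F \<phi>" "h @ I # g"] tens_Cons[of I g] T.m_assoc)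
    qed
  qed
qed

definition normal_span :: "'r tensor set" where
  "normal_span = additive_span {pure k bs | k bs. k \<in> K \<and> bs \<in> normal_lists}"

lemma normal_span_generators: "{pure k bs | k bs. k \<in> K \<and> bs \<in> normal_lists} \<subseteq> carrier T"
  by (auto simp del: in_lists_conv_set intro!: pure_in dest: normal_lists_gen_module)

text \<open>\<open>rho_value\<close> is the identity on normal tensors and zero on the
  ideal.\<close>

lemma normal_span_ideal: "x \<in> normal_span \<Longrightarrow> x \<in> IDO_ideal \<Longrightarrow> x = \<zero>\<^bsub>T\<^esub>"
proof -
  assume x: "x \<in> normal_span" "x \<in> IDO_ideal"
  from x(1) normal_span_generators have "rho_value x = x" unfolding normal_span_def
  proof (induction x rule: span_induct)
    case zero
    then show ?case using rho_value_cls[of 0] by simp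
  next
    case (diff x y)
    then show ?case using span_carrier[OF normal_span_generators] by (auto simp: rho_value_diff subset_iff)
  qed (auto simp: rho_value_normal)
  then show ?thesis using rho_value_ideal[OF x(2)] by simp
qed

end

subsection \<open>Irreducible words\<close>

fun spec_prefix :: "letter list \<Rightarrow> letter list \<Rightarrow> bool" where
  "spec_prefix [] V = True"
| "spec_prefix (w # W) [] = False"
| "spec_prefix (w # W) (v # V) = (v \<in> letter_spec w \<and> spec_prefix W V)"

lemma spec_prefix_iff: "(\<exists>S\<in>specializations W. prefix S V) \<longleftrightarrow> spec_prefix W V"
proof (induction W V rule: spec_prefix.induct)
  case (1 V)
  then show ?case by (auto simp: specializations_def)
next
  case (2 w W)
  then show ?case by (auto simp: specializations_def list_all2_Cons1)
next
  case (3 w W v V)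
  have "(\<exists>S\<in>specializations (w # W). prefix S (v # V)) \<longleftrightarrow> v \<in> letter_spec w \<and> (\<exists>S\<in>specializations W. prefix S V)"
    unfolding specializations_def by (auto simp: list_all2_Cons1 intro: exI[where x = "v # _"])
  then show ?case using 3 by simp
qed

definition rule_words :: "letter list set" where
  "rule_words = {[L\<^sub>K], [L\<^sub>R, L\<^sub>R], [L\<^sub>D, L\<^sub>R], [L\<^sub>D, L\<^sub>\<Phi>], [L\<^sub>D, L\<^sub>I], [L\<^sub>\<Phi>, L\<^sub>R, L\<^sub>\<Phi>], [L\<^sub>\<Phi>, L\<^sub>\<Phi>], [L\<^sub>E, L\<^sub>I],
     [L\<^sub>I, L\<^sub>R, L\<^sub>D], [L\<^sub>I, L\<^sub>R, L\<^sub>\<Phi>], [L\<^sub>I, L\<^sub>R, L\<^sub>I], [L\<^sub>I, L\<^sub>D], [L\<^sub>I, L\<^sub>\<Phi>], [L\<^sub>I, L\<^sub>I]}"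

text \<open>A sublist is a prefix of a suffix, so avoidance of the rule words can be tested one
  suffix at a time, which makes the analysis a computation.\<close>

fun irred :: "letter list \<Rightarrow> bool" where
  "irred [] = True"
| "irred (v # V) \<longleftrightarrow> v \<in> letters_X \<and> (\<forall>W\<in>rule_words. \<not> spec_prefix W (v # V)) \<and> irred V"

lemma irred_iff: "irred V \<longleftrightarrow> V \<in> lists letters_X \<and> \<not> (\<exists>W\<in>rule_words. \<exists>S\<in>specializations W. sublist S V)"
proof (induction V)
  case Nil
  have "[] \<notin> specializations W" if "W \<in> rule_words" for W
    using that by (auto simp: rule_words_def specializations_def)
  then show ?case by auto
next
  case (Cons v V)
  show ?case unfolding irred.simps Cons sublist_Cons_right spec_prefix_iff[symmetric] by auto
qed

definition optional_Rt :: "letter list set" where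
  "optional_Rt = {[], [L\<^sub>R\<^sub>t]}"

text \<open>The irreducible words stripped of a possible ring letter in front. The empty word is
  among them as the power 0 of \<partial>.\<close>

definition headless_words :: "letter list set" where
  "headless_words = {replicate j L\<^sub>D | j. True} \<union> {L\<^sub>I # s | s. s \<in> optional_Rt} \<union>
    {p # s @ replicate j L\<^sub>D | p s j. p \<in> {L\<^sub>E, L\<^sub>\<Phi>\<^sub>t} \<and> s \<in> optional_Rt} \<union>
    {p # s @ L\<^sub>I # t | p s t. p \<in> {L\<^sub>E, L\<^sub>\<Phi>\<^sub>t} \<and> s \<in> optional_Rt \<and> t \<in> optional_Rt \<and> \<not> (p = L\<^sub>E \<and> s = [])}"

lemma irred_D: "irred (replicate j L\<^sub>D)"
proof (induction j)
  case (Suc j)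
  then show ?case by (cases j) (simp_all add: rule_words_def letters_X_def)
qed simp

lemma irred_headless:
  assumes "w \<in> headless_words" shows "irred w \<and> irred (L\<^sub>R\<^sub>t # w)"
proof -
  have D: "irred (p # replicate j L\<^sub>D) \<and> irred (L\<^sub>R\<^sub>t # p # replicate j L\<^sub>D) \<and>
      irred (p # L\<^sub>R\<^sub>t # replicate j L\<^sub>D) \<and> irred (L\<^sub>R\<^sub>t # p # L\<^sub>R\<^sub>t # replicate j L\<^sub>D)" if "p \<in> {L\<^sub>E, L\<^sub>\<Phi>\<^sub>t}" for j p
    using irred_D[of j] that by (cases j) (auto simp: rule_words_def letters_X_def)
  have R: "irred (L\<^sub>R\<^sub>t # replicate j L\<^sub>D)" for j
    using irred_D[of j] by (cases j) (auto simp: rule_words_def letters_X_def)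
  from assms show ?thesis
    unfolding headless_words_def
  proof (elim UnE CollectE exE conjE)
    fix s assume "w = L\<^sub>I # s" "s \<in> optional_Rt"
    then show ?thesis by (auto simp: optional_Rt_def rule_words_def letters_X_def)
  next
    fix p s j assume "w = p # s @ replicate j L\<^sub>D" "p \<in> {L\<^sub>E, L\<^sub>\<Phi>\<^sub>t}" "s \<in> optional_Rt"
    moreover from this have "s = [] \<or> s = [L\<^sub>R\<^sub>t]" by (simp add: optional_Rt_def)
    ultimately show ?thesis using D[of p j] by (elim disjE) (simp_all del: irred.simps insert_iff)
  next
    fix p s t assume "w = p # s @ L\<^sub>I # t" "p \<in> {L\<^sub>E, L\<^sub>\<Phi>\<^sub>t}" "s \<in> optional_Rt" "t \<in> optional_Rt" "\<not> (p = L\<^sub>E \<and> s = [])"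
    then show ?thesis by (auto simp: optional_Rt_def rule_words_def letters_X_def)
  qed (use irred_D R in blast)
qed

lemma headless_D: "replicate j L\<^sub>D \<in> headless_words" "[] \<in> headless_words"
  by (auto simp: headless_words_def intro: exI[of _ j] exI[of _ 0])

text \<open>A letter is prepended to a word already known to have the right shape. The rules leave
  few choices: a ring letter or \<partial> cannot precede a ring letter, \<partial> can precede only
  powers of \<partial>, \<integral> at most one ring letter and nothing else, and a functional no
  second functional, even across a ring letter.\<close>

lemma irred_normal: "irred V \<Longrightarrow> \<exists>r\<in>optional_Rt. \<exists>w\<in>headless_words. V = r @ w"
proof (induction V)
  case Nil
  show ?case using headless_D(2) by (auto simp: optional_Rt_def)
next
  case (Cons v V)
  then obtain r w where rw: "r \<in> optional_Rt" "w \<in> headless_words" "V = r @ w" by auto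
  have no: "\<not> spec_prefix W (v # V)" if "W \<in> rule_words" for W
    using Cons.prems that by simp
  have mem: "[L\<^sub>K] \<in> rule_words" "[L\<^sub>R, L\<^sub>R] \<in> rule_words" "[L\<^sub>D, L\<^sub>R] \<in> rule_words" "[L\<^sub>D, L\<^sub>\<Phi>] \<in> rule_words" "[L\<^sub>D, L\<^sub>I] \<in> rule_words"
    "[L\<^sub>\<Phi>, L\<^sub>R, L\<^sub>\<Phi>] \<in> rule_words" "[L\<^sub>\<Phi>, L\<^sub>\<Phi>] \<in> rule_words" "[L\<^sub>E, L\<^sub>I] \<in> rule_words" "[L\<^sub>I, L\<^sub>R, L\<^sub>D] \<in> rule_words"
    "[L\<^sub>I, L\<^sub>R, L\<^sub>\<Phi>] \<in> rule_words" "[L\<^sub>I, L\<^sub>R, L\<^sub>I] \<in> rule_words" "[L\<^sub>I, L\<^sub>D] \<in> rule_words" "[L\<^sub>I, L\<^sub>\<Phi>] \<in> rule_words" "[L\<^sub>I, L\<^sub>I] \<in> rule_words"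
    by (simp_all add: rule_words_def)
  have "v \<in> letters_X" using Cons.prems by simp
  then have v: "v \<in> {L\<^sub>R\<^sub>t, L\<^sub>D, L\<^sub>I, L\<^sub>E, L\<^sub>\<Phi>\<^sub>t}"
    using no[OF mem(1)] by (auto simp: letters_X_def)
  have r: "r = [] \<or> r = [L\<^sub>R\<^sub>t]" using rw(1) by (simp add: optional_Rt_def)
  have hd: "w = [] \<or> hd w \<in> {L\<^sub>D, L\<^sub>I, L\<^sub>E, L\<^sub>\<Phi>\<^sub>t}"
    using rw(2) unfolding headless_words_def by (elim UnE CollectE exE conjE) auto
  have "v = L\<^sub>R\<^sub>t \<Longrightarrow> r = []" "v = L\<^sub>D \<Longrightarrow> r = []"
    using no[OF mem(2)] no[OF mem(3)] rw(3) r by auto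
  moreover have "w = []" if "v = L\<^sub>I"
    using hd r that rw(3) no[OF mem(12)] no[OF mem(13)] no[OF mem(14)] no[OF mem(9)] no[OF mem(10)] no[OF mem(11)]
    by (cases w) auto
  moreover have "\<exists>j. w = replicate j L\<^sub>D" if "v = L\<^sub>D"
  proof -
    have "V = w" using \<open>v = L\<^sub>D \<Longrightarrow> r = []\<close> that rw(3) by simp
    then show ?thesis using that rw(2) no[OF mem(4)] no[OF mem(5)] unfolding headless_words_def
      by (elim UnE CollectE exE conjE) auto
  qed
  moreover have "(\<exists>j. w = replicate j L\<^sub>D) \<or> (\<exists>t\<in>optional_Rt. w = L\<^sub>I # t \<and> \<not> (v = L\<^sub>E \<and> r = []))" if "v \<in> {L\<^sub>E, L\<^sub>\<Phi>\<^sub>t}"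
    using rw(2) unfolding headless_words_def
  proof (elim UnE CollectE exE conjE)
    fix s assume "w = L\<^sub>I # s" "s \<in> optional_Rt"
    then show ?thesis using no[OF mem(8)] rw(3) by auto
  next
    fix p s j assume "w = p # s @ replicate j L\<^sub>D" "p \<in> {L\<^sub>E, L\<^sub>\<Phi>\<^sub>t}"
    then show ?thesis using no[OF mem(7)] no[OF mem(6)] rw(3) r that by auto
  next
    fix p s t assume "w = p # s @ L\<^sub>I # t" "p \<in> {L\<^sub>E, L\<^sub>\<Phi>\<^sub>t}"
    then show ?thesis using no[OF mem(7)] no[OF mem(6)] rw(3) r that by auto
  qed auto
  ultimately consider "v = L\<^sub>R\<^sub>t" "r = []" | j where "v = L\<^sub>D" "r = []" "w = replicate j L\<^sub>D" | "v = L\<^sub>I" "w = []"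
    | j where "v \<in> {L\<^sub>E, L\<^sub>\<Phi>\<^sub>t}" "w = replicate j L\<^sub>D" | t where "v \<in> {L\<^sub>E, L\<^sub>\<Phi>\<^sub>t}" "t \<in> optional_Rt" "w = L\<^sub>I # t" "\<not> (v = L\<^sub>E \<and> r = [])"
    using v by blast
  then show ?case
  proof cases
    case 1
    then show ?thesis using rw by (intro bexI[of _ "[L\<^sub>R\<^sub>t]"] bexI[of _ w]) (auto simp: optional_Rt_def)
  next
    case (2 j)
    then show ?thesis using rw headless_D(1)[of "Suc j"] by (intro bexI[of _ "[]"] bexI[of _ "replicate (Suc j) L\<^sub>D"]) (auto simp: optional_Rt_def)
  next
    case 3
    then have "v # V \<in> headless_words" using rw by (auto simp: headless_words_def)
    then show ?thesis by (intro bexI[of _ "[]"] bexI[of _ "v # V"]) (auto simp: optional_Rt_def)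
  next
    case (4 j)
    then have "v # V \<in> headless_words" using rw by (auto simp: headless_words_def)
    then show ?thesis by (intro bexI[of _ "[]"] bexI[of _ "v # V"]) (auto simp: optional_Rt_def)
  next
    case (5 t)
    then have "v # V \<in> headless_words" using rw by (auto simp: headless_words_def)
    then show ?thesis by (intro bexI[of _ "[]"] bexI[of _ "v # V"]) (auto simp: optional_Rt_def)
  qed
qed

context ido_functionals
begin

declare split_paired_Ex [simp del] split_paired_All [simp del]

text \<open>A word counts as a left-hand side only if a homomorphism for it exists. The redexes
  supply one for each word; for rules with functionals \<open>E\<close> is always available as an
  instance.\<close>

lemma rule_words_eq: "(\<exists>h. (W, h) \<in> \<Sigma>_IDO) \<longleftrightarrow> W \<in> rule_words"
proof
  show "\<exists>h. (W, h) \<in> \<Sigma>_IDO \<Longrightarrow> W \<in> rule_words"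
    unfolding \<Sigma>_IDO_def rule_def rule_words_def by blast
  have "\<exists>h. (W, h) \<in> \<Sigma>_IDO" if "redex W bs v" for W bs v using that by (auto simp: redex_def)
  note red = this
  show "W \<in> rule_words \<Longrightarrow> \<exists>h. (W, h) \<in> \<Sigma>_IDO"
    unfolding rule_words_def
    by (elim insertE; (elim emptyE)?; hypsubst)
       (rule red[OF redex_K] red[OF redex_RR] red[OF redex_DR] red[OF redex_DPhi[OF evaluation_in]] red[OF redex_DI]
         red[OF redex_PhiRPhi[OF evaluation_in evaluation_in]] red[OF redex_PhiPhi[OF evaluation_in evaluation_in]] red[OF redex_EI]
         red[OF redex_IRD] red[OF redex_IRPhi[OF evaluation_in]] red[OF redex_IRI] red[OF redex_ID] red[OF redex_IPhi[OF evaluation_in]] red[OF redex_II])+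
qed

lemma irreducible_word_iff: "irreducible_word \<Sigma>_IDO V \<longleftrightarrow> (\<exists>r\<in>optional_Rt. \<exists>w\<in>headless_words. V = r @ w)"
proof -
  have "irreducible_word \<Sigma>_IDO V \<longleftrightarrow> irred V"
    unfolding irreducible_word_def irred_iff using rule_words_eq by fastforce
  moreover have "irred V \<longleftrightarrow> (\<exists>r\<in>optional_Rt. \<exists>w\<in>headless_words. V = r @ w)"
  proof
    assume "\<exists>r\<in>optional_Rt. \<exists>w\<in>headless_words. V = r @ w"
    then obtain r w where "r \<in> optional_Rt" "w \<in> headless_words" "V = r @ w" by blast
    moreover from this have "r = [] \<or> r = [L\<^sub>R\<^sub>t]" by (simp add: optional_Rt_def)
    ultimately show "irred V" using irred_headless[of w] by (elim disjE) (simp_all del: irred.simps)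
  qed (rule irred_normal)
  ultimately show ?thesis by simp
qed

section \<open>Matching normal tensors with irreducible words\<close>

definition headless :: "'r gens list set" where
  "headless = {replicate j D | j. True} \<union> {I # g | g. g \<in> optional_JR} \<union>
    {F \<phi> # h @ replicate j D | \<phi> h j. \<phi> \<in> \<Phi> \<and> h \<in> optional_JR} \<union>
    {F \<phi> # h @ I # g | \<phi> h g. \<phi> \<in> \<Phi> \<and> h \<in> optional_JR \<and> g \<in> optional_JR \<and> \<not> (\<phi> = E \<and> h = [])}"

lemma normal_lists_eq: "normal_lists = {f @ w | f w. f \<in> optional_JR \<and> w \<in> headless}"
  unfolding normal_lists_def headless_def
  by (rule Set.set_eqI) (simp only: Un_iff mem_Collect_eq append_Cons append_Nil, blast)

abbreviation base_match :: "letter list \<Rightarrow> 'r gens list \<Rightarrow> bool" where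
  "base_match \<equiv> list_all2 (\<lambda>w b. b \<in> letter_base w)"

lemma base_match_optional: "f \<in> optional_JR \<longleftrightarrow> (\<exists>r\<in>optional_Rt. base_match r f)"
proof -
  have "f \<in> optional_JR \<longleftrightarrow> f = [] \<or> (\<exists>b\<in>rg ` range J. f = [b])"
    unfolding optional_JR_def by blast
  also have "\<dots> \<longleftrightarrow> (\<exists>r\<in>optional_Rt. base_match r f)"
    unfolding optional_Rt_def by (simp add: list_all2_Cons1 del: split_paired_Ex) blast
  finally show ?thesis .
qed

lemma base_match_replicate: "base_match (replicate j L\<^sub>D) bs \<longleftrightarrow> bs = replicate j D"
proof (induction j arbitrary: bs)
  case (Suc j)
  then show ?case by (cases bs) simp_all
qed simp

lemma base_match_headless: "w \<in> headless \<longleftrightarrow> (\<exists>V\<in>headless_words. base_match V w)"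
proof
  assume "w \<in> headless"
  then show "\<exists>V\<in>headless_words. base_match V w"
    unfolding headless_def
  proof (elim UnE CollectE exE conjE)
    fix j assume "w = replicate j D"
    then show ?thesis by (intro bexI[of _ "replicate j L\<^sub>D"]) (auto simp: base_match_replicate headless_words_def)
  next
    fix g assume "w = I # g" "g \<in> optional_JR"
    then obtain s where "s \<in> optional_Rt" "base_match s g" using base_match_optional by blast
    then show ?thesis using \<open>w = _\<close> by (intro bexI[of _ "L\<^sub>I # s"]) (auto simp: headless_words_def)
  next
    fix \<phi> h j assume *: "w = F \<phi> # h @ replicate j D" "\<phi> \<in> \<Phi>" "h \<in> optional_JR"
    then obtain s where s: "s \<in> optional_Rt" "base_match s h" using base_match_optional by blast
    then have "base_match (s @ replicate j L\<^sub>D) (h @ replicate j D)" by (intro list_all2_appendI) (simp_all add: base_match_replicate)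
    with s * show ?thesis by (intro bexI[of _ "(if \<phi> = E then L\<^sub>E else L\<^sub>\<Phi>\<^sub>t) # s @ replicate j L\<^sub>D"]) (auto simp: headless_words_def)
  next
    fix \<phi> h g assume *: "w = F \<phi> # h @ I # g" "\<phi> \<in> \<Phi>" "h \<in> optional_JR" "g \<in> optional_JR" "\<not> (\<phi> = E \<and> h = [])"
    then obtain s t where s: "s \<in> optional_Rt" "base_match s h" "t \<in> optional_Rt" "base_match t g" using base_match_optional by blast
    then have "base_match (s @ L\<^sub>I # t) (h @ I # g)" by (intro list_all2_appendI) simp_all
    moreover have "\<not> (\<phi> = E \<and> s = [])" using * s by auto
    ultimately show ?thesis using s *
      by (intro bexI[of _ "(if \<phi> = E then L\<^sub>E else L\<^sub>\<Phi>\<^sub>t) # s @ L\<^sub>I # t"]) (auto simp: headless_words_def)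
  qed
next
  assume "\<exists>V\<in>headless_words. base_match V w"
  then obtain V where V: "V \<in> headless_words" "base_match V w" by blast
  have P: "\<exists>\<phi>\<in>\<Phi>. b = F \<phi> \<and> (p = L\<^sub>E \<longleftrightarrow> \<phi> = E)" if "p \<in> {L\<^sub>E, L\<^sub>\<Phi>\<^sub>t}" "b \<in> letter_base p" for p b
    using that by auto
  from V(1) show "w \<in> headless"
    unfolding headless_words_def
  proof (elim UnE CollectE exE conjE)
    fix j assume "V = replicate j L\<^sub>D"
    then show ?thesis using V(2) by (auto simp: base_match_replicate headless_def)
  next
    fix s assume "V = L\<^sub>I # s" "s \<in> optional_Rt"
    then show ?thesis using V(2) base_match_optional by (auto simp: headless_def list_all2_Cons1)
  next
    fix p s j assume *: "V = p # s @ replicate j L\<^sub>D" "p \<in> {L\<^sub>E, L\<^sub>\<Phi>\<^sub>t}" "s \<in> optional_Rt"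
    then obtain b h where "b \<in> letter_base p" "base_match s h" "w = b # h @ replicate j D"
      using V(2) by (auto simp: list_all2_Cons1 list_all2_append1 base_match_replicate)
    then show ?thesis using P[OF *(2)] * base_match_optional unfolding headless_def by blast
  next
    fix p s t assume *: "V = p # s @ L\<^sub>I # t" "p \<in> {L\<^sub>E, L\<^sub>\<Phi>\<^sub>t}" "s \<in> optional_Rt" "t \<in> optional_Rt" "\<not> (p = L\<^sub>E \<and> s = [])"
    then obtain b h g where b: "b \<in> letter_base p" "base_match s h" "base_match t g" "w = b # h @ I # g"
      using V(2) by (auto simp: list_all2_Cons1 list_all2_append1)
    obtain \<phi> where "\<phi> \<in> \<Phi>" "b = F \<phi>" "p = L\<^sub>E \<longleftrightarrow> \<phi> = E" using P[OF *(2) b(1)] by blast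
    moreover have "h = [] \<longleftrightarrow> s = []" using b(2) by auto
    ultimately show ?thesis using b * base_match_optional unfolding headless_def by blast
  qed
qed

text \<open>Splitting functionals into \<open>E\<close> and the others makes the side condition on
  \<open>E\<close> and \<integral> in the tensors the same as the one in the words.\<close>

lemma normal_lists_words: "bs \<in> normal_lists \<longleftrightarrow> (\<exists>V. irreducible_word \<Sigma>_IDO V \<and> base_match V bs)"
proof
  assume "bs \<in> normal_lists"
  then obtain f w r V where "bs = f @ w" "r \<in> optional_Rt" "base_match r f" "V \<in> headless_words" "base_match V w"
    unfolding normal_lists_eq base_match_optional base_match_headless by blast
  then show "\<exists>V. irreducible_word \<Sigma>_IDO V \<and> base_match V bs"
    unfolding irreducible_word_iff by (blast intro: list_all2_appendI)
next
  assume "\<exists>V. irreducible_word \<Sigma>_IDO V \<and> base_match V bs"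
  then obtain r w where "r \<in> optional_Rt" "w \<in> headless_words" "base_match (r @ w) bs"
    unfolding irreducible_word_iff by blast
  then show "bs \<in> normal_lists"
    unfolding normal_lists_eq mem_Collect_eq base_match_optional base_match_headless by (auto simp: list_all2_append1)
qed

lemma irreducibles_eq: "irreducibles \<Sigma>_IDO = normal_span"
proof
  let ?U = "\<Union>W\<in>{W. irreducible_word \<Sigma>_IDO W}. word_module W"
  have U: "?U \<subseteq> carrier T" using word_module_carrier by auto
  show "irreducibles \<Sigma>_IDO \<subseteq> normal_span"
    unfolding irreducibles_def normal_span_def
  proof (rule span_minimal[OF UN_least normal_span_generators])
    fix W assume "W \<in> {W. irreducible_word \<Sigma>_IDO W}"
    then show "word_module W \<subseteq> additive_span {pure k bs |k bs. k \<in> K \<and> bs \<in> normal_lists}"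
      unfolding word_module_span using normal_lists_words by (intro span_mono[OF _ normal_span_generators]) blast
  qed
  show "normal_span \<subseteq> irreducibles \<Sigma>_IDO"
    unfolding irreducibles_def normal_span_def
  proof (rule span_mono[OF _ U], safe)
    fix k bs assume "k \<in> K" "bs \<in> normal_lists"
    then obtain V where "irreducible_word \<Sigma>_IDO V" "base_match V bs" using normal_lists_words by blast
    moreover from this have "pure k bs \<in> word_module V" unfolding word_module_span using \<open>k \<in> K\<close> by (intro span_incl) blast
    ultimately show "pure k bs \<in> ?U" by blast
  qed
qed

subsection \<open>Every tensor can be reduced\<close>

abbreviation step :: "'r tensor \<Rightarrow> 'r tensor \<Rightarrow> bool" where "step \<equiv> reduces_step \<Sigma>_IDO"

lemma step_iff: "step t s \<longleftrightarrow> (\<exists>W h A B a w b r. (W, h) \<in> \<Sigma>_IDO \<and> a \<in> word_module A \<and> w \<in> word_module W \<and> b \<in> word_module B \<and>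
    r \<in> carrier T \<and> t = r +\<^sub>T a *\<^sub>T w *\<^sub>T b \<and> s = r +\<^sub>T a *\<^sub>T h w *\<^sub>T b)"
  unfolding reduces_step_def by blast

lemma rule_closed: "(W, h) \<in> \<Sigma>_IDO \<Longrightarrow> w \<in> word_module W \<Longrightarrow> h w \<in> carrier T"
  unfolding \<Sigma>_IDO_def rule_def bimodule_homs_def by blast

lemma word_module_in: "a \<in> word_module A \<Longrightarrow> a \<in> carrier T"
  using word_module_carrier by blast

lemma step_add:
  assumes "step t s" "x \<in> carrier T" shows "step (t +\<^sub>T x) (s +\<^sub>T x)"
proof -
  from assms(1) obtain W h A B a w b r where *: "(W, h) \<in> \<Sigma>_IDO" "a \<in> word_module A" "w \<in> word_module W" "b \<in> word_module B"
    "r \<in> carrier T" "t = r +\<^sub>T a *\<^sub>T w *\<^sub>T b" "s = r +\<^sub>T a *\<^sub>T h w *\<^sub>T b" unfolding step_iff by blast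
  have "r +\<^sub>T y +\<^sub>T x = r +\<^sub>T x +\<^sub>T y" if "y \<in> carrier T" for y
    using that * assms(2) by (simp add: T.a_ac)
  moreover have "a *\<^sub>T w *\<^sub>T b \<in> carrier T" "a *\<^sub>T h w *\<^sub>T b \<in> carrier T"
    using * word_module_in rule_closed by simp_all
  ultimately have "t +\<^sub>T x = (r +\<^sub>T x) +\<^sub>T a *\<^sub>T w *\<^sub>T b" "s +\<^sub>T x = (r +\<^sub>T x) +\<^sub>T a *\<^sub>T h w *\<^sub>T b" using * by auto
  moreover have "r +\<^sub>T x \<in> carrier T" using * assms(2) by simp
  ultimately show ?thesis unfolding step_iff using * by blast
qed

lemma word_module_span_carrier: "{pure c ms | c ms. c \<in> K \<and> list_all2 (\<lambda>w m. m \<in> letter_module w) W ms} \<subseteq> carrier T"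
  by (auto simp del: in_lists_conv_set intro!: pure_in dest: list_all2_gen_module(1))

lemma word_module_minus: "a \<in> word_module A \<Longrightarrow> \<ominus>\<^bsub>T\<^esub> a \<in> word_module A"
  unfolding word_module_def by (rule span_minus[OF _ word_module_span_carrier])

text \<open>The sign is absorbed by the left context, since word modules are closed under
  negation.\<close>

lemma step_minus:
  assumes "step t s" shows "step (\<ominus>\<^bsub>T\<^esub> t) (\<ominus>\<^bsub>T\<^esub> s)"
proof -
  from assms(1) obtain W h A B a w b r where *: "(W, h) \<in> \<Sigma>_IDO" "a \<in> word_module A" "w \<in> word_module W" "b \<in> word_module B"
    "r \<in> carrier T" "t = r +\<^sub>T a *\<^sub>T w *\<^sub>T b" "s = r +\<^sub>T a *\<^sub>T h w *\<^sub>T b" unfolding step_iff by blast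
  have c: "a \<in> carrier T" "b \<in> carrier T" "w \<in> carrier T" "h w \<in> carrier T"
    using * word_module_in rule_closed by auto
  have "\<ominus>\<^bsub>T\<^esub> t = \<ominus>\<^bsub>T\<^esub> r +\<^sub>T (\<ominus>\<^bsub>T\<^esub> a) *\<^sub>T w *\<^sub>T b" "\<ominus>\<^bsub>T\<^esub> s = \<ominus>\<^bsub>T\<^esub> r +\<^sub>T (\<ominus>\<^bsub>T\<^esub> a) *\<^sub>T h w *\<^sub>T b"
    using * c by (simp_all add: T.minus_add T.l_minus)
  moreover have "\<ominus>\<^bsub>T\<^esub> r \<in> carrier T" using * by simp
  ultimately show ?thesis unfolding step_iff using * word_module_minus[OF *(2)] by blast
qed

lemma pure_word_module: "c \<in> K \<Longrightarrow> list_all2 (\<lambda>w m. m \<in> letter_module w) A ms \<Longrightarrow> pure c ms \<in> word_module A"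
  unfolding word_module_def by (intro span_incl) blast

text \<open>The scalar of the right factor enters the last slot of the left one; letter modules are
  stable under right scalars, so the word does not change.\<close>

lemma pure_mult_word_module:
  assumes c: "c \<in> K" and ms: "list_all2 (\<lambda>w m. m \<in> letter_module w) A ms" and a: "a \<in> word_module B"
  shows "pure c ms *\<^sub>T a \<in> word_module (A @ B)"
proof -
  have gm: "ms \<in> lists gen_module" using ms by (rule list_all2_gen_module)
  have p: "pure c ms \<in> carrier T" using c gm by (rule pure_in)
  show ?thesis
    using a word_module_span_carrier unfolding word_module_def[of B]
  proof (induction a rule: span_induct)
    case zero
    then show ?case using p by (simp add: word_module_def)
  next
    case (incl x)
    then obtain k ns where x: "x = pure k ns" "k \<in> K" and ns: "list_all2 (\<lambda>w m. m \<in> letter_module w) B ns" by blast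
    have ngm: "ns \<in> lists gen_module" using ns by (rule list_all2_gen_module)
    show ?case
    proof (cases ms rule: rev_cases)
      case Nil
      then have "pure c ms *\<^sub>T x = pure (c * k) ns" "A = []" using x c ngm ms by (simp_all add: sc_mult_pure)
      then show ?thesis using pure_word_module[of "c * k" B ns] x c ns by simp
    next
      case (snoc us u)
      obtain V v where W: "A = V @ [v]" and V: "list_all2 (\<lambda>w m. m \<in> letter_module w) V us" and u: "u \<in> letter_module v"
        using ms snoc by (auto simp: list_all2_append2 list_all2_Cons2)
      have "pure c ms *\<^sub>T x = pure c (us @ [ract u k] @ ns)"
        using x c gm ngm snoc by (simp add: pure_mult pure_cls[symmetric])
      moreover have "list_all2 (\<lambda>w m. m \<in> letter_module w) (A @ B) (us @ [ract u k] @ ns)"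
        unfolding W append_assoc using V ns letter_module_ract[OF u x(2)] by (intro list_all2_appendI) simp_all
      ultimately show ?thesis using pure_word_module[OF c] by simp
    qed
  next
    case (diff x y)
    then have "x \<in> carrier T" "y \<in> carrier T" using span_carrier[OF word_module_span_carrier] by blast+
    then show ?case using diff p unfolding word_module_def by (simp add: T_diff_distr span_diff[OF _ _ word_module_span_carrier])
  qed
qed

text \<open>The factor is merged with the left context of the step. It must itself be homogeneous
  for some word, as contexts are.\<close>

lemma step_mult:
  assumes "step t s" "c \<in> K" "list_all2 (\<lambda>w m. m \<in> letter_module w) A0 ms"
  shows "step (pure c ms *\<^sub>T t) (pure c ms *\<^sub>T s)"
proof -
  from assms(1) obtain W h A B a w b r where *: "(W, h) \<in> \<Sigma>_IDO" "a \<in> word_module A" "w \<in> word_module W" "b \<in> word_module B"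
    "r \<in> carrier T" "t = r +\<^sub>T a *\<^sub>T w *\<^sub>T b" "s = r +\<^sub>T a *\<^sub>T h w *\<^sub>T b" unfolding step_iff by blast
  have p: "pure c ms \<in> carrier T" using assms(2) list_all2_gen_module(1)[OF assms(3)] by (rule pure_in)
  have c: "a \<in> carrier T" "b \<in> carrier T" "w \<in> carrier T" "h w \<in> carrier T"
    using * word_module_in rule_closed by auto
  have "pure c ms *\<^sub>T t = pure c ms *\<^sub>T r +\<^sub>T (pure c ms *\<^sub>T a) *\<^sub>T w *\<^sub>T b" "pure c ms *\<^sub>T s = pure c ms *\<^sub>T r +\<^sub>T (pure c ms *\<^sub>T a) *\<^sub>T h w *\<^sub>T b"
    using * c p by (simp_all add: T.r_distr T.m_assoc)
  moreover have "pure c ms *\<^sub>T r \<in> carrier T" using * p by simp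
  ultimately show ?thesis unfolding step_iff using * pure_mult_word_module[OF assms(2,3) *(2)] by blast
qed

lemma steps_map:
  assumes "\<And>t s. step t s \<Longrightarrow> step (g t) (g s)" "step\<^sup>*\<^sup>* t s" shows "step\<^sup>*\<^sup>* (g t) (g s)"
  using assms(2) by (induction rule: rtranclp_induct) (simp_all add: assms(1) rtranclp.rtrancl_into_rtrancl)

lemma normal_span_carrier: "x \<in> normal_span \<Longrightarrow> x \<in> carrier T"
  using span_carrier[OF normal_span_generators] unfolding normal_span_def by blast

lemma normal_span_closed:
  "\<zero>\<^bsub>T\<^esub> \<in> normal_span" "x \<in> normal_span \<Longrightarrow> y \<in> normal_span \<Longrightarrow> x +\<^sub>T y \<in> normal_span"
  "x \<in> normal_span \<Longrightarrow> y \<in> normal_span \<Longrightarrow> x -\<^sub>T y \<in> normal_span"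
  "x \<in> normal_span \<Longrightarrow> \<ominus>\<^bsub>T\<^esub> x \<in> normal_span"
  unfolding normal_span_def using span_diff span_minus normal_span_generators by (simp_all add: span_add)

lemma normal_span_pure: "k \<in> K \<Longrightarrow> bs \<in> normal_lists \<Longrightarrow> pure k bs \<in> normal_span"
  unfolding normal_span_def by (intro span_incl) blast

lemma normal_span_sc:
  assumes "k \<in> K" "x \<in> normal_span" shows "sc k *\<^sub>T x \<in> normal_span"
  using assms(2) normal_span_generators unfolding normal_span_def
proof (induction x rule: span_induct)
  case zero
  then show ?case using assms(1) by simp
next
  case (incl x)
  then obtain l bs where "x = pure l bs" "l \<in> K" "bs \<in> normal_lists" by blast
  then show ?case using assms(1) normal_lists_gen_module[of bs] normal_span_pure[of "k * l" bs]
    by (simp add: sc_mult_pure normal_span_def)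
next
  case (diff x y)
  then have "x \<in> carrier T" "y \<in> carrier T" using span_carrier[OF normal_span_generators] by blast+
  then show ?case using diff assms(1) span_diff[OF _ _ normal_span_generators] by (simp add: T_diff_distr)
qed

section \<open>Tensors that reduce to normal tensors\<close>

definition Red :: "'r tensor \<Rightarrow> bool" where
  "Red t \<longleftrightarrow> t \<in> carrier T \<and> (\<exists>s\<in>normal_span. step\<^sup>*\<^sup>* t s)"

lemma Red_normal: "x \<in> normal_span \<Longrightarrow> Red x"
  unfolding Red_def using normal_span_carrier by blast

lemma Red_step: "step\<^sup>*\<^sup>* t s \<Longrightarrow> t \<in> carrier T \<Longrightarrow> Red s \<Longrightarrow> Red t"
  unfolding Red_def by (blast intro: rtranclp_trans)

text \<open>One summand is reduced while the other is kept as the remainder of the step, then the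
  roles are exchanged.\<close>

lemma Red_add: "Red x \<Longrightarrow> Red y \<Longrightarrow> Red (x +\<^sub>T y)"
proof -
  assume "Red x" "Red y"
  then obtain s u where s: "x \<in> carrier T" "s \<in> normal_span" "step\<^sup>*\<^sup>* x s" and u: "y \<in> carrier T" "u \<in> normal_span" "step\<^sup>*\<^sup>* y u"
    by (auto simp: Red_def)
  have "step\<^sup>*\<^sup>* (x +\<^sub>T y) (s +\<^sub>T y)" using steps_map[of "\<lambda>z. z +\<^sub>T y", OF step_add[OF _ u(1)] s(3)] .
  also have "step\<^sup>*\<^sup>* (s +\<^sub>T y) (s +\<^sub>T u)"
    using steps_map[of "\<lambda>z. z +\<^sub>T s", OF step_add[OF _ normal_span_carrier[OF s(2)]] u(3)] s(2) u(1,2) normal_span_carrier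
    by (simp add: T.a_comm[of s])
  finally show ?thesis unfolding Red_def using s u normal_span_closed(2) by blast
qed

lemma Red_minus: "Red x \<Longrightarrow> Red (\<ominus>\<^bsub>T\<^esub> x)"
proof -
  assume "Red x"
  then obtain s where s: "x \<in> carrier T" "s \<in> normal_span" "step\<^sup>*\<^sup>* x s" by (auto simp: Red_def)
  then show ?thesis unfolding Red_def using steps_map[of "\<lambda>z. \<ominus>\<^bsub>T\<^esub> z", OF step_minus s(3)] normal_span_closed(4) by blast
qed

lemma Red_diff: "Red x \<Longrightarrow> Red y \<Longrightarrow> Red (x -\<^sub>T y)"
  unfolding T.minus_eq by (intro Red_add Red_minus)

lemma Red_zero: "Red \<zero>\<^bsub>T\<^esub>"
  by (intro Red_normal normal_span_closed)

lemma Red_sc: assumes k: "k \<in> K" and "Red x" shows "Red (sc k *\<^sub>T x)"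
proof -
  obtain s where s: "x \<in> carrier T" "s \<in> normal_span" "step\<^sup>*\<^sup>* x s" using assms by (auto simp: Red_def)
  have "step\<^sup>*\<^sup>* (sc k *\<^sub>T x) (sc k *\<^sub>T s)" using steps_map[of "\<lambda>z. sc k *\<^sub>T z", OF step_mult[OF _ k, of _ _ "[]" "[]"] s(3)] by simp
  then show ?thesis unfolding Red_def using s k normal_span_sc[OF k s(2)] by auto
qed

lemma bases_letter: "b \<in> bases \<Longrightarrow> \<exists>w. b \<in> letter_base w"
  unfolding bases_def by (auto intro: exI[of _ L\<^sub>R] exI[of _ L\<^sub>D] exI[of _ L\<^sub>I] exI[of _ L\<^sub>\<Phi>])

lemma bases_word: "bs \<in> lists bases \<Longrightarrow> \<exists>A. base_match A bs"
proof (induction bs)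
  case (Cons b bs)
  then have b: "b \<in> bases" and bs: "bs \<in> lists bases" by simp_all
  obtain w where "b \<in> letter_base w" using bases_letter[OF b] by blast
  moreover obtain A where "base_match A bs" using Cons.IH[OF bs] by blast
  ultimately show ?case by (intro exI[of _ "w # A"]) simp
qed simp

lemma bases_lists: "bs \<in> lists bases \<Longrightarrow> bs \<in> lists gen_module"
  by (auto simp: bases_gen_module)

lemma tens_word_module: "base_match A bs \<Longrightarrow> tens bs \<in> word_module A"
  unfolding word_module_span by (intro span_incl CollectI exI[of _ 1] exI[of _ bs]) simp

lemma Red_redex:
  assumes red: "redex W bs v" and pre: "pre \<in> lists bases" "post \<in> lists bases" and R: "Red (tens pre *\<^sub>T v *\<^sub>T tens post)"
  shows "Red (tens (pre @ bs @ post))"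
proof -
  obtain h where h: "(W, h) \<in> \<Sigma>_IDO" "base_match W bs" "h (tens bs) = v" using red by (auto simp: redex_def)
  obtain A B where AB: "base_match A pre" "base_match B post" using bases_word pre by blast
  have gm: "bs \<in> lists gen_module" using h(2) by (rule list_all2_gen_module)
  have c: "tens pre \<in> carrier T" "tens bs \<in> carrier T" "tens post \<in> carrier T" "v \<in> carrier T"
    using bases_lists[OF pre(1)] bases_lists[OF pre(2)] gm rule_closed[OF h(1) tens_word_module[OF h(2)]] h(3) by auto
  have "tens (pre @ bs @ post) = \<zero>\<^bsub>T\<^esub> +\<^sub>T tens pre *\<^sub>T tens bs *\<^sub>T tens post"
    using bases_lists[OF pre(1)] bases_lists[OF pre(2)] gm c by (simp add: tens_append T.m_assoc)
  moreover have "tens pre *\<^sub>T v *\<^sub>T tens post = \<zero>\<^bsub>T\<^esub> +\<^sub>T tens pre *\<^sub>T h (tens bs) *\<^sub>T tens post" using c h(3) by simp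
  ultimately have "step (tens (pre @ bs @ post)) (tens pre *\<^sub>T v *\<^sub>T tens post)"
    unfolding step_iff using h(1) tens_word_module[OF AB(1)] tens_word_module[OF h(2)] tens_word_module[OF AB(2)] T.zero_closed by blast
  then have "step\<^sup>*\<^sup>* (tens (pre @ bs @ post)) (tens pre *\<^sub>T v *\<^sub>T tens post)" by (rule r_into_rtranclp)
  moreover have "tens (pre @ bs @ post) \<in> carrier T"
    using bases_lists[OF pre(1)] bases_lists[OF pre(2)] gm by simp
  ultimately show ?thesis using R by (rule Red_step)
qed

abbreviation RL :: "'r gens list \<Rightarrow> bool" where "RL bs \<equiv> Red (tens bs)"

lemma RL_normal: "bs \<in> normal_lists \<Longrightarrow> RL bs"
  by (intro Red_normal normal_span_pure) simp

lemma bases_simps [simp]: "rg f \<in> bases" "D \<in> bases" "I \<in> bases" "\<phi> \<in> \<Phi> \<Longrightarrow> F \<phi> \<in> bases"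
  by (auto simp: bases_def)

text \<open>Splitting f into E f and an integral is an identity in the tensor ring. A reduction is
  needed only for the constant part, where the scalar moves out and the remaining ring element 1 is
  removed by the rule for K.\<close>

lemma RL_split:
  assumes w: "w \<in> lists bases" and "RL w" "\<And>h. RL (rg (J h) # w)"
  shows "RL (rg f # w)"
proof -
  have gm: "w \<in> lists gen_module" using w by (rule bases_lists)
  have one: "RL (rg 1 # w)"
    using Red_redex[OF redex_K, of "[]" w] w assms(2) gm by simp
  have "tens (rg f # w) = tens (rg (E f) # w) +\<^sub>T tens (rg (J (d f)) # w)"
    using pure_add_slot[of 1 "rg (E f)" "rg (J (d f))" "[]" w] gm evaluation_decomp[of f] by (simp add: rg_add[symmetric])
  moreover have "tens (rg (E f) # w) = sc (E f) *\<^sub>T tens (rg 1 # w)"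
    using pure_first[of 1 "E f" "rg 1" w] gm by (simp add: sc_mult_pure)
  ultimately show ?thesis using Red_add[OF Red_sc[OF _ one] assms(3)] by simp
qed

text \<open>As for a leading ring element, except that the scalar of the constant part has to cross
  the symbol in front.\<close>

lemma RL_split_symbol:
  assumes w: "w \<in> lists bases" and s: "s \<in> symbols" and "RL (sy 1 s # w)" "\<And>h. RL (sy 1 s # rg (J h) # w)"
  shows "RL (sy 1 s # rg f # w)"
proof -
  have gm: "w \<in> lists gen_module" "sy 1 s \<in> gen_module" using bases_lists[OF w] s by simp_all
  have sb: "sy 1 s \<in> bases" using s by auto
  have one: "RL (sy 1 s # rg 1 # w)"
    using Red_redex[OF redex_K, of "[sy 1 s]" w] w sb assms(3) gm by (simp add: pure_mult_tens del: sy_in)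
  have "tens (sy 1 s # rg f # w) = tens (sy 1 s # rg (E f) # w) +\<^sub>T tens (sy 1 s # rg (J (d f)) # w)"
    using pure_add_slot[of 1 "rg (E f)" "rg (J (d f))" "[sy 1 s]" w] gm evaluation_decomp[of f] by (simp add: rg_add[symmetric])
  moreover have "tens (sy 1 s # rg (E f) # w) = sc (E f) *\<^sub>T tens (sy 1 s # rg 1 # w)"
    using pure_balance[of 1 "E f" "sy 1 s" "rg 1" "[]" w] pure_first[of 1 "E f" "sy 1 s" "rg 1 # w"] gm by (simp add: sc_mult_pure)
  ultimately show ?thesis using Red_add[OF Red_sc[OF _ one] assms(4)] by simp
qed

lemma optional_bases: "f \<in> optional_JR \<Longrightarrow> f \<in> lists bases"
  by (auto simp: optional_JR_def)

lemma headless_bases: "w \<in> headless \<Longrightarrow> w \<in> lists bases"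
  using optional_bases by (auto simp: headless_def)

lemma optional_simps [simp]: "[] \<in> optional_JR" "[rg (J f)] \<in> optional_JR"
  by (auto simp: optional_JR_def)

lemma headless_Nil [simp]: "[] \<in> headless" "replicate j D \<in> headless"
  by (auto simp: headless_def intro: exI[of _ 0])

lemma RL_headless: "w \<in> headless \<Longrightarrow> f \<in> optional_JR \<Longrightarrow> RL (f @ w)"
  by (intro RL_normal) (auto simp: normal_lists_eq)

lemma RL_rg: assumes "w \<in> headless" shows "RL (rg f # w)"
proof (rule RL_split[OF headless_bases[OF assms]])
  show "RL w" using RL_headless[OF assms, of "[]"] by simp
  show "RL (rg (J h) # w)" for h using RL_headless[OF assms, of "[rg (J h)]"] by simp
qed

lemma optional_cases:
  assumes "f \<in> optional_JR" obtains "f = []" | g where "f = [rg (J g)]"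
  using assms by (auto simp: optional_JR_def)

lemma RL_rg_mult:
  assumes w: "w \<in> headless" and f: "f \<in> optional_JR" shows "RL (rg r # f @ w)"
  using f
proof (cases rule: optional_cases)
  case 1
  then show ?thesis using RL_rg[OF w] by simp
next
  case (2 g)
  have "w \<in> lists gen_module" using headless_bases[OF w] by (rule bases_lists)
  then show ?thesis
    using Red_redex[OF redex_RR[of r "J g"], of "[]" w] headless_bases[OF w] RL_rg[OF w] 2 by (simp add: pure_mult_tens)
qed

text \<open>The Leibniz rule moves \<partial> behind the ring factor. There it joins a power of
  \<partial>, cancels with \<integral>, or is annihilated by a functional.\<close>

lemma RL_D:
  assumes w: "w \<in> headless" and f: "f \<in> optional_JR" shows "RL (D # f @ w)"
proof -
  have cont: "RL (p @ D # w)" if p: "p \<in> optional_JR" for p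
    using w unfolding headless_def
  proof (elim UnE CollectE exE conjE)
    fix j assume "w = replicate j D"
    then show ?thesis using RL_headless[OF headless_Nil(2)[of "Suc j"] p] by simp
  next
    fix g assume wg: "w = I # g" "g \<in> optional_JR"
    have gm: "p \<in> lists gen_module" "g \<in> lists gen_module" by (rule optional_JR_gen_module[OF p], rule optional_JR_gen_module[OF wg(2)])
    \<comment> \<open>After the cancellation of \<partial> and \<integral> two ring factors may meet
      and have to be multiplied and split again.\<close>
    have "RL (p @ g)" using p
    proof (cases rule: optional_cases)
      case 1
      then show ?thesis using RL_headless[OF headless_Nil(1) wg(2)] by simp
    next
      case (2 a)
      then show ?thesis using RL_rg_mult[OF headless_Nil(1) wg(2)] by simp
    qed
    then show ?thesis
      using Red_redex[OF redex_DI, of p g] optional_bases[OF p] optional_bases[OF wg(2)] gm wg by (simp add: pure_mult_tens)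
  next
    fix \<phi> h j assume *: "w = F \<phi> # h @ replicate j D" "\<phi> \<in> \<Phi>" "h \<in> optional_JR"
    have "h @ replicate j D \<in> lists bases" using optional_bases[OF *(3)] by auto
    then show ?thesis
      using Red_redex[OF redex_DPhi[OF *(2)], of p "h @ replicate j D"] optional_bases[OF p] bases_lists[of p] bases_lists[of "h @ replicate j D"] * Red_zero by simp
  next
    fix \<phi> h g assume *: "w = F \<phi> # h @ I # g" "\<phi> \<in> \<Phi>" "h \<in> optional_JR" "g \<in> optional_JR"
    have "h @ I # g \<in> lists bases" using optional_bases[OF *(3)] optional_bases[OF *(4)] by auto
    then show ?thesis
      using Red_redex[OF redex_DPhi[OF *(2)], of p "h @ I # g"] optional_bases[OF p] bases_lists[of p] bases_lists[of "h @ I # g"] * Red_zero by simp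
  qed
  from f show ?thesis
  proof (cases rule: optional_cases)
    case 1
    then show ?thesis using cont[of "[]"] by simp
  next
    case (2 a)
    have gm: "w \<in> lists gen_module" using headless_bases[OF w] by (rule bases_lists)
    have "Red (tens (rg (J a) # D # w) +\<^sub>T tens (rg (d (J a)) # w))"
      using cont[of "[rg (J a)]"] RL_rg[OF w] by (intro Red_add) auto
    then show ?thesis
      using Red_redex[OF redex_DR[of "J a"], of "[]" w] headless_bases[OF w] gm 2 by (simp add: T.l_distr pure_mult_tens)
  qed
qed

text \<open>In front of another functional the two collapse to a scalar multiple of the second. In
  front of a power of \<partial> or of \<integral> the word is already normal, except for
  \<open>E\<close> directly before \<integral>, which reduces to zero.\<close>

lemma RL_F:
  assumes w: "w \<in> headless" and f: "f \<in> optional_JR" and \<psi>: "\<psi> \<in> \<Phi>" shows "RL (F \<psi> # f @ w)"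
proof -
  have phi: "RL (F \<psi> # f @ F \<phi> # y)" if y: "F \<phi> # y \<in> headless" "\<phi> \<in> \<Phi>" for \<phi> y
  proof -
    have b: "y \<in> lists bases" using headless_bases[OF y(1)] by simp
    have gm: "y \<in> lists gen_module" using b by (rule bases_lists)
    have R: "Red (sc k *\<^sub>T tens (F \<phi> # y))" if "k \<in> K" for k
      using Red_sc[OF that] RL_headless[OF y(1), of "[]"] by simp
    have e: "tens [sy k (Fsym \<phi>)] *\<^sub>T tens y = sc k *\<^sub>T tens (F \<phi> # y)" if "k \<in> K" for k
      using gen_sy[of k "Fsym \<phi>"] that y gm tens_Cons[of "F \<phi>" y] by (simp add: T.m_assoc)
    from f show ?thesis
    proof (cases rule: optional_cases)
      case 1
      then show ?thesis using Red_redex[OF redex_PhiPhi[OF \<psi> y(2)], of "[]" y] b R[of "\<psi> 1"] e[of "\<psi> 1"] \<psi> y(2) by simp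
    next
      case (2 a)
      then show ?thesis using Red_redex[OF redex_PhiRPhi[OF \<psi> y(2), of "J a"], of "[]" y] b R[of "\<psi> (J a)"] e[of "\<psi> (J a)"] \<psi> y(2) by simp
    qed
  qed
  from w show ?thesis unfolding headless_def
  proof (elim UnE CollectE exE conjE)
    fix j assume "w = replicate j D"
    then have "F \<psi> # f @ w \<in> headless" using f \<psi> by (auto simp: headless_def)
    then show ?thesis using RL_headless[of _ "[]"] by simp
  next
    fix g assume wg: "w = I # g" "g \<in> optional_JR"
    show ?thesis
    proof (cases "\<psi> = E \<and> f = []")
      case True
      then show ?thesis using Red_redex[OF redex_EI, of "[]" g] optional_bases[OF wg(2)] bases_lists[of g] wg Red_zero by simp
    next
      case False
      then have "F \<psi> # f @ w \<in> headless" using f \<psi> wg unfolding headless_def by blast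
      then show ?thesis using RL_headless[of _ "[]"] by simp
    qed
  next
    fix \<phi> h j assume *: "w = F \<phi> # h @ replicate j D" "\<phi> \<in> \<Phi>"
    then show ?thesis using phi w by simp
  next
    fix \<phi> h g assume *: "w = F \<phi> # h @ I # g" "\<phi> \<in> \<Phi>"
    then show ?thesis using phi w by simp
  qed
qed

lemma T_diff_distr_2: "a \<in> carrier T \<Longrightarrow> b \<in> carrier T \<Longrightarrow> c \<in> carrier T \<Longrightarrow> x \<in> carrier T \<Longrightarrow>
    (a -\<^sub>T b -\<^sub>T c) *\<^sub>T x = a *\<^sub>T x -\<^sub>T b *\<^sub>T x -\<^sub>T c *\<^sub>T x"
  by (simp add: T_diff_distr)

text \<open>The coefficient is an arbitrary ring element, because the induction differentiates it
  and leaves the range of \<open>J\<close>.\<close>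

lemma RL_I_D: "RL (I # rg f # replicate j D)"
proof (induction j arbitrary: f)
  case 0
  have "I # g \<in> headless" if "g \<in> optional_JR" for g using that by (auto simp: headless_def)
  then have g: "RL (I # g)" if "g \<in> optional_JR" for g using that RL_headless[of "I # g" "[]"] by simp
  have "RL (sy 1 Isym # rg f # [])"
    by (rule RL_split_symbol) (use g[of "[]"] g[of "[rg (J h)]" for h] in simp_all)
  then show ?case by simp
next
  case (Suc j)
  have E: "RL (F E # rg f # replicate j D)"
  proof (rule RL_split_symbol)
    show "RL (F E # replicate j D)" using RL_F[OF headless_Nil(2)[of j] _ evaluation_in, of "[]"] by simp
    show "RL (F E # rg (J h) # replicate j D)" for h using RL_F[OF headless_Nil(2)[of j] _ evaluation_in, of "[rg (J h)]"] by simp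
  qed auto
  have "Red (tens (rg f # replicate j D) -\<^sub>T tens (F E # rg f # replicate j D) -\<^sub>T tens (I # rg (d f) # replicate j D))"
    by (intro Red_diff RL_rg E Suc headless_Nil)
  then show ?case
    using Red_redex[OF redex_IRD[of f], of "[]" "replicate j D"] by (simp add: T_diff_distr_2 pure_mult_tens)
qed

text \<open>Powers of \<partial> fall to \<open>RL_I_D\<close>, a functional absorbs \<integral>
  into the ring factor before it, and a second \<integral> is removed by integration by
  parts.\<close>

lemma RL_I:
  assumes w: "w \<in> headless" and f: "f \<in> optional_JR" shows "RL (I # f @ w)"
  using w unfolding headless_def
proof (elim UnE CollectE exE conjE)
  fix j assume w: "w = replicate j D"
  from f show ?thesis
  proof (cases rule: optional_cases)
    case 1
    show ?thesis
    proof (cases j)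
      case 0
      have "[I] \<in> headless" by (auto simp: headless_def)
      then show ?thesis using RL_headless[of "[I]" "[]"] 0 1 w by simp
    next
      case (Suc i)
      have "Red (tens (replicate i D) -\<^sub>T tens (F E # replicate i D))"
        using RL_headless[OF headless_Nil(2)[of i], of "[]"] RL_F[OF headless_Nil(2)[of i] _ evaluation_in, of "[]"] by (intro Red_diff) simp_all
      then show ?thesis
        using Red_redex[OF redex_ID, of "[]" "replicate i D"] 1 w Suc by (simp add: T_diff_distr pure_mult_tens)
    qed
  next
    case (2 a)
    then show ?thesis using RL_I_D w by simp
  qed
next
  fix g assume wg: "w = I # g" "g \<in> optional_JR"
  have g: "g \<in> lists bases" "g \<in> lists gen_module" by (rule optional_bases[OF wg(2)], rule optional_JR_gen_module[OF wg(2)])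
  have wI: "I # g \<in> headless" using wg by (auto simp: headless_def)
  \<comment> \<open>The last term of integration by parts puts \<open>J a\<close> next to the
    trailing factor. Their product need not be an integral, so it is split by the case of power
    0.\<close>
  have "RL (I # rg (J a) # g)" for a
    using wg(2)
  proof (cases rule: optional_cases)
    case 1
    then show ?thesis using RL_I_D[of "J a" 0] by simp
  next
    case (2 b)
    then show ?thesis using Red_redex[OF redex_RR[of "J a" "J b"], of "[I]" "[]"] RL_I_D[of "J a * J b" 0] by (simp add: pure_mult_tens)
  qed
  then have R: "Red (tens (rg (J a) # I # g) -\<^sub>T tens (F E # rg (J a) # I # g) -\<^sub>T tens (I # rg (J a) # g))" for a
    using RL_rg[OF wI] RL_F[OF wI _ evaluation_in, of "[rg (J a)]"] by (intro Red_diff) auto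
  from f show ?thesis
  proof (cases rule: optional_cases)
    case 1
    then show ?thesis using Red_redex[OF redex_II, of "[]" g] R[of 1] wg g by (simp add: T_diff_distr_2 pure_mult_tens)
  next
    case (2 a)
    then show ?thesis using Red_redex[OF redex_IRI[of "J a"], of "[]" g] R[of "J a"] wg g by (simp add: T_diff_distr_2 pure_mult_tens)
  qed
next
  have phi: "RL (I # f @ F \<phi> # y)" if y: "F \<phi> # y \<in> headless" "\<phi> \<in> \<Phi>" for \<phi> y
  proof -
    have b: "y \<in> lists bases" "y \<in> lists gen_module" using headless_bases[OF y(1)] bases_lists[of y] by simp_all
    from f show ?thesis
    proof (cases rule: optional_cases)
      case 1
      then show ?thesis using Red_redex[OF redex_IPhi[OF y(2)], of "[]" y] RL_rg[OF y(1), of "J 1"] b y(2) by (simp add: pure_mult_tens)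
    next
      case (2 a)
      then show ?thesis using Red_redex[OF redex_IRPhi[OF y(2), of "J a"], of "[]" y] RL_rg[OF y(1), of "J (J a)"] b y(2) by (simp add: pure_mult_tens)
    qed
  qed
  {
    fix \<phi> h j assume *: "w = F \<phi> # h @ replicate j D" "\<phi> \<in> \<Phi>"
    then show ?thesis using phi w by simp
  next
    fix \<phi> h g assume *: "w = F \<phi> # h @ I # g" "\<phi> \<in> \<Phi>"
    then show ?thesis using phi w by simp
  }
qed

lemma RL_Cons: "b \<in> bases \<Longrightarrow> bs \<in> normal_lists \<Longrightarrow> RL (b # bs)"
  unfolding bases_def normal_lists_eq by (auto simp: RL_rg_mult RL_D RL_I RL_F)

text \<open>Normal tensors come with a leading scalar. A ring element swallows it, a symbol lets it
  pass to the left.\<close>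

lemma bases_pass_scalar:
  assumes "b \<in> bases" "k \<in> K" obtains l b' where "l \<in> K" "b' \<in> bases" "tens [b] *\<^sub>T sc k = sc l *\<^sub>T tens [b']"
proof (cases "b \<in> range rg")
  case True
  then obtain f where "b = rg f" by blast
  then have "tens [b] *\<^sub>T sc k = sc 1 *\<^sub>T tens [rg (f * k)]" using gen_ract[of k "rg f"] assms by simp
  then show ?thesis using that[of 1 "rg (f * k)"] by simp
next
  case False
  then obtain s where "b = sy 1 s" "s \<in> symbols" using assms(1) unfolding bases_def by blast
  then show ?thesis using that[of k b] assms sy_central[of k s] by simp
qed

text \<open>The tail is reduced first, then the first letter is multiplied into every term of the
  result. Only products of one generator with a normal tensor have to be considered.\<close>

lemma RL_bases: "bs \<in> lists bases \<Longrightarrow> RL bs"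
proof (induction bs)
  case Nil
  show ?case using RL_headless[OF headless_Nil(1), of "[]"] by simp
next
  case (Cons b bs)
  then have b: "b \<in> bases" and bs: "bs \<in> lists bases" by auto
  have gm: "b \<in> gen_module" "bs \<in> lists gen_module" by (rule bases_gen_module[OF b], rule bases_lists[OF bs])
  obtain s where s: "s \<in> normal_span" "step\<^sup>*\<^sup>* (tens bs) s" using Cons.IH[OF bs] by (auto simp: Red_def)
  obtain w where w: "b \<in> letter_module w" using bases_letter[OF b] letter_base_module by blast
  have "step\<^sup>*\<^sup>* (tens [b] *\<^sub>T tens bs) (tens [b] *\<^sub>T s)"
    using steps_map[of "\<lambda>z. tens [b] *\<^sub>T z", OF step_mult[OF _ constants_one, of _ _ "[w]" "[b]"] s(2)] w by simp
  moreover have "Red (tens [b] *\<^sub>T s)"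
    using s(1) normal_span_generators unfolding normal_span_def
  proof (induction s rule: span_induct)
    case zero
    then show ?case using gm Red_zero by simp
  next
    case (incl x)
    then obtain k cs where x: "x = pure k cs" "k \<in> K" "cs \<in> normal_lists" by blast
    obtain l b' where l: "l \<in> K" "b' \<in> bases" "tens [b] *\<^sub>T sc k = sc l *\<^sub>T tens [b']" using bases_pass_scalar[OF b x(2)] .
    have cs: "cs \<in> lists gen_module" using x(3) by (rule normal_lists_gen_module)
    have "tens [b] *\<^sub>T x = tens [b] *\<^sub>T sc k *\<^sub>T tens cs" using x cs gm by (simp add: pure_eq[of k cs] T.m_assoc)
    also have "\<dots> = sc l *\<^sub>T tens (b' # cs)" unfolding l(3) using l cs bases_gen_module[OF l(2)] by (simp add: tens_Cons[of b' cs] T.m_assoc)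
    finally show ?case using Red_sc[OF l(1) RL_Cons[OF l(2) x(3)]] by simp
  next
    case (diff x y)
    then have "x \<in> carrier T" "y \<in> carrier T" using span_carrier[OF normal_span_generators] by blast+
    then show ?case using diff gm Red_diff by (simp add: T_diff_distr)
  qed
  ultimately show ?case using Red_step[of "tens (b # bs)" "tens [b] *\<^sub>T s"] gm tens_Cons[OF gm] by simp
qed

lemma Red_all: "t \<in> carrier T \<Longrightarrow> Red t"
proof -
  assume t: "t \<in> carrier T"
  have S: "{pure k bs | k bs. k \<in> K \<and> bs \<in> lists bases} \<subseteq> carrier T"
    by (auto simp del: in_lists_conv_set intro!: pure_in bases_lists)
  from t[unfolded carrier_T_bases] S show "Red t"
  proof (induction t rule: span_induct)
    case (incl x)
    then obtain k bs where "x = pure k bs" "k \<in> K" "bs \<in> lists bases" by blast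
    then show ?case using Red_sc[OF _ RL_bases[of bs], of k] bases_lists[of bs] by (simp add: pure_eq[of k bs])
  qed (auto intro: Red_zero Red_diff)
qed

subsection \<open>Normal forms and the operator ring\<close>

lemma normal_form_unique: "t \<in> carrier T \<Longrightarrow> \<exists>!s. is_normal_form \<Sigma>_IDO t s"
proof (rule ex_ex1I)
  assume t: "t \<in> carrier T"
  show "\<exists>s. is_normal_form \<Sigma>_IDO t s"
    using Red_all[OF t] unfolding Red_def is_normal_form_def irreducibles_eq by blast
  fix s s' assume "is_normal_form \<Sigma>_IDO t s" "is_normal_form \<Sigma>_IDO t s'"
  then have s: "s \<in> normal_span" "s' \<in> normal_span" "q s = q s'" "s \<in> carrier T" "s' \<in> carrier T"
    using q_steps[OF _ t] unfolding is_normal_form_def irreducibles_eq by auto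
  then have "s -\<^sub>T s' = \<zero>\<^bsub>T\<^esub>" using normal_span_ideal[OF normal_span_closed(3)] q_eq_iff by blast
  then show "s = s'" using s T_eq_iff by blast
qed

abbreviation nf :: "'r tensor \<Rightarrow> 'r tensor" where "nf \<equiv> normal_form \<Sigma>_IDO"

lemma nf: assumes "t \<in> carrier T" shows "nf t \<in> normal_span" "q (nf t) = q t" "nf t \<in> carrier T"
proof -
  have "is_normal_form \<Sigma>_IDO t (nf t)" unfolding normal_form_def by (rule theI') (rule normal_form_unique[OF assms])
  then show "nf t \<in> normal_span" "q (nf t) = q t" "nf t \<in> carrier T"
    using q_steps[OF _ assms] unfolding is_normal_form_def irreducibles_eq by auto
qed

text \<open>Normal forms are determined by their class modulo the ideal, so later identities between
  them follow from identities in the quotient without any reduction.\<close>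

lemma nf_eqI: "t \<in> carrier T \<Longrightarrow> s \<in> normal_span \<Longrightarrow> q s = q t \<Longrightarrow> nf t = s"
proof -
  assume *: "t \<in> carrier T" "s \<in> normal_span" "q s = q t"
  have "nf t -\<^sub>T s = \<zero>\<^bsub>T\<^esub>"
    using normal_span_ideal[OF normal_span_closed(3)[OF nf(1)[OF *(1)] *(2)]] q_eq_iff[OF nf(3)[OF *(1)] normal_span_carrier[OF *(2)]] nf(2)[OF *(1)] * by simp
  then show ?thesis using T_eq_iff[OF nf(3)[OF *(1)] normal_span_carrier[OF *(2)]] by blast
qed

lemma normal_span_K_span: "normal_span = K_span normal_tensors"
proof -
  have nt: "normal_tensors = tens ` normal_lists"
    unfolding normal_tensors_def normal_lists_def by (rule Set.set_eqI) (simp only: Un_iff mem_Collect_eq image_iff bex_simps, blast)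
  have e: "lsmult T k (tens bs) = pure k bs" if "k \<in> K" "bs \<in> normal_lists" for k bs
    using that normal_lists_gen_module[OF that(2)] by (simp add: sc_mult_pure)
  have "{lsmult T k x |k x. k \<in> K \<and> x \<in> normal_tensors} = {pure k bs | k bs. k \<in> K \<and> bs \<in> normal_lists}"
  proof (intro subset_antisym subsetI)
    fix y assume "y \<in> {lsmult T k x |k x. k \<in> K \<and> x \<in> normal_tensors}"
    then obtain k bs where "y = lsmult T k (tens bs)" "k \<in> K" "bs \<in> normal_lists" unfolding nt by blast
    then show "y \<in> {pure k bs | k bs. k \<in> K \<and> bs \<in> normal_lists}" using e by blast
  next
    fix y assume "y \<in> {pure k bs | k bs. k \<in> K \<and> bs \<in> normal_lists}"
    then obtain k bs where y: "y = pure k bs" "k \<in> K" "bs \<in> normal_lists" by blast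
    then have "y = lsmult T k (tens bs)" using e by metis
    then show "y \<in> {lsmult T k x |k x. k \<in> K \<and> x \<in> normal_tensors}" unfolding nt using y by blast
  qed
  then show ?thesis unfolding normal_span_def K_span_def by simp
qed

lemma IDO_simps:
  "carrier IDO = q ` carrier T" "x \<otimes>\<^bsub>IDO\<^esub> y = x \<otimes>\<^bsub>Q\<^esub> y" "x \<oplus>\<^bsub>IDO\<^esub> y = x \<oplus>\<^bsub>Q\<^esub> y"
  "\<one>\<^bsub>IDO\<^esub> = \<one>\<^bsub>Q\<^esub>" "\<zero>\<^bsub>IDO\<^esub> = \<zero>\<^bsub>Q\<^esub>" "lsmult IDO k x = q (sc k) \<otimes>\<^bsub>Q\<^esub> x" "rsmult IDO x k = x \<otimes>\<^bsub>Q\<^esub> q (sc k)"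
  using carrier_Q by (simp_all add: IDO_def q_def)

lemma K_ring_IDO: "K_ring K IDO"
proof -
  have "IDO = with_scalars Q (\<lambda>k. q (sc k))" by (simp add: IDO_def q_def)
  also have "K_ring K \<dots>"
    by (rule K_ring_with_scalars[OF Q.ring_axioms]) (simp_all add: sc_add sc_mult q_add q_mult)
  finally show ?thesis .
qed

abbreviation Irr :: "('r, 'r tensor) bimod_ring" where "Irr \<equiv> irreducible_ring \<Sigma>_IDO"

lemma Irr_simps:
  "carrier Irr = normal_span" "x \<otimes>\<^bsub>Irr\<^esub> y = nf (x *\<^sub>T y)" "x \<oplus>\<^bsub>Irr\<^esub> y = x +\<^sub>T y"
  "\<one>\<^bsub>Irr\<^esub> = \<one>\<^bsub>T\<^esub>" "\<zero>\<^bsub>Irr\<^esub> = \<zero>\<^bsub>T\<^esub>" "lsmult Irr k x = sc k *\<^sub>T x" "rsmult Irr x k = x *\<^sub>T sc k"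
  by (simp_all add: irreducible_ring_def irreducibles_eq)

lemma one_normal_span: "\<one>\<^bsub>T\<^esub> \<in> normal_span"
  using normal_span_pure[of 1 "[]"] by (simp add: T_one normal_lists_eq)

text \<open>A right scalar alters the last factor, so the generating form with a leading scalar is
  lost. It does stay in the same word module, which is why the argument goes through irreducible
  words.\<close>

lemma normal_span_right:
  assumes k: "k \<in> K" and "x \<in> normal_span" shows "x *\<^sub>T sc k \<in> normal_span"
proof -
  have S: "{pure l bs | l bs. l \<in> K \<and> bs \<in> normal_lists} \<subseteq> carrier T" by (rule normal_span_generators)
  from assms(2)[unfolded normal_span_def] S show ?thesis
  proof (induction x rule: span_induct)
    case zero
    then show ?case using k normal_span_closed by simp
  next
    case (incl x)
    then obtain l bs where x: "x = pure l bs" "l \<in> K" "bs \<in> normal_lists" by blast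
    obtain V where V: "irreducible_word \<Sigma>_IDO V" "base_match V bs" using x(3) normal_lists_words by blast
    have "list_all2 (\<lambda>w m. m \<in> letter_module w) V bs" using V(2) by (rule list_all2_mono) (rule letter_base_module)
    moreover have "sc k \<in> word_module []" using k by (intro pure_word_module) simp_all
    ultimately have "x *\<^sub>T sc k \<in> word_module (V @ [])" unfolding x(1) by (intro pure_mult_word_module x(2))
    then have "x *\<^sub>T sc k \<in> (\<Union>W\<in>{W. irreducible_word \<Sigma>_IDO W}. word_module W)" using V(1) by auto
    then show ?case unfolding irreducibles_eq[symmetric] irreducibles_def by (rule span_incl)
  next
    case (diff x y)
    then have "x \<in> carrier T" "y \<in> carrier T" using span_carrier[OF S] by blast+
    then show ?case using diff k normal_span_closed(3) by (simp add: T_diff_distr)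
  qed
qed

section \<open>The isomorphism with the ring of operators\<close>

definition ido_iso :: "'r tensor set \<Rightarrow> 'r tensor" where
  "ido_iso Y = normal_form \<Sigma>_IDO (inv_into (carrier T) q Y)"

lemma ido_iso_q: "t \<in> carrier T \<Longrightarrow> ido_iso (q t) = nf t"
proof -
  assume t: "t \<in> carrier T"
  have u: "inv_into (carrier T) q (q t) \<in> carrier T" "q (inv_into (carrier T) q (q t)) = q t"
    using inv_into_into[of "q t" q "carrier T"] f_inv_into_f[of "q t" q "carrier T"] t by simp_all
  show ?thesis unfolding ido_iso_def by (rule nf_eqI[OF u(1) nf(1)[OF t]]) (simp add: nf(2)[OF t] u(2))
qed

lemma nf_normal: "s \<in> normal_span \<Longrightarrow> nf s = s"
  by (rule nf_eqI) (auto intro: normal_span_carrier)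

text \<open>Each compatibility compares two irreducible tensors of the same class. Injectivity holds
  because a tensor and its normal form share their class.\<close>

lemma ido_iso_hom:
  shows "ido_iso ` carrier IDO = carrier Irr"
    and "x \<in> carrier IDO \<Longrightarrow> y \<in> carrier IDO \<Longrightarrow> ido_iso (x \<otimes>\<^bsub>IDO\<^esub> y) = ido_iso x \<otimes>\<^bsub>Irr\<^esub> ido_iso y"
    and "x \<in> carrier IDO \<Longrightarrow> y \<in> carrier IDO \<Longrightarrow> ido_iso (x \<oplus>\<^bsub>IDO\<^esub> y) = ido_iso x \<oplus>\<^bsub>Irr\<^esub> ido_iso y"
    and "ido_iso \<one>\<^bsub>IDO\<^esub> = \<one>\<^bsub>Irr\<^esub>" and "ido_iso \<zero>\<^bsub>IDO\<^esub> = \<zero>\<^bsub>Irr\<^esub>"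
    and "k \<in> K \<Longrightarrow> x \<in> carrier IDO \<Longrightarrow> ido_iso (lsmult IDO k x) = lsmult Irr k (ido_iso x)"
    and "k \<in> K \<Longrightarrow> x \<in> carrier IDO \<Longrightarrow> ido_iso (rsmult IDO x k) = rsmult Irr (ido_iso x) k"
    and "inj_on ido_iso (carrier IDO)"
proof -
  show "ido_iso ` carrier IDO = carrier Irr"
  proof
    show "ido_iso ` carrier IDO \<subseteq> carrier Irr" unfolding IDO_simps Irr_simps by (auto simp: ido_iso_q nf)
    show "carrier Irr \<subseteq> ido_iso ` carrier IDO"
    proof
      fix s assume "s \<in> carrier Irr"
      then have "s \<in> normal_span" "s \<in> carrier T" using normal_span_carrier by (simp_all add: Irr_simps)
      then have "s = ido_iso (q s)" "q s \<in> carrier IDO" by (simp_all add: ido_iso_q nf_normal IDO_simps)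
      then show "s \<in> ido_iso ` carrier IDO" by (rule image_eqI)
    qed
  qed
  show "ido_iso \<one>\<^bsub>IDO\<^esub> = \<one>\<^bsub>Irr\<^esub>"
    unfolding IDO_simps Irr_simps q_one[symmetric] by (simp add: ido_iso_q nf_normal one_normal_span)
  show "ido_iso \<zero>\<^bsub>IDO\<^esub> = \<zero>\<^bsub>Irr\<^esub>"
    unfolding IDO_simps Irr_simps q_zero[symmetric] by (simp add: ido_iso_q nf_normal normal_span_closed)
  show "inj_on ido_iso (carrier IDO)"
  proof (rule inj_onI)
    fix x y assume "x \<in> carrier IDO" "y \<in> carrier IDO" and eq: "ido_iso x = ido_iso y"
    then obtain t u where tu: "t \<in> carrier T" "x = q t" "u \<in> carrier T" "y = q u" unfolding IDO_simps by blast
    have "q t = q (nf t)" using nf(2)[OF tu(1)] by simp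
    also have "nf t = nf u" using eq tu by (simp add: ido_iso_q)
    also have "q (nf u) = q u" by (rule nf(2)[OF tu(3)])
    finally show "x = y" using tu by simp
  qed
  {
    assume "x \<in> carrier IDO" "y \<in> carrier IDO"
    then obtain t u where tu: "t \<in> carrier T" "x = q t" "u \<in> carrier T" "y = q u" unfolding IDO_simps by blast
    note n = nf[OF tu(1)] nf[OF tu(3)]
    show "ido_iso (x \<otimes>\<^bsub>IDO\<^esub> y) = ido_iso x \<otimes>\<^bsub>Irr\<^esub> ido_iso y"
      unfolding IDO_simps Irr_simps tu(2,4) ido_iso_q[OF tu(1)] ido_iso_q[OF tu(3)] q_mult[OF tu(1,3), symmetric]
        ido_iso_q[OF T.m_closed[OF tu(1,3)]]
      by (rule nf_eqI) (use tu n in \<open>simp_all add: nf q_mult\<close>)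
    show "ido_iso (x \<oplus>\<^bsub>IDO\<^esub> y) = ido_iso x \<oplus>\<^bsub>Irr\<^esub> ido_iso y"
      unfolding IDO_simps Irr_simps tu(2,4) ido_iso_q[OF tu(1)] ido_iso_q[OF tu(3)] q_add[OF tu(1,3), symmetric]
        ido_iso_q[OF T.a_closed[OF tu(1,3)]]
      by (rule nf_eqI) (use tu n in \<open>simp_all add: normal_span_closed q_add\<close>)
  }
  {
    assume k: "k \<in> K" and "x \<in> carrier IDO"
    then obtain t where t: "t \<in> carrier T" "x = q t" unfolding IDO_simps by blast
    note n = nf[OF t(1)]
    have sk: "sc k \<in> carrier T" using k by simp
    show "ido_iso (lsmult IDO k x) = lsmult Irr k (ido_iso x)"
      unfolding IDO_simps Irr_simps t(2) ido_iso_q[OF t(1)] q_mult[OF sk t(1), symmetric] ido_iso_q[OF T.m_closed[OF sk t(1)]]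
      by (rule nf_eqI) (use t n k in \<open>simp_all add: normal_span_sc q_mult\<close>)
    show "ido_iso (rsmult IDO x k) = rsmult Irr (ido_iso x) k"
      unfolding IDO_simps Irr_simps t(2) ido_iso_q[OF t(1)] q_mult[OF t(1) sk, symmetric] ido_iso_q[OF T.m_closed[OF t(1) sk]]
      by (rule nf_eqI) (use t n k in \<open>simp_all add: normal_span_right q_mult\<close>)
  }
qed

text \<open>The structure is transported from the quotient along \<open>ido_iso\<close>; the ring
  axioms for the normal form product are not checked by reduction.\<close>

lemma K_ring_Irr: "K_ring K Irr"
  by (rule K_ring_image[OF K_ring_IDO _ _ ido_iso_hom(1-7)]) simp_all

lemma K_ring_iso_IDO: "ido_iso \<in> K_ring_iso K IDO Irr"
  unfolding K_ring_iso_def ring_iso_def ring_hom_def bij_betw_def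
  using ido_iso_hom by (auto simp del: with_scalars_simps)

end

theorem theoremA5:
  fixes d J :: "'r::ring_1 \<Rightarrow> 'r" and \<Phi> :: "('r \<Rightarrow> 'r) set"
  assumes "ido_functionals d J \<Phi>"
  shows "(\<forall>t\<in>carrier (ido_functionals.T d \<Phi>).
      (\<exists>!s. ido_functionals.is_normal_form d J \<Phi> (ido_functionals.\<Sigma>_IDO d J \<Phi>) t s) \<and>
      ido_functionals.normal_form d J \<Phi> (ido_functionals.\<Sigma>_IDO d J \<Phi>) t
        \<in> ido_functionals.K_span d \<Phi> (ido_functionals.normal_tensors d J \<Phi>))
    \<and> K_ring (int_diff_ring.constants d) (ido_functionals.IDO d J \<Phi>)
    \<and> K_ring (int_diff_ring.constants d)
        (ido_functionals.irreducible_ring d J \<Phi> (ido_functionals.\<Sigma>_IDO d J \<Phi>))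
    \<and> K_ring_iso (int_diff_ring.constants d) (ido_functionals.IDO d J \<Phi>)
        (ido_functionals.irreducible_ring d J \<Phi> (ido_functionals.\<Sigma>_IDO d J \<Phi>)) \<noteq> {}"
proof -
  interpret ido_functionals d J \<Phi> by fact
  show ?thesis
    using normal_form_unique nf(1) K_ring_IDO K_ring_Irr K_ring_iso_IDO unfolding normal_span_K_span by blast
qed

end
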